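(* Let $d\ge 2$, let $0<q<1$, and let $Q$ be a probability measure on $\mathbb{R}^+$ with $Q\ne\delta_0$ and $Q([0,R_0])=1$ for some $R_0>0$. (i) There exists $z_1=z_1(Q,q,d)<\infty$ such that for every $z>z_1$, every CRCM$(z,Q,q)$ percolates, i.e. every CRCM$(z,Q,q)$ $P$ satisfies $P(\omega\text{ percolates})=1$. (ii) There exists $z_0=z_0(Q,q,d)>0$ such that for every $0<z<z_0$, no CRCM$(z,Q,q)$ percolates, i.e. every CRCM$(z,Q,q)$ $P$ satisfies $P(\omega\text{ percolates})=0$.
   Context: Let $d\ge 2$ and $S=\mathbb{R}^d\times\mathbb{R}^+$ with its Borel $\sigma$-algebra. A configuration is a non-negative integer-valued measure $\omega=\sum_{i\in I}\delta_{(x_i,R_i)}$ on $S$ ($I$ finite or countable) with $\omega(\Lambda\times\mathbb{R}^+)<\infty$ for every bounded $\Lambda\subset\mathbb{R}^d$. $\Omega$ is the set of configurations, with the $\sigma$-algebra $\mathcal{F}$ generated by $\omega\mapsto\omega(\Gamma)$, $\Gamma\subset S$ bounded Borel. For $\Lambda\subset\mathbb{R}^d$, $\omega_\Lambda$ is the restriction of $\omega$ to $\Lambda\times\mathbb{R}^+$, and $\Lambda^c=\mathbb{R}^d\setminus\Lambda$. Write $(x,R)\in\omega$ if $\omega(\{(x,R)\})>0$. Set $L(\omega)=\bigcup_{(x,R)\in\omega}B(x,R)$, where $B(x,R)$ is the closed Euclidean ball. Connected components of $L(\omega)$: $x,y\in\mathbb{R}^d$ are in the same connected component if there are finitely many $(x_1,R_1),\dots,(x_n,R_n)\in\omega$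 with $x\in B(x_1,R_1)$, $y\in B(x_n,R_n)$ and $B(x_i,R_i)\cap B(x_{i+1},R_{i+1})\ne\emptyset$ for $1\le i\le n-1$. The configuration $\omega$ percolates if $L(\omega)$ has at least one unbounded connected component. A probability measure on $\Omega$ percolates (resp. does not percolate) if the event $\{\omega\text{ percolates}\}$ has probability $1$ (resp. $0$). For a finite configuration, $N_{cc}(\omega)$ is the number of connected components of $L(\omega)$. For bounded $\Lambda$ and any configuration $\omega$, $N_{cc}^{\Lambda}(\omega)=\lim_{\Delta\to\mathbb{R}^d}\big(N_{cc}(\omega_\Delta)-N_{cc}(\omega_{\Delta\setminus\Lambda})\big)$, the limit being taken along any increasing sequence of bounded sets $\Delta$ (it is known to be well defined). $\pi^{z,Q}$ is the law on $\Omega$ of the homogeneous Poisson point process with spatial intensity $z$ and independent marks of law $Q$; $\pi^{z,Q}_\Lambda$ is its projection on $\Lambda\times\mathbb{R}^+$. A probability measure $P$ on $(\Omega,\mathcal{F})$ is a CRCM$(z,Q,q)$ (continuum random cluster model) if it is stationary (invariant under translations of $\mathbb{R}^d$) and for every bounded $\Lambda\subset\mathbb{R}^d$ and every bounded measurable $f$, $$\int f\,dP=\int\int f(\omega'_\Lambda+\omega_{\Lambda^c})\frac{q^{N_{cc}^\Lambda(\omega'_\Lambda+\omega_{\Lambda^c})}}{Z_\Lambda(\omega_{\Lambda^c})}\,\pi^{z,Q}_\Lambda(d\omega'_\Lambda)\,P(d\omega),$$ where $Z_\Lambda(\omega_{\Lambda^c})=\int q^{N_{cc}^\Lambda(\omega'_\Lambda+\omega_{\Lambda^c})}\pi^{z,Q}_\Lambda(d\omega'_\Lambda)$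 is assumed to be non-degenerate. *)

theory Defs
  imports "HOL-Probability.Probability"
begin

text \<open>
  A configuration on \<open>\<real>\<^sup>d \<times> \<real>\<^sup>+\<close> is a Borel measure on \<open>\<real>\<^sup>d \<times> \<real>\<close> that is carried by
  \<open>\<real>\<^sup>d \<times> [0,\<infinity>)\<close>. The push-forward of a counting measure under \<open>X\<close> is the sum of the Dirac
  masses \<open>\<delta>\<^bsub>X i\<^esub>\<close> with \<open>i \<in> I\<close>; \<open>X\<close> need not be injective, so multiple points are allowed.
\<close>

type_synonym 'n conf = "((real ^ 'n) \<times> real) measure"

definition configurations :: "('n::finite) conf set" where
  "configurations =
     {\<omega>. (\<exists>(I::nat set) X. X \<in> I \<rightarrow> UNIV \<times> {0..} \<and> \<omega> = distr (count_space I) borel X) \<and>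
         (\<forall>\<Lambda>\<in>sets borel. bounded \<Lambda> \<longrightarrow> emeasure \<omega> (\<Lambda> \<times> UNIV) < \<infinity>)}"

text \<open>
  Only the space and the \<open>\<sigma>\<close>-algebra of the following measure are used: the coarsest one
  that makes \<open>\<omega> \<mapsto> \<omega>(\<Gamma>)\<close> measurable for all bounded Borel \<open>\<Gamma>\<close>.
\<close>

definition conf_algebra :: "('n::finite) conf measure" where
  "conf_algebra = (SUP \<Gamma>\<in>{\<Gamma>\<in>sets borel. bounded \<Gamma>}.
     vimage_algebra configurations (\<lambda>\<omega>. emeasure \<omega> \<Gamma>) borel)"

definition restr :: "(real ^ 'n) set \<Rightarrow> ('n::finite) conf \<Rightarrow> 'n conf" where
  "restr \<Lambda> \<omega> = density \<omega> (indicator (\<Lambda> \<times> UNIV))"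

definition superpose :: "('n::finite) conf \<Rightarrow> 'n conf \<Rightarrow> 'n conf" where
  "superpose \<omega> \<omega>' = measure_of UNIV (sets borel) (\<lambda>A. emeasure \<omega> A + emeasure \<omega>' A)"

definition translate :: "real ^ 'n \<Rightarrow> ('n::finite) conf \<Rightarrow> 'n conf" where
  "translate a \<omega> = distr \<omega> borel (\<lambda>(x, R). (x + a, R))"

definition points :: "('n::finite) conf \<Rightarrow> ((real ^ 'n) \<times> real) set" where
  "points \<omega> = {p. emeasure \<omega> {p} > 0}"

definition germ_ball :: "(real ^ 'n) \<times> real \<Rightarrow> (real ^ 'n::finite) set" where
  "germ_ball p = cball (fst p) (snd p)"

definition covered :: "('n::finite) conf \<Rightarrow> (real ^ 'n) set" where
  "covered \<omega> = (\<Union>p\<in>points \<omega>. germ_ball p)"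

definition connected_in :: "('n::finite) conf \<Rightarrow> real ^ 'n \<Rightarrow> real ^ 'n \<Rightarrow> bool" where
  "connected_in \<omega> x y \<longleftrightarrow>
     (\<exists>ps. ps \<noteq> [] \<and> set ps \<subseteq> points \<omega> \<and> x \<in> germ_ball (hd ps) \<and> y \<in> germ_ball (last ps) \<and>
        (\<forall>i. Suc i < length ps \<longrightarrow> germ_ball (ps ! i) \<inter> germ_ball (ps ! Suc i) \<noteq> {}))"

definition conn_components :: "('n::finite) conf \<Rightarrow> (real ^ 'n) set set" where
  "conn_components \<omega> = covered \<omega> // {(x, y). connected_in \<omega> x y}"

definition percolates :: "('n::finite) conf \<Rightarrow> bool" where
  "percolates \<omega> \<longleftrightarrow> (\<exists>C\<in>conn_components \<omega>. \<not> bounded C)"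

definition N_cc :: "('n::finite) conf \<Rightarrow> nat" where
  "N_cc \<omega> = card (conn_components \<omega>)"

definition exhaustion :: "(nat \<Rightarrow> (real ^ 'n::finite) set) \<Rightarrow> bool" where
  "exhaustion \<Delta> \<longleftrightarrow>
     incseq \<Delta> \<and> (\<forall>k. \<Delta> k \<in> sets borel \<and> bounded (\<Delta> k)) \<and> (\<Union>k. \<Delta> k) = UNIV"

definition N_cc_loc :: "(real ^ 'n) set \<Rightarrow> ('n::finite) conf \<Rightarrow> int" where
  "N_cc_loc \<Lambda> \<omega> = (THE l. \<forall>\<Delta>. exhaustion \<Delta> \<longrightarrow>
     (\<lambda>k. int (N_cc (restr (\<Delta> k) \<omega>)) - int (N_cc (restr (\<Delta> k - \<Lambda>) \<omega>))) \<longlonglongrightarrow> l)"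

text \<open>
  The homogeneous Poisson process with spatial intensity \<open>z\<close> and independent marks of law \<open>Q\<close>
  is the Poisson process with intensity measure \<open>z dx \<otimes> Q(dR)\<close>.
\<close>

definition poisson_law :: "real \<Rightarrow> real measure \<Rightarrow> ('n::finite) conf measure \<Rightarrow> bool" where
  "poisson_law z Q \<pi> \<longleftrightarrow>
     prob_space \<pi> \<and> sets \<pi> = sets conf_algebra \<and>
     (\<forall>\<Gamma>\<in>sets borel. bounded \<Gamma> \<longrightarrow>
        (let m = z * measure (lborel \<Otimes>\<^sub>M Q) \<Gamma> in
         \<forall>k::nat. measure \<pi> {\<omega> \<in> space \<pi>. emeasure \<omega> \<Gamma> = of_nat k} = m ^ k / fact k * exp (- m))) \<and>
     (\<forall>(n::nat) \<Gamma>. (\<forall>i<n. \<Gamma> i \<in> sets borel \<and> bounded (\<Gamma> i)) \<and> disjoint_family_on \<Gamma> {..<n} \<longrightarrow>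
        prob_space.indep_vars \<pi> (\<lambda>_. borel) (\<lambda>i \<omega>. emeasure \<omega> (\<Gamma> i)) {..<n})"

definition project :: "(real ^ 'n) set \<Rightarrow> ('n::finite) conf measure \<Rightarrow> 'n conf measure" where
  "project \<Lambda> \<pi> = distr \<pi> conf_algebra (restr \<Lambda>)"

definition partition_fun ::
  "real \<Rightarrow> ('n::finite) conf measure \<Rightarrow> (real ^ 'n) set \<Rightarrow> 'n conf \<Rightarrow> ennreal" where
  "partition_fun q \<pi> \<Lambda> \<eta> =
     (\<integral>\<^sup>+ \<omega>'. ennreal (q powi N_cc_loc \<Lambda> (superpose \<omega>' \<eta>)) \<partial>project \<Lambda> \<pi>)"

definition stationary :: "('n::finite) conf measure \<Rightarrow> bool" where
  "stationary P \<longleftrightarrow> (\<forall>a. distr P conf_algebra (translate a) = P)"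

text \<open>
  The Poisson law \<open>\<pi>\<close> is determined uniquely by \<open>z\<close> and \<open>Q\<close>, so the existential quantifier
  merely names it. Nondegeneracy of the partition function is required for almost every
  boundary condition.
\<close>

definition CRCM :: "real \<Rightarrow> real measure \<Rightarrow> real \<Rightarrow> ('n::finite) conf measure \<Rightarrow> bool" where
  "CRCM z Q q P \<longleftrightarrow>
     prob_space P \<and> sets P = sets conf_algebra \<and> stationary P \<and>
     (\<exists>\<pi>. poisson_law z Q \<pi> \<and>
       (\<forall>\<Lambda>\<in>sets borel. bounded \<Lambda> \<longrightarrow>
          (AE \<omega> in P. 0 < partition_fun q \<pi> \<Lambda> (restr (- \<Lambda>) \<omega>) \<and>
                      partition_fun q \<pi> \<Lambda> (restr (- \<Lambda>) \<omega>) < \<infinity>) \<and>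
          (\<forall>f::'n conf \<Rightarrow> real.
             f \<in> borel_measurable conf_algebra \<and> (\<exists>B. \<forall>\<omega>\<in>configurations. \<bar>f \<omega>\<bar> \<le> B) \<longrightarrow>
             (\<integral>\<omega>. f \<omega> \<partial>P) =
             (\<integral>\<omega>. (\<integral>\<omega>'. f (superpose \<omega>' (restr (- \<Lambda>) \<omega>)) *
                       (q powi N_cc_loc \<Lambda> (superpose \<omega>' (restr (- \<Lambda>) \<omega>)) /
                        enn2real (partition_fun q \<pi> \<Lambda> (restr (- \<Lambda>) \<omega>))) \<partial>project \<Lambda> \<pi>) \<partial>P))))"

text \<open>
  Almost-sure quantification is used also for probability 0, since \<open>measure\<close> returns 0 on
  non-measurable sets.
\<close>

definition law_percolates :: "('n::finite) conf measure \<Rightarrow> bool" where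
  "law_percolates P \<longleftrightarrow> (AE \<omega> in P. percolates \<omega>)"

definition law_not_percolates :: "('n::finite) conf measure \<Rightarrow> bool" where
  "law_not_percolates P \<longleftrightarrow> (AE \<omega> in P. \<not> percolates \<omega>)"

end

theory Submission
  imports Defs
begin

text \<open>
  The difficulty for \<open>q < 1\<close> is that one ball may merge arbitrarily many components, so the density
  with respect to the Poisson process is not bounded from above. Two estimates follow from the DLR
  equations. Filling an empty region whose possible balls all touch each other creates at most one
  component, which costs at most a factor \<open>q\<close>. Conversely, if the balls in a region can merge
  at most \<open>K\<close> outside components, the probability of an event in that region is at most
  \<open>(1/q)\<^sup>K\<close> times its Poisson probability, up to the probability of the empty region.

  For large \<open>z\<close>, the first estimate shows that any \<open>n\<close> small cubes arranged in a plane are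
  simultaneously vacant with probability at most \<open>\<alpha>\<^sup>n\<close>, where \<open>\<alpha>\<close> is small. A block made of
  \<open>3 \<times> 3\<close> subblocks is called good if at most one subblock is bad. Adjacent good blocks have connected
  clusters, and the probability of being bad decays doubly exponentially in the scale; this gives an
  unbounded component without planar duality.

  For small \<open>z\<close>, percolation produces arbitrarily long paths of occupied cells. If the \<open>n\<close>
  cells of a path are occupied, consider the number \<open>M\<^sub>k\<close> of points in the \<open>k\<close>-neighbourhood of the
  path. Unless \<open>M\<^sub>k\<close> at least doubles in every step, there is a \<open>k\<close> with \<open>M\<^sub>k \<ge> 2\<^sup>k n\<close>
  whose surrounding shell contains at most \<open>M\<^sub>k\<close> points, and the second estimate bounds the probability
  by \<open>(\<beta> z)\<^sup>n\<close>, because the volume grows only polynomially in \<open>k\<close>. Doubling forever is excluded by a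
  bound on the number of points in a single cell that is uniform in the boundary condition: by the
  first estimate, one may assume that large balls cover a neighbourhood of the cell at bounded cost,
  and then the second estimate applies with \<open>K\<close> bounded.
\<close>

subsection \<open>Components of finite graphs\<close>

text \<open>Both estimates compare two integrals over the Poisson points of one bounded region with
  everything else frozen; the partition function is common to both and cancels. Since the bounds
  hold jointly with any event outside the region, they can be applied region by region, and products
  appear although the regions are dependent. In the merging estimate the number of merged components
  depends on the random number of neighbouring points, so its cost has no deterministic bound. The
  cost \<open>(1 / q) ^ M\<close> is affordable when the region itself contains \<open>M\<close>
  points, because the Poisson probability of \<open>M\<close> points carries the factor
  \<open>1 / fact M\<close>. This is why, at low intensity, a path is followed outwards until the
  surrounding shell is no richer than the interior. The side \<open>2 * R\<^sub>0\<close> of the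
  cells is the largest distance between the centres of touching balls. In a finite window the
  components are those of a finite graph on the points, so the combinatorial input is stated for
  abstract symmetric graphs.\<close>

definition adj :: "('a \<Rightarrow> 'a \<Rightarrow> bool) \<Rightarrow> 'a set \<Rightarrow> ('a \<times> 'a) set" where
  "adj T V = {(p, q). p \<in> V \<and> q \<in> V \<and> T p q}"

text \<open>The closure is reflexive, so \<open>p\<close> belongs to its own class even outside
  \<open>V\<close>; \<open>comps\<close> only uses the classes of members of
  \<open>V\<close>.\<close>

definition comp_of :: "('a \<Rightarrow> 'a \<Rightarrow> bool) \<Rightarrow> 'a set \<Rightarrow> 'a \<Rightarrow> 'a set" where
  "comp_of T V p = {q. (p, q) \<in> (adj T V)\<^sup>*}"

definition comps :: "('a \<Rightarrow> 'a \<Rightarrow> bool) \<Rightarrow> 'a set \<Rightarrow> 'a set set" where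
  "comps T V = comp_of T V ` V"

lemma adj_mono: "V \<subseteq> V' \<Longrightarrow> adj T V \<subseteq> adj T V'"
  by (auto simp: adj_def)

lemma comp_of_mono: "V \<subseteq> V' \<Longrightarrow> comp_of T V p \<subseteq> comp_of T V' p"
  unfolding comp_of_def using rtrancl_mono[OF adj_mono] by blast

lemma comp_of_subset: "p \<in> V \<Longrightarrow> comp_of T V p \<subseteq> V"
proof
  fix q assume "p \<in> V" "q \<in> comp_of T V p"
  then have "(p, q) \<in> (adj T V)\<^sup>*" by (simp add: comp_of_def)
  then show "q \<in> V" using \<open>p \<in> V\<close> by induction (auto simp: adj_def)
qed

lemma comps_subset: "C \<in> comps T V \<Longrightarrow> C \<subseteq> V"
  by (auto simp: comps_def dest: subsetD[OF comp_of_subset])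

lemma comp_of_self [simp]: "p \<in> comp_of T V p"
  by (simp add: comp_of_def)

lemma finite_comps: "finite V \<Longrightarrow> finite (comps T V)"
  by (simp add: comps_def)

lemma comps_nonempty: "C \<in> comps T V \<Longrightarrow> \<exists>x. x \<in> C"
  by (auto simp: comps_def intro: comp_of_self)

locale sym_graph =
  fixes T :: "'a \<Rightarrow> 'a \<Rightarrow> bool"
  assumes T_sym: "T p q \<Longrightarrow> T q p"
begin

lemma adj_rtrancl_sym: "(p, q) \<in> (adj T V)\<^sup>* \<Longrightarrow> (q, p) \<in> (adj T V)\<^sup>*"
  by (rule symD[OF sym_rtrancl]) (auto simp: sym_def adj_def T_sym)

lemma comp_of_eq_iff: "comp_of T V p = comp_of T V q \<longleftrightarrow> (p, q) \<in> (adj T V)\<^sup>*"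
proof
  assume "comp_of T V p = comp_of T V q"
  then have "q \<in> comp_of T V p" by simp
  then show "(p, q) \<in> (adj T V)\<^sup>*" by (simp add: comp_of_def)
next
  assume "(p, q) \<in> (adj T V)\<^sup>*"
  then show "comp_of T V p = comp_of T V q"
    unfolding comp_of_def using adj_rtrancl_sym by (auto intro: rtrancl_trans)
qed

lemma comp_of_eq: "q \<in> comp_of T V p \<Longrightarrow> comp_of T V q = comp_of T V p"
  using comp_of_eq_iff[of V p q] by (simp add: comp_of_def)

lemma comps_eqI:
  assumes "C \<in> comps T V" "q \<in> C" shows "C = comp_of T V q"
proof -
  obtain p where "C = comp_of T V p" using assms(1) by (auto simp: comps_def)
  with comp_of_eq[of q V p] assms(2) show ?thesis by simp
qed

lemma comp_of_adj: "p \<in> V \<Longrightarrow> q \<in> V \<Longrightarrow> T p q \<Longrightarrow> comp_of T V p = comp_of T V q"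
  by (subst comp_of_eq_iff) (auto simp: adj_def)

lemma comps_disjoint: "C \<in> comps T V \<Longrightarrow> C' \<in> comps T V \<Longrightarrow> x \<in> C \<Longrightarrow> x \<in> C' \<Longrightarrow> C = C'"
  using comps_eqI by metis

lemma comps_closed:
  assumes "C \<in> comps T V" "p \<in> C" "q \<in> V" "T p q" shows "q \<in> C"
proof -
  have "p \<in> V" using assms(1,2) comps_subset by blast
  then have "comp_of T V p = comp_of T V q" using assms comp_of_adj by blast
  then show ?thesis using comps_eqI[OF assms(1,2)] by simp
qed

text \<open>A walk that leaves the old component would have to step from a vertex of it directly to
  a new vertex of \<open>W\<close>.\<close>

lemma comp_of_untouched:
  assumes p: "p \<in> V" and un: "\<And>x w. x \<in> comp_of T V p \<Longrightarrow> w \<in> W \<Longrightarrow> w \<notin> V \<Longrightarrow> \<not> T x w"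
  shows "comp_of T (V \<union> W) p = comp_of T V p"
proof
  show "comp_of T V p \<subseteq> comp_of T (V \<union> W) p" by (rule comp_of_mono) auto
  show "comp_of T (V \<union> W) p \<subseteq> comp_of T V p"
  proof
    fix q assume "q \<in> comp_of T (V \<union> W) p"
    then have "(p, q) \<in> (adj T (V \<union> W))\<^sup>*" by (simp add: comp_of_def)
    then show "q \<in> comp_of T V p"
    proof induction
      case (step y z)
      have "y \<in> V" using step(3) comp_of_subset[OF p] by auto
      have "z \<in> V" using step(2) un[OF step(3), of z] by (auto simp: adj_def)
      then have "(y, z) \<in> adj T V" using step(2) \<open>y \<in> V\<close> by (auto simp: adj_def)
      then show ?case using step(3) by (auto simp: comp_of_def intro: rtrancl_into_rtrancl)
    qed simp
  qed
qed

text \<open>\<open>SOME p. p \<in> C\<close> picks one vertex per old component, so the new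
  component becomes a function of the old one and can be counted as an image.\<close>

lemma comps_Un_subset:
  "comps T (V \<union> W) \<subseteq> (\<lambda>C. comp_of T (V \<union> W) (SOME p. p \<in> C)) ` comps T V \<union> comp_of T (V \<union> W) ` W"
proof
  fix C assume "C \<in> comps T (V \<union> W)"
  then obtain p where p: "p \<in> V \<union> W" "C = comp_of T (V \<union> W) p" by (auto simp: comps_def)
  show "C \<in> (\<lambda>C. comp_of T (V \<union> W) (SOME p. p \<in> C)) ` comps T V \<union> comp_of T (V \<union> W) ` W"
  proof (cases "p \<in> W")
    case False
    then have "p \<in> V" using p by auto
    define x where "x = (SOME x. x \<in> comp_of T V p)"
    have "x \<in> comp_of T V p" unfolding x_def by (rule someI[of _ p]) simp
    then have "x \<in> comp_of T (V \<union> W) p" using comp_of_mono[of V "V \<union> W"] by blast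
    then have "C = comp_of T (V \<union> W) x" using comp_of_eq p by auto
    then show ?thesis using \<open>p \<in> V\<close> unfolding comps_def x_def by blast
  qed (use p in auto)
qed

lemma card_comps_Un_le:
  assumes "finite V" "finite W" shows "card (comps T (V \<union> W)) \<le> card (comps T V) + card W"
proof -
  have "card (comps T (V \<union> W)) \<le> card ((\<lambda>C. comp_of T (V \<union> W) (SOME p. p \<in> C)) ` comps T V \<union> comp_of T (V \<union> W) ` W)"
    by (rule card_mono[OF _ comps_Un_subset]) (use assms finite_comps in blast)
  also have "\<dots> \<le> card ((\<lambda>C. comp_of T (V \<union> W) (SOME p. p \<in> C)) ` comps T V) + card (comp_of T (V \<union> W) ` W)"
    by (rule card_Un_le)
  also have "\<dots> \<le> card (comps T V) + card W"
    by (intro add_mono card_image_le finite_comps assms)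
  finally show ?thesis .
qed

text \<open>All vertices of \<open>W\<close> lie in one and the same component, so beyond those that
  continue components of \<open>V\<close> at most one is new.\<close>

lemma card_comps_Un_clique_le:
  assumes "finite V" "finite W" and cl: "\<And>p q. p \<in> W \<Longrightarrow> q \<in> W \<Longrightarrow> T p q"
  shows "card (comps T (V \<union> W)) \<le> card (comps T V) + 1"
proof (cases "W = {}")
  case False
  then obtain w where w: "w \<in> W" by auto
  have "comp_of T (V \<union> W) ` W \<subseteq> {comp_of T (V \<union> W) w}"
  proof
    fix C assume "C \<in> comp_of T (V \<union> W) ` W"
    then obtain x where "x \<in> W" "C = comp_of T (V \<union> W) x" by auto
    then show "C \<in> {comp_of T (V \<union> W) w}" using comp_of_adj[of x "V \<union> W" w] cl w by auto
  qed
  then have sub: "comps T (V \<union> W) \<subseteq> (\<lambda>C. comp_of T (V \<union> W) (SOME p. p \<in> C)) ` comps T V \<union> {comp_of T (V \<union> W) w}"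
    using comps_Un_subset[of V W] by blast
  have "card (comps T (V \<union> W)) \<le> card ((\<lambda>C. comp_of T (V \<union> W) (SOME p. p \<in> C)) ` comps T V \<union> {comp_of T (V \<union> W) w})"
    by (rule card_mono[OF _ sub]) (use assms(1) finite_comps in blast)
  also have "\<dots> \<le> card ((\<lambda>C. comp_of T (V \<union> W) (SOME p. p \<in> C)) ` comps T V) + card {comp_of T (V \<union> W) w}"
    by (rule card_Un_le)
  also have "\<dots> \<le> card (comps T V) + 1"
    by (intro add_mono card_image_le finite_comps assms) auto
  finally show ?thesis .
qed simp

text \<open>A component without contact to a new vertex survives unchanged. Any other one has a
  vertex touching some \<open>y\<close> in \<open>Y\<close>, hence contains that \<open>y\<close>,
  so at most \<open>card Y\<close> components are lost.\<close>

lemma card_comps_le_Un: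
  assumes "finite V" "finite W" "Y \<subseteq> V"
    and touch: "\<And>p w. p \<in> V \<Longrightarrow> w \<in> W \<Longrightarrow> w \<notin> V \<Longrightarrow> T p w \<Longrightarrow> \<exists>y\<in>Y. T p y"
  shows "card (comps T V) \<le> card (comps T (V \<union> W)) + card Y"
proof -
  have "comps T V \<subseteq> comps T (V \<union> W) \<union> comp_of T V ` Y"
  proof
    fix C assume C: "C \<in> comps T V"
    then obtain p where p: "p \<in> V" "C = comp_of T V p" by (auto simp: comps_def)
    show "C \<in> comps T (V \<union> W) \<union> comp_of T V ` Y"
    proof (cases "\<exists>x\<in>C. \<exists>w\<in>W. w \<notin> V \<and> T x w")
      case True
      then obtain x w where x: "x \<in> C" "w \<in> W" "w \<notin> V" "T x w" by auto
      then have "x \<in> V" using p comp_of_subset[OF p(1)] by blast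
      then obtain y where "y \<in> Y" "T x y" using touch x by blast
      then have "comp_of T V y = C"
        using comp_of_adj[of x V y] comps_eqI[OF C x(1)] \<open>x \<in> V\<close> assms(3) by auto
      then show ?thesis using \<open>y \<in> Y\<close> by auto
    next
      case False
      then have "comp_of T (V \<union> W) p = C" using comp_of_untouched[OF p(1)] p by blast
      then show ?thesis using p by (auto simp: comps_def)
    qed
  qed
  then have "card (comps T V) \<le> card (comps T (V \<union> W) \<union> comp_of T V ` Y)"
    by (rule card_mono[rotated]) (auto intro: finite_comps assms finite_subset[OF assms(3)])
  also have "\<dots> \<le> card (comps T (V \<union> W)) + card (comp_of T V ` Y)" by (rule card_Un_le)
  also have "\<dots> \<le> card (comps T (V \<union> W)) + card Y"
    by (intro add_mono card_image_le) (auto intro: finite_subset[OF assms(3)] assms)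
  finally show ?thesis .
qed

section \<open>Effect of a single additional vertex on the number of components\<close>

definition touched :: "'a set \<Rightarrow> 'a \<Rightarrow> 'a set set" where
  "touched V p = {C\<in>comps T V. \<exists>x\<in>C. T x p}"

text \<open>The components that \<open>p\<close> touches are replaced by a single one containing
  \<open>p\<close>; the others survive unchanged.\<close>

lemma card_comps_insert:
  assumes fin: "finite V" and p: "p \<notin> V"
  shows "card (comps T (insert p V)) + card (touched V p) = card (comps T V) + 1"
proof -
  let ?V = "insert p V"
  define N where "N = comp_of T ?V p"
  have Veq: "?V = V \<union> {p}" by auto
  have sub: "C \<subseteq> V" if "C \<in> comps T V" for C
    using that by (rule comps_subset)
  have un: "C \<in> comps T ?V" if C: "C \<in> comps T V - touched V p" for C
  proof -
    obtain x where x: "x \<in> V" "C = comp_of T V x" using C by (auto simp: comps_def)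
    then have "comp_of T (V \<union> {p}) x = comp_of T V x"
      using C by (intro comp_of_untouched) (auto simp: touched_def)
    then have "C = comp_of T ?V x" using x unfolding Veq by simp
    then show ?thesis using x by (auto simp: comps_def)
  qed
  have "comps T ?V = insert N (comps T V - touched V p)"
  proof (intro equalityI subsetI)
    fix C assume C: "C \<in> comps T ?V"
    show "C \<in> insert N (comps T V - touched V p)"
    proof (cases "p \<in> C")
      case True
      then show ?thesis using comps_eqI[OF C] N_def by simp
    next
      case False
      obtain x where x: "x \<in> ?V" "C = comp_of T ?V x" using C by (auto simp: comps_def)
      have "x \<in> V" using x False by auto
      have unx: "comp_of T (V \<union> {p}) x = comp_of T V x"
      proof (rule comp_of_untouched[OF \<open>x \<in> V\<close>])
        fix y w assume y: "y \<in> comp_of T V x" "w \<in> {p}" "w \<notin> V"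
        have "y \<in> C" using y comp_of_mono[of V ?V] x by blast
        then show "\<not> T y w" using comps_closed[OF C, of y p] False y by auto
      qed
      then have CV: "C \<in> comps T V" using x \<open>x \<in> V\<close> by (auto simp: comps_def)
      moreover have "C \<notin> touched V p"
      proof
        assume "C \<in> touched V p"
        then obtain y where "y \<in> C" "T y p" by (auto simp: touched_def)
        then show False using comps_closed[OF C, of y p] False by auto
      qed
      ultimately show ?thesis by simp
    qed
  next
    fix C assume "C \<in> insert N (comps T V - touched V p)"
    then show "C \<in> comps T ?V" using un by (auto simp: N_def comps_def)
  qed
  moreover have "N \<notin> comps T V - touched V p"
    using sub p unfolding N_def by (metis DiffD1 comp_of_self subsetD)
  moreover have "touched V p \<subseteq> comps T V" by (auto simp: touched_def)
  ultimately show ?thesis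
    using finite_comps[OF fin, of T]
    by (simp add: card_Diff_subset finite_subset card_mono)
qed

text \<open>A component of the larger graph that touches \<open>p\<close> does so through a vertex
  of \<open>V\<close>, hence contains a component that touched \<open>p\<close> before. Far vertices
  can fuse such components but not create them.\<close>

lemma card_touched_antimono:
  assumes "finite V" "finite L" and far: "\<And>l. l \<in> L \<Longrightarrow> \<not> T l p"
  shows "card (touched (V \<union> L) p) \<le> card (touched V p)"
proof -
  have "touched (V \<union> L) p \<subseteq> (\<lambda>C. comp_of T (V \<union> L) (SOME x. x \<in> C)) ` touched V p"
  proof
    fix C assume "C \<in> touched (V \<union> L) p"
    then obtain x where C: "C \<in> comps T (V \<union> L)" and x: "x \<in> C" "T x p" by (auto simp: touched_def)
    have "x \<in> V \<union> L" using C x comps_subset by blast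
    then have xV: "x \<in> V" using far x by auto
    define y where "y = (SOME y. y \<in> comp_of T V x)"
    have "y \<in> comp_of T V x" unfolding y_def by (rule someI[of _ x]) simp
    then have "y \<in> comp_of T (V \<union> L) x" using comp_of_mono[of V "V \<union> L"] by blast
    then have "C = comp_of T (V \<union> L) y" using comp_of_eq comps_eqI[OF C x(1)] by metis
    moreover have "comp_of T V x \<in> touched V p"
      using xV x by (auto simp: touched_def comps_def intro: bexI[of _ x])
    ultimately show "C \<in> (\<lambda>C. comp_of T (V \<union> L) (SOME x. x \<in> C)) ` touched V p"
      unfolding y_def by blast
  qed
  moreover have "finite (touched V p)"
    using finite_comps[OF assms(1), of T] by (simp add: touched_def)
  ultimately show ?thesis by (rule surj_card_le[rotated])
qed

text \<open>For \<open>L \<subseteq> V\<close> this is the change in the number of components when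
  \<open>L\<close> is removed, the finite counterpart of \<open>N_cc_loc\<close>.\<close>

definition comps_diff :: "'a set \<Rightarrow> 'a set \<Rightarrow> int" where
  "comps_diff L V = int (card (comps T (V \<union> L))) - int (card (comps T (V - L)))"

text \<open>Adding \<open>p\<close> changes each of the two counts by one minus the number of
  components touched, and that number is no larger in the presence of \<open>L\<close>.\<close>

lemma comps_diff_insert:
  assumes "finite V" "finite L" "L \<subseteq> V" and far: "\<And>l. l \<in> L \<Longrightarrow> \<not> T l p"
  shows "comps_diff L V \<le> comps_diff L (insert p V)"
proof (cases "p \<in> V")
  case False
  then have pL: "p \<notin> L" using assms(3) by auto
  have VL: "V - L \<union> L = V \<union> L" by auto
  have "card (touched (V - L \<union> L) p) \<le> card (touched (V - L) p)"
    using assms by (intro card_touched_antimono) auto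
  moreover have "card (comps T (insert p (V - L))) + card (touched (V - L) p) = card (comps T (V - L)) + 1"
    using assms False by (intro card_comps_insert) auto
  moreover have "card (comps T (insert p (V \<union> L))) + card (touched (V \<union> L) p) = card (comps T (V \<union> L)) + 1"
    using assms False pL by (intro card_comps_insert) auto
  moreover have "insert p V - L = insert p (V - L)" "insert p V \<union> L = insert p (V \<union> L)" using pL by auto
  ultimately show ?thesis unfolding comps_diff_def VL by simp
qed (simp add: insert_absorb)

lemma comps_diff_mono:
  assumes "finite V'" "L \<subseteq> V" "V \<subseteq> V'"
    and far: "\<And>l p. l \<in> L \<Longrightarrow> p \<in> V' - V \<Longrightarrow> \<not> T l p"
  shows "comps_diff L V \<le> comps_diff L V'"
proof -
  have "comps_diff L V \<le> comps_diff L (V \<union> X)" if "X \<subseteq> V' - V" for X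
  proof -
    have "finite X" using that assms(1) finite_subset by blast
    then show ?thesis using that
    proof induction
      case (insert p X)
      have "comps_diff L (V \<union> X) \<le> comps_diff L (insert p (V \<union> X))"
        using insert assms finite_subset[of V V'] finite_subset[of L V'] far
        by (intro comps_diff_insert) auto
      then show ?case using insert by simp
    qed simp
  qed
  from this[of "V' - V"] show ?thesis using assms(3) by (simp add: Un_absorb1)
qed

lemma comps_diff_le:
  assumes "finite V" "finite L" shows "comps_diff L V \<le> int (card L)"
  using card_comps_Un_le[of "V - L" L] assms by (simp add: comps_diff_def)

text \<open>The difference is monotone and bounded, hence constant from some finite set on.\<close>

lemma comps_diff_eventually_const:
  assumes "finite L" and fin: "finite {p\<in>A. \<exists>l\<in>L. T l p}" and "L \<subseteq> A"
  shows "\<exists>F l. finite F \<and> F \<subseteq> A \<and> (\<forall>V. finite V \<and> F \<subseteq> V \<and> V \<subseteq> A \<longrightarrow> comps_diff L V = l)"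
proof -
  \<comment> \<open>All neighbours of \<open>L\<close> are included, so every vertex added later is
    far from \<open>L\<close>, as monotonicity requires.\<close>
  define F0 where "F0 = L \<union> {p\<in>A. \<exists>l\<in>L. T l p}"
  define D where "D = {V. finite V \<and> F0 \<subseteq> V \<and> V \<subseteq> A}"
  have F0: "F0 \<in> D" using assms by (auto simp: D_def F0_def)
  \<comment> \<open>The gap to the upper bound \<open>card L\<close>. As a natural number it attains
    a minimum, and from there on the difference cannot grow any more.\<close>
  define m where "m V = nat (int (card L) - comps_diff L V)" for V
  obtain F where F: "F \<in> D" and min: "\<And>V. V \<in> D \<Longrightarrow> m F \<le> m V"
    using ex_has_least_nat[of "\<lambda>V. V \<in> D" F0 m] F0 by auto
  have "comps_diff L V = comps_diff L F" if V: "finite V" "F \<subseteq> V" "V \<subseteq> A" for V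
  proof -
    have "V \<in> D" using V F by (auto simp: D_def)
    then have "m F \<le> m V" by (rule min)
    then have "comps_diff L V \<le> comps_diff L F"
      unfolding m_def using comps_diff_le[OF V(1) assms(1)] comps_diff_le[of F, OF _ assms(1)] F
      by (auto simp: D_def)
    moreover have "comps_diff L F \<le> comps_diff L V"
      using V F by (intro comps_diff_mono) (auto simp: D_def F0_def)
    ultimately show ?thesis by simp
  qed
  moreover have "finite F" "F \<subseteq> A" using F by (simp_all add: D_def)
  ultimately show ?thesis by blast
qed

end

subsection \<open>Configurations\<close>

lemma emeasure_distr_count:
  assumes "A \<in> sets borel"
  shows "emeasure (distr (count_space I) borel X) A =
    (if finite {i\<in>I. X i \<in> A} then of_nat (card {i\<in>I. X i \<in> A}) else \<infinity>)"
proof -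
  have "X -` A \<inter> space (count_space I) = {i\<in>I. X i \<in> A}" by auto
  then show ?thesis
    using assms by (subst emeasure_distr) (auto simp: emeasure_count_space)
qed

lemma configurationsE:
  assumes "\<omega> \<in> configurations"
  obtains I :: "nat set" and X where "\<And>i. i \<in> I \<Longrightarrow> 0 \<le> snd (X i)" "\<omega> = distr (count_space I) borel X"
proof -
  obtain I :: "nat set" and X where "X \<in> I \<rightarrow> UNIV \<times> {0..}" "\<omega> = distr (count_space I) borel X"
    using assms by (auto simp: configurations_def)
  moreover have "0 \<le> snd (X i)" if "i \<in> I" for i
    using funcset_mem[OF calculation(1) that] by (auto simp: mem_Times_iff)
  ultimately show thesis using that by blast
qed

lemma sets_configuration [simp]: "\<omega> \<in> configurations \<Longrightarrow> sets \<omega> = sets borel"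
  by (auto simp: configurations_def)

lemma space_configuration [simp]: "\<omega> \<in> configurations \<Longrightarrow> space \<omega> = UNIV"
  by (auto simp: configurations_def)

lemma configuration_eqI:
  assumes "\<omega> \<in> configurations" "\<omega>' \<in> configurations"
    and "\<And>A. A \<in> sets borel \<Longrightarrow> emeasure \<omega> A = emeasure \<omega>' A"
  shows "\<omega> = \<omega>'"
  using assms by (intro measure_eqI) auto

lemma cylinder_borel:
  fixes A :: "'a::second_countable_topology set"
  assumes "A \<in> sets borel" shows "A \<times> (UNIV :: real set) \<in> sets borel"
proof -
  have "A \<times> (UNIV :: real set) \<in> sets (borel \<Otimes>\<^sub>M borel)" using assms by (intro pair_measureI) auto
  then show ?thesis unfolding borel_prod .
qed

lemma bounded_subset_cballE:
  assumes "bounded (S :: 'a::real_normed_vector set)" obtains B where "S \<subseteq> cball 0 B"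
  using bounded_subset_ballD[OF assms, of 0] ball_subset_cball by blast

lemma emeasure_configuration_finite:
  assumes "\<omega> \<in> configurations" "bounded \<Gamma>"
  shows "emeasure \<omega> \<Gamma> < \<infinity>"
proof -
  have "bounded (fst ` \<Gamma>)" using assms(2) by (rule bounded_fst)
  then obtain B where B: "fst ` \<Gamma> \<subseteq> cball 0 B" by (rule bounded_subset_cballE)
  then have "\<Gamma> \<subseteq> cball 0 B \<times> UNIV" by (auto simp: subset_iff image_iff)
  moreover have "cball (0::real^'a) B \<times> (UNIV::real set) \<in> sets \<omega>"
    using assms(1) by (simp add: cylinder_borel)
  ultimately have "emeasure \<omega> \<Gamma> \<le> emeasure \<omega> (cball 0 B \<times> UNIV)" by (rule emeasure_mono)
  also have "\<dots> < \<infinity>" using assms(1) by (auto simp: configurations_def)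
  finally show ?thesis .
qed

text \<open>Integer counts can be summed and compared without infinite values. They are faithful
  where the mass is finite, which boundedness of the set ensures.\<close>

definition cnt :: "('n::finite) conf \<Rightarrow> ((real ^ 'n) \<times> real) set \<Rightarrow> nat" where
  "cnt \<omega> \<Gamma> = nat \<lfloor>enn2real (emeasure \<omega> \<Gamma>)\<rfloor>"

lemma emeasure_eq_cnt:
  assumes "\<omega> \<in> configurations" "bounded \<Gamma>" "\<Gamma> \<in> sets borel"
  shows "emeasure \<omega> \<Gamma> = of_nat (cnt \<omega> \<Gamma>)"
proof -
  obtain I :: "nat set" and X where X: "\<omega> = distr (count_space I) borel X"
    using assms(1) by (rule configurationsE) blast
  have *: "emeasure \<omega> \<Gamma> = (if finite {i\<in>I. X i \<in> \<Gamma>} then of_nat (card {i\<in>I. X i \<in> \<Gamma>}) else \<infinity>)"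
    unfolding X by (rule emeasure_distr_count) fact
  then have "emeasure \<omega> \<Gamma> = of_nat (card {i\<in>I. X i \<in> \<Gamma>})"
    using emeasure_configuration_finite[OF assms(1,2)] by (auto split: if_splits)
  then show ?thesis unfolding cnt_def by (simp add: ennreal_of_nat_eq_real_of_nat)
qed

lemma emeasure_eq_of_nat_iff:
  assumes "\<omega> \<in> configurations" "bounded \<Gamma>" "\<Gamma> \<in> sets borel"
  shows "emeasure \<omega> \<Gamma> = of_nat k \<longleftrightarrow> cnt \<omega> \<Gamma> = k"
  by (simp add: emeasure_eq_cnt[OF assms] ennreal_of_nat_eq_real_of_nat)

lemma points_distr:
  assumes "\<omega> = distr (count_space I) borel X"
  shows "points \<omega> = X ` I"
proof -
  have "emeasure \<omega> {p} > 0 \<longleftrightarrow> p \<in> X ` I" for p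
    unfolding assms
    by (subst emeasure_distr_count) (auto simp: zero_less_iff_neq_zero dest!: infinite_imp_nonempty)
  then show ?thesis by (auto simp: points_def)
qed

lemma points_snd_nonneg: "\<omega> \<in> configurations \<Longrightarrow> p \<in> points \<omega> \<Longrightarrow> 0 \<le> snd p"
  by (metis configurationsE imageE points_distr)

lemma emeasure_eq_0_iff_points:
  assumes "\<omega> \<in> configurations" "\<Gamma> \<in> sets borel"
  shows "emeasure \<omega> \<Gamma> = 0 \<longleftrightarrow> points \<omega> \<inter> \<Gamma> = {}"
proof -
  obtain I :: "nat set" and X where X: "\<omega> = distr (count_space I) borel X"
    using assms(1) by (rule configurationsE) blast
  show ?thesis unfolding points_distr[OF X] unfolding X
    by (subst emeasure_distr_count[OF assms(2)]) (auto dest!: infinite_imp_nonempty)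
qed

lemma cnt_eq_0_iff:
  assumes "\<omega> \<in> configurations" "bounded \<Gamma>" "\<Gamma> \<in> sets borel"
  shows "cnt \<omega> \<Gamma> = 0 \<longleftrightarrow> points \<omega> \<inter> \<Gamma> = {}"
  using emeasure_eq_0_iff_points[OF assms(1,3)] emeasure_eq_cnt[OF assms] by simp

text \<open>\<open>points\<close> forgets multiplicities while \<open>cnt\<close> keeps them, hence
  an inequality only.\<close>

lemma
  assumes "\<omega> \<in> configurations" "bounded \<Gamma>" "\<Gamma> \<in> sets borel"
  shows finite_points: "finite (points \<omega> \<inter> \<Gamma>)"
    and card_points_le_cnt: "card (points \<omega> \<inter> \<Gamma>) \<le> cnt \<omega> \<Gamma>"
proof -
  obtain I :: "nat set" and X where X: "\<omega> = distr (count_space I) borel X"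
    using assms(1) by (rule configurationsE) blast
  let ?J = "{i\<in>I. X i \<in> \<Gamma>}"
  have *: "of_nat (cnt \<omega> \<Gamma>) = (if finite ?J then of_nat (card ?J) else (\<infinity>::ennreal))"
    unfolding emeasure_eq_cnt[OF assms, symmetric] unfolding X
    by (rule emeasure_distr_count) fact
  then have "finite ?J" by (auto split: if_splits)
  with * have "cnt \<omega> \<Gamma> = card ?J" by (simp add: ennreal_of_nat_eq_real_of_nat)
  moreover have "points \<omega> \<inter> \<Gamma> = X ` ?J" unfolding points_distr[OF X] by auto
  ultimately show "finite (points \<omega> \<inter> \<Gamma>)" "card (points \<omega> \<inter> \<Gamma>) \<le> cnt \<omega> \<Gamma>"
    using \<open>finite ?J\<close> card_image_le by auto
qed

lemma cnt_mono:
  assumes "\<omega> \<in> configurations" "bounded \<Gamma>'" "\<Gamma> \<in> sets borel" "\<Gamma>' \<in> sets borel" "\<Gamma> \<subseteq> \<Gamma>'"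
  shows "cnt \<omega> \<Gamma> \<le> cnt \<omega> \<Gamma>'"
proof -
  have "emeasure \<omega> \<Gamma> \<le> emeasure \<omega> \<Gamma>'" using assms by (intro emeasure_mono) auto
  then show ?thesis
    using emeasure_eq_cnt[of \<omega> \<Gamma>] emeasure_eq_cnt[of \<omega> \<Gamma>'] assms bounded_subset[of \<Gamma>' \<Gamma>]
    by (simp add: ennreal_of_nat_eq_real_of_nat)
qed

lemma cnt_UNION:
  assumes "\<omega> \<in> configurations" "finite S" "\<And>c. c \<in> S \<Longrightarrow> bounded (\<Gamma> c)"
    "\<And>c. c \<in> S \<Longrightarrow> \<Gamma> c \<in> sets borel" "disjoint_family_on \<Gamma> S"
  shows "cnt \<omega> (\<Union>c\<in>S. \<Gamma> c) = (\<Sum>c\<in>S. cnt \<omega> (\<Gamma> c))"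
proof -
  have b: "bounded (\<Union>c\<in>S. \<Gamma> c)" using assms by auto
  have s: "(\<Union>c\<in>S. \<Gamma> c) \<in> sets borel" using assms by auto
  have "emeasure \<omega> (\<Union>c\<in>S. \<Gamma> c) = (\<Sum>c\<in>S. emeasure \<omega> (\<Gamma> c))"
    using assms by (intro sum_emeasure[symmetric]) auto
  also have "\<dots> = (\<Sum>c\<in>S. of_nat (cnt \<omega> (\<Gamma> c)))"
    using assms by (intro sum.cong refl emeasure_eq_cnt) auto
  also have "\<dots> = of_nat (\<Sum>c\<in>S. cnt \<omega> (\<Gamma> c))" by simp
  finally show ?thesis using emeasure_eq_of_nat_iff[OF assms(1) b s] by blast
qed

lemma cnt_Diff:
  assumes "\<omega> \<in> configurations" "bounded \<Gamma>'" "\<Gamma> \<in> sets borel" "\<Gamma>' \<in> sets borel" "\<Gamma> \<subseteq> \<Gamma>'"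
  shows "cnt \<omega> \<Gamma>' = cnt \<omega> \<Gamma> + cnt \<omega> (\<Gamma>' - \<Gamma>)"
proof -
  have "cnt \<omega> (\<Union>b\<in>{True, False}. if b then \<Gamma> else \<Gamma>' - \<Gamma>) = (\<Sum>b\<in>{True, False}. cnt \<omega> (if b then \<Gamma> else \<Gamma>' - \<Gamma>))"
    using assms bounded_subset[OF assms(2)]
    by (intro cnt_UNION) (auto simp: disjoint_family_on_def)
  moreover have "(\<Union>b\<in>{True, False}. if b then \<Gamma> else \<Gamma>' - \<Gamma>) = \<Gamma>'" using assms by auto
  ultimately show ?thesis by simp
qed

subsection \<open>Restriction and superposition\<close>

text \<open>Unlike \<open>restr\<close>, this restricts to arbitrary sets of centre-radius pairs;
  regions that also limit the radius are needed for both estimates.\<close>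

definition cut :: "((real ^ 'n) \<times> real) set \<Rightarrow> ('n::finite) conf \<Rightarrow> 'n conf" where
  "cut \<Gamma> \<omega> = density \<omega> (indicator \<Gamma>)"

lemma restr_eq_cut: "restr \<Lambda> \<omega> = cut (\<Lambda> \<times> UNIV) \<omega>"
  by (simp add: restr_def cut_def)

lemma emeasure_cut:
  assumes "\<omega> \<in> configurations" "\<Gamma> \<in> sets borel" "A \<in> sets borel"
  shows "emeasure (cut \<Gamma> \<omega>) A = emeasure \<omega> (A \<inter> \<Gamma>)"
proof -
  have "emeasure (cut \<Gamma> \<omega>) A = (\<integral>\<^sup>+x. indicator \<Gamma> x * indicator A x \<partial>\<omega>)"
    unfolding cut_def using assms by (intro emeasure_density borel_measurable_indicator) auto
  also have "\<dots> = (\<integral>\<^sup>+x. indicator (A \<inter> \<Gamma>) x \<partial>\<omega>)"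
    by (intro nn_integral_cong) (auto simp: indicator_def)
  also have "\<dots> = emeasure \<omega> (A \<inter> \<Gamma>)" using assms by (intro nn_integral_indicator) auto
  finally show ?thesis .
qed

lemma cut_configurations [simp, intro]:
  assumes "\<omega> \<in> configurations" "\<Gamma> \<in> sets borel"
  shows "cut \<Gamma> \<omega> \<in> configurations"
proof -
  obtain I :: "nat set" and X where X: "\<And>i. i \<in> I \<Longrightarrow> 0 \<le> snd (X i)" "\<omega> = distr (count_space I) borel X"
    using assms(1) by (rule configurationsE) blast
  define J where "J = {i\<in>I. X i \<in> \<Gamma>}"
  have "cut \<Gamma> \<omega> = distr (count_space J) borel X"
  proof (rule measure_eqI)
    fix A assume "A \<in> sets (cut \<Gamma> \<omega>)"
    then have A: "A \<in> sets borel" using assms by (simp add: cut_def)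
    have "{i\<in>I. X i \<in> A \<inter> \<Gamma>} = {i\<in>J. X i \<in> A}" by (auto simp: J_def)
    then show "emeasure (cut \<Gamma> \<omega>) A = emeasure (distr (count_space J) borel X) A"
      using emeasure_cut[OF assms A] A assms(2)
      by (simp add: X(2) emeasure_distr_count del: distr_cong)
  qed (use assms in \<open>simp add: cut_def\<close>)
  moreover have "X \<in> J \<rightarrow> UNIV \<times> {0..}" using X(1) by (auto simp: J_def mem_Times_iff)
  moreover have "emeasure (cut \<Gamma> \<omega>) (\<Lambda> \<times> UNIV) < \<infinity>" if "\<Lambda> \<in> sets borel" "bounded \<Lambda>" for \<Lambda>
  proof -
    have "emeasure (cut \<Gamma> \<omega>) (\<Lambda> \<times> UNIV) = emeasure \<omega> (\<Lambda> \<times> UNIV \<inter> \<Gamma>)"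
      using assms that by (intro emeasure_cut cylinder_borel) auto
    also have "\<dots> \<le> emeasure \<omega> (\<Lambda> \<times> UNIV)"
      using assms that by (intro emeasure_mono) (auto simp: cylinder_borel)
    also have "\<dots> < \<infinity>" using assms that by (auto simp: configurations_def)
    finally show ?thesis .
  qed
  ultimately show ?thesis unfolding configurations_def by blast
qed

lemma restr_configurations [simp, intro]:
  "\<omega> \<in> configurations \<Longrightarrow> \<Lambda> \<in> sets borel \<Longrightarrow> restr \<Lambda> \<omega> \<in> configurations"
  unfolding restr_eq_cut by (intro cut_configurations cylinder_borel)

lemma points_cut:
  assumes "\<omega> \<in> configurations" "\<Gamma> \<in> sets borel"
  shows "points (cut \<Gamma> \<omega>) = points \<omega> \<inter> \<Gamma>"
proof -
  have "emeasure (cut \<Gamma> \<omega>) {p} = (if p \<in> \<Gamma> then emeasure \<omega> {p} else 0)" for p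
    using emeasure_cut[OF assms, of "{p}"] by (auto simp: Int_insert_left)
  then show ?thesis by (auto simp: points_def split: if_splits)
qed

lemma superpose_aux:
  fixes \<omega> \<omega>' :: "('n::finite) conf"
  assumes "\<omega> \<in> configurations" "\<omega>' \<in> configurations"
  shows "\<exists>(K::nat set) Z. Z \<in> K \<rightarrow> UNIV \<times> {0..} \<and> superpose \<omega> \<omega>' = distr (count_space K) borel Z \<and>
    (\<forall>A\<in>sets borel. emeasure (superpose \<omega> \<omega>') A = emeasure \<omega> A + emeasure \<omega>' A)"
proof -
  obtain I :: "nat set" and X where X: "\<And>i. i \<in> I \<Longrightarrow> 0 \<le> snd (X i)" "\<omega> = distr (count_space I) borel X"
    using assms(1) by (rule configurationsE) blast
  obtain J :: "nat set" and Y where Y: "\<And>i. i \<in> J \<Longrightarrow> 0 \<le> snd (Y i)" "\<omega>' = distr (count_space J) borel Y"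
    using assms(2) by (rule configurationsE) blast
  \<comment> \<open>Even and odd indices interleave the two enumerations in one index set of natural
    numbers, which keeps multiple points apart.\<close>
  define K where "K = (\<lambda>i. 2 * i) ` I \<union> (\<lambda>i. 2 * i + 1) ` J"
  define Z where "Z k = (if even k then X (k div 2) else Y (k div 2))" for k
  have em: "emeasure (distr (count_space K) borel Z) A = emeasure \<omega> A + emeasure \<omega>' A"
    if A: "A \<in> sets borel" for A
  proof -
    let ?a = "{i\<in>I. X i \<in> A}" and ?b = "{i\<in>J. Y i \<in> A}"
    have eq: "{k\<in>K. Z k \<in> A} = (\<lambda>i. 2 * i) ` ?a \<union> (\<lambda>i. 2 * i + 1) ` ?b"
      by (auto simp: K_def Z_def)
    have i1: "inj_on (\<lambda>i::nat. 2 * i) ?a" and i2: "inj_on (\<lambda>i::nat. 2 * i + 1) ?b"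
      by (auto simp: inj_on_def)
    have disj: "(\<lambda>i. 2 * i) ` ?a \<inter> (\<lambda>i. 2 * i + 1) ` ?b = {}" by auto presburger
    have fin: "finite {k\<in>K. Z k \<in> A} \<longleftrightarrow> finite ?a \<and> finite ?b"
      unfolding eq using finite_image_iff[OF i1] finite_image_iff[OF i2] by simp
    have "card {k\<in>K. Z k \<in> A} = card ?a + card ?b" if "finite ?a" "finite ?b"
      unfolding eq using that card_image[OF i1] card_image[OF i2]
      by (subst card_Un_disjoint[OF _ _ disj]) auto
    then show ?thesis
      unfolding X(2) Y(2) emeasure_distr_count[OF A] using fin by auto
  qed
  have "superpose \<omega> \<omega>' = measure_of UNIV (sets borel) (emeasure (distr (count_space K) borel Z))"
    unfolding superpose_def
  proof (rule measure_of_eq)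
    fix A :: "((real ^ 'n) \<times> real) set"
    assume "A \<in> sigma_sets UNIV (sets borel)"
    then have "A \<in> sets borel" by (metis sets.sigma_sets_eq space_borel)
    then show "emeasure \<omega> A + emeasure \<omega>' A = emeasure (distr (count_space K) borel Z) A" using em by simp
  qed simp
  also have "\<dots> = distr (count_space K) borel Z"
    using measure_of_of_measure[of "distr (count_space K) borel Z"] by simp
  finally have eq: "superpose \<omega> \<omega>' = distr (count_space K) borel Z" .
  moreover have "Z \<in> K \<rightarrow> UNIV \<times> {0..}" using X(1) Y(1) by (auto simp: K_def Z_def mem_Times_iff)
  ultimately show ?thesis
    using em by (intro exI[of _ K] exI[of _ Z] conjI ballI) simp_all
qed

lemma emeasure_superpose:
  assumes "\<omega> \<in> configurations" "\<omega>' \<in> configurations" "A \<in> sets borel"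
  shows "emeasure (superpose \<omega> \<omega>') A = emeasure \<omega> A + emeasure \<omega>' A"
  using superpose_aux[OF assms(1,2)] assms(3) by blast

lemma superpose_configurations [simp, intro]:
  assumes "\<omega> \<in> configurations" "\<omega>' \<in> configurations"
  shows "superpose \<omega> \<omega>' \<in> configurations"
proof -
  have "emeasure (superpose \<omega> \<omega>') (\<Lambda> \<times> UNIV) < \<infinity>" if "\<Lambda> \<in> sets borel" "bounded \<Lambda>" for \<Lambda>
    using assms that emeasure_superpose[OF assms cylinder_borel[OF that(1)]]
    by (auto simp: configurations_def)
  then show ?thesis using superpose_aux[OF assms] unfolding configurations_def by blast
qed

lemma points_superpose:
  assumes "\<omega> \<in> configurations" "\<omega>' \<in> configurations"
  shows "points (superpose \<omega> \<omega>') = points \<omega> \<union> points \<omega>'"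
  unfolding points_def using emeasure_superpose[OF assms] by (auto simp: zero_less_iff_neq_zero)

lemma superpose_assoc:
  assumes "\<omega> \<in> configurations" "\<omega>' \<in> configurations" "\<omega>'' \<in> configurations"
  shows "superpose (superpose \<omega> \<omega>') \<omega>'' = superpose \<omega> (superpose \<omega>' \<omega>'')"
  using assms by (intro configuration_eqI) (auto simp: emeasure_superpose add.assoc)

lemma superpose_null:
  assumes "\<omega> \<in> configurations" "\<omega>' \<in> configurations" "points \<omega> = {}"
  shows "superpose \<omega> \<omega>' = \<omega>'"
  using assms emeasure_eq_0_iff_points[OF assms(1)]
  by (intro configuration_eqI) (auto simp: emeasure_superpose)

lemma cut_superpose:
  assumes "\<omega> \<in> configurations" "\<omega>' \<in> configurations" "\<Gamma> \<in> sets borel"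
  shows "cut \<Gamma> (superpose \<omega> \<omega>') = superpose (cut \<Gamma> \<omega>) (cut \<Gamma> \<omega>')"
  using assms by (intro configuration_eqI) (auto simp: emeasure_superpose emeasure_cut)

lemma cut_cut:
  assumes "\<omega> \<in> configurations" "\<Gamma> \<in> sets borel" "\<Gamma>' \<in> sets borel"
  shows "cut \<Gamma> (cut \<Gamma>' \<omega>) = cut (\<Gamma> \<inter> \<Gamma>') \<omega>"
  using assms by (intro configuration_eqI) (auto simp: emeasure_cut Int_ac)

lemma superpose_cut_cut:
  assumes "\<omega> \<in> configurations" "\<Gamma> \<in> sets borel" "\<Gamma>' \<in> sets borel" "\<Gamma> \<inter> \<Gamma>' = {}"
  shows "superpose (cut \<Gamma> \<omega>) (cut \<Gamma>' \<omega>) = cut (\<Gamma> \<union> \<Gamma>') \<omega>"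
proof (rule configuration_eqI)
  fix A :: "((real ^ 'a) \<times> real) set" assume A: "A \<in> sets borel"
  have "emeasure \<omega> (A \<inter> \<Gamma>) + emeasure \<omega> (A \<inter> \<Gamma>') = emeasure \<omega> (A \<inter> \<Gamma> \<union> A \<inter> \<Gamma>')"
    using assms A by (intro plus_emeasure) auto
  then show "emeasure (superpose (cut \<Gamma> \<omega>) (cut \<Gamma>' \<omega>)) A = emeasure (cut (\<Gamma> \<union> \<Gamma>') \<omega>) A"
    using assms A by (simp add: emeasure_superpose emeasure_cut Int_Un_distrib)
qed (use assms in auto)

subsection \<open>Connected components of the covered set\<close>

definition touch :: "(real ^ 'n) \<times> real \<Rightarrow> (real ^ 'n::finite) \<times> real \<Rightarrow> bool" where
  "touch p q \<longleftrightarrow> germ_ball p \<inter> germ_ball q \<noteq> {}"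

interpretation touch: sym_graph touch
  by standard (auto simp: touch_def)

lemma touch_iff:
  assumes "0 \<le> snd p" "0 \<le> snd q"
  shows "touch p q \<longleftrightarrow> dist (fst p) (fst q) \<le> snd p + snd q"
proof -
  have "cball (fst p) (snd p) \<inter> cball (fst q) (snd q) \<noteq> {}" if d: "dist (fst p) (fst q) \<le> snd p + snd q"
  proof (cases "snd p + snd q = 0")
    case True
    then have "fst p \<in> cball (fst p) (snd p) \<inter> cball (fst q) (snd q)"
      using d assms by (auto simp: dist_commute)
    then show ?thesis by blast
  next
    case False
    \<comment> \<open>The point dividing the segment of centres in the ratio of the radii lies in
      both balls; two zero radii are treated separately to avoid the division.\<close>
    define t where "t = snd p / (snd p + snd q)"
    define y where "y = fst p + t *\<^sub>R (fst q - fst p)"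
    have t: "0 \<le> t" "t \<le> 1" "t * (snd p + snd q) = snd p" using assms False by (auto simp: t_def divide_le_eq_1)
    have "dist (fst p) y = t * dist (fst p) (fst q)"
      using t by (simp add: y_def dist_norm norm_minus_commute)
    also have "\<dots> \<le> t * (snd p + snd q)" using d t by (intro mult_left_mono)
    finally have 1: "dist (fst p) y \<le> snd p" using t by simp
    have "fst q - y = (1 - t) *\<^sub>R (fst q - fst p)" by (simp add: y_def algebra_simps)
    then have "dist (fst q) y = (1 - t) * dist (fst p) (fst q)"
      using t by (simp add: dist_norm norm_minus_commute)
    also have "\<dots> \<le> (1 - t) * (snd p + snd q)" using d t by (intro mult_left_mono) auto
    finally have 2: "dist (fst q) y \<le> snd q" using t(3) by (simp add: algebra_simps)
    from 1 2 have "y \<in> cball (fst p) (snd p) \<inter> cball (fst q) (snd q)" by simp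
    then show ?thesis by blast
  qed
  moreover have "dist (fst p) (fst q) \<le> snd p + snd q"
    if y: "y \<in> cball (fst p) (snd p)" "y \<in> cball (fst q) (snd q)" for y
    using y dist_triangle[of "fst p" "fst q" y] by (simp add: dist_commute)
  ultimately show ?thesis unfolding touch_def germ_ball_def by blast
qed

lemma chain_rtrancl:
  assumes "ps \<noteq> []" "set ps \<subseteq> V" "\<forall>i. Suc i < length ps \<longrightarrow> T (ps ! i) (ps ! Suc i)"
  shows "(hd ps, last ps) \<in> (adj T V)\<^sup>*"
  using assms
proof (induction ps)
  case (Cons p ps)
  show ?case
  proof (cases "ps = []")
    case False
    have "\<forall>i. Suc i < length ps \<longrightarrow> T (ps ! i) (ps ! Suc i)" using Cons.prems(3) by fastforce
    then have "(hd ps, last ps) \<in> (adj T V)\<^sup>*" using Cons False by auto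
    moreover have "T p (hd ps)" using Cons.prems(3)[rule_format, of 0] False by (simp add: hd_conv_nth)
    then have "(p, hd ps) \<in> adj T V" using Cons.prems False by (auto simp: adj_def)
    ultimately show ?thesis using False by (simp add: converse_rtrancl_into_rtrancl)
  qed simp
qed simp

lemma rtrancl_chain:
  assumes "(p, q) \<in> (adj T V)\<^sup>*" "p \<in> V"
  shows "\<exists>ps. ps \<noteq> [] \<and> set ps \<subseteq> V \<and> hd ps = p \<and> last ps = q \<and>
    (\<forall>i. Suc i < length ps \<longrightarrow> T (ps ! i) (ps ! Suc i))"
  using assms
proof (induction rule: rtrancl_induct)
  case base
  then show ?case by (intro exI[of _ "[p]"]) auto
next
  case (step y z)
  then obtain ps where ps: "ps \<noteq> []" "set ps \<subseteq> V" "hd ps = p" "last ps = y"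
    "\<And>i. Suc i < length ps \<Longrightarrow> T (ps ! i) (ps ! Suc i)" by auto
  have "T ((ps @ [z]) ! i) ((ps @ [z]) ! Suc i)" if i: "Suc i < length (ps @ [z])" for i
  proof (cases "Suc i < length ps")
    case True then show ?thesis using ps(5)[OF True] by (simp add: nth_append)
  next
    case False
    then have "i = length ps - 1" using i ps(1) by (cases ps) auto
    then have "ps ! i = y" "Suc i = length ps" using ps(1,4) by (auto simp: last_conv_nth)
    then show ?thesis using step(2) ps(1) by (simp add: nth_append adj_def)
  qed
  then show ?case using ps step(2) by (intro exI[of _ "ps @ [z]"]) (auto simp: adj_def)
qed

lemma connected_in_iff:
  "connected_in \<omega> x y \<longleftrightarrow>
    (\<exists>p\<in>points \<omega>. \<exists>q. x \<in> germ_ball p \<and> y \<in> germ_ball q \<and> (p, q) \<in> (adj touch (points \<omega>))\<^sup>*)"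
proof
  assume "connected_in \<omega> x y"
  then obtain ps where ps: "ps \<noteq> []" "set ps \<subseteq> points \<omega>" "x \<in> germ_ball (hd ps)" "y \<in> germ_ball (last ps)"
    "\<forall>i. Suc i < length ps \<longrightarrow> touch (ps ! i) (ps ! Suc i)"
    by (auto simp: connected_in_def touch_def)
  moreover have "hd ps \<in> points \<omega>" using ps by auto
  ultimately show "\<exists>p\<in>points \<omega>. \<exists>q. x \<in> germ_ball p \<and> y \<in> germ_ball q \<and> (p, q) \<in> (adj touch (points \<omega>))\<^sup>*"
    using chain_rtrancl[of ps "points \<omega>" touch] by blast
next
  assume "\<exists>p\<in>points \<omega>. \<exists>q. x \<in> germ_ball p \<and> y \<in> germ_ball q \<and> (p, q) \<in> (adj touch (points \<omega>))\<^sup>*"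
  then obtain p q where "p \<in> points \<omega>" "x \<in> germ_ball p" "y \<in> germ_ball q" "(p, q) \<in> (adj touch (points \<omega>))\<^sup>*"
    by auto
  with rtrancl_chain[of p q touch "points \<omega>"] show "connected_in \<omega> x y"
    unfolding connected_in_def touch_def by blast
qed

text \<open>Each component of the covered set is the union of the balls of one graph component.
  Radii are non-negative, so every ball contains its centre; hence two graph components with the
  same union contain touching balls and coincide.\<close>

lemma N_cc_eq_card_comps:
  assumes "\<omega> \<in> configurations"
  shows "N_cc \<omega> = card (comps touch (points \<omega>))"
proof -
  let ?V = "points \<omega>"
  define U where "U K = (\<Union>p\<in>K. germ_ball p)" for K :: "((real ^ 'a) \<times> real) set"
  have class_eq: "{y. connected_in \<omega> x y} = U (comp_of touch ?V p)" if "p \<in> ?V" "x \<in> germ_ball p" for p x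
  proof -
    have "connected_in \<omega> x y \<longleftrightarrow> (\<exists>q. y \<in> germ_ball q \<and> (p, q) \<in> (adj touch ?V)\<^sup>*)" for y
    proof
      assume "connected_in \<omega> x y"
      then obtain p' q where p': "p' \<in> ?V" "x \<in> germ_ball p'" "y \<in> germ_ball q" "(p', q) \<in> (adj touch ?V)\<^sup>*"
        by (auto simp: connected_in_iff)
      then have "(p, p') \<in> adj touch ?V" using that by (auto simp: adj_def touch_def)
      then show "\<exists>q. y \<in> germ_ball q \<and> (p, q) \<in> (adj touch ?V)\<^sup>*"
        using p' by (blast intro: converse_rtrancl_into_rtrancl)
    qed (use that in \<open>auto simp: connected_in_iff\<close>)
    then show ?thesis by (auto simp: U_def comp_of_def)
  qed
  have ne: "fst p \<in> germ_ball p" if "p \<in> ?V" for p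
    using points_snd_nonneg[OF assms that] by (simp add: germ_ball_def)
  have "conn_components \<omega> = U ` comps touch ?V"
  proof (intro equalityI subsetI)
    fix C assume "C \<in> conn_components \<omega>"
    then obtain x where x: "x \<in> covered \<omega>" "C = {y. connected_in \<omega> x y}"
      by (auto simp: conn_components_def quotient_def)
    then obtain p where "p \<in> ?V" "x \<in> germ_ball p" by (auto simp: covered_def)
    then show "C \<in> U ` comps touch ?V" using x class_eq by (auto simp: comps_def)
  next
    fix C assume "C \<in> U ` comps touch ?V"
    then obtain p where p: "p \<in> ?V" "C = U (comp_of touch ?V p)" by (auto simp: comps_def)
    then have "C = {y. connected_in \<omega> (fst p) y}" using class_eq ne by simp
    moreover have "fst p \<in> covered \<omega>" using ne[OF p(1)] p(1) unfolding covered_def by blast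
    ultimately show "C \<in> conn_components \<omega>" by (auto simp: conn_components_def quotient_def)
  qed
  moreover have "inj_on U (comps touch ?V)"
  proof (rule inj_onI)
    fix K K' assume K: "K \<in> comps touch ?V" "K' \<in> comps touch ?V" "U K = U K'"
    obtain p where p: "p \<in> K" "p \<in> ?V" using comps_nonempty[OF K(1)] comps_subset[OF K(1)] by blast
    then have "fst p \<in> U K" using ne[OF p(2)] by (auto simp: U_def)
    then have "fst p \<in> U K'" using K(3) by simp
    then obtain q where q: "q \<in> K'" "fst p \<in> germ_ball q" by (auto simp: U_def)
    then have "touch q p" using ne[OF p(2)] unfolding touch_def by blast
    then have "p \<in> K'" using touch.comps_closed[OF K(2) q(1) p(2)] by simp
    then show "K = K'" using touch.comps_disjoint[OF K(1,2) p(1)] by simp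
  qed
  ultimately show ?thesis unfolding N_cc_def by (simp add: card_image)
qed

subsection \<open>The local number of components\<close>

text \<open>Bounded radii ensure that only finitely many points can touch the balls centred in a
  bounded region. Almost every configuration will turn out to be tame.\<close>

definition tame :: "real \<Rightarrow> ('n::finite) conf \<Rightarrow> bool" where
  "tame r \<omega> \<longleftrightarrow> \<omega> \<in> configurations \<and> (\<forall>p\<in>points \<omega>. snd p \<le> r)"

lemma tame_configurations: "tame r \<omega> \<Longrightarrow> \<omega> \<in> configurations"
  by (simp add: tame_def)

lemma tame_superpose: "tame r \<omega> \<Longrightarrow> tame r \<omega>' \<Longrightarrow> tame r (superpose \<omega> \<omega>')"
  by (auto simp: tame_def points_superpose)

lemma tame_cut: "tame r \<omega> \<Longrightarrow> \<Gamma> \<in> sets borel \<Longrightarrow> tame r (cut \<Gamma> \<omega>)"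
  by (auto simp: tame_def points_cut)

lemma tame_finite_points:
  assumes "tame r \<omega>" "bounded \<Lambda>"
  shows "finite (points \<omega> \<inter> \<Lambda> \<times> UNIV)"
proof -
  obtain B where B: "\<Lambda> \<subseteq> cball 0 B" using assms(2) by (rule bounded_subset_cballE)
  let ?G = "cball (0::real^'a) B \<times> {0..r}"
  have "bounded ?G" "?G \<in> sets borel" by (auto intro!: bounded_Times borel_closed closed_Times)
  then have "finite (points \<omega> \<inter> ?G)" by (intro finite_points tame_configurations[OF assms(1)])
  moreover have "points \<omega> \<inter> \<Lambda> \<times> UNIV \<subseteq> points \<omega> \<inter> ?G"
    using B assms points_snd_nonneg[OF tame_configurations[OF assms(1)]] by (auto simp: tame_def)
  ultimately show ?thesis by (rule finite_subset[rotated])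
qed

lemma exhaustion_eventually_superset:
  fixes F :: "((real ^ 'n::finite) \<times> real) set"
  assumes "exhaustion \<Delta>" "finite F"
  shows "eventually (\<lambda>k. F \<subseteq> \<Delta> k \<times> UNIV) sequentially"
proof -
  have "eventually (\<lambda>k. p \<in> \<Delta> k \<times> UNIV) sequentially" for p
  proof -
    obtain k where "fst p \<in> \<Delta> k" using assms(1) unfolding exhaustion_def by blast
    then have "p \<in> \<Delta> j \<times> UNIV" if "j \<ge> k" for j
      using that assms(1) unfolding exhaustion_def incseq_def by (auto simp: mem_Times_iff)
    then show ?thesis by (auto simp: eventually_sequentially)
  qed
  then have "eventually (\<lambda>k. \<forall>p\<in>F. p \<in> \<Delta> k \<times> UNIV) sequentially"
    using assms(2) by (intro eventually_ball_finite) auto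
  then show ?thesis by eventually_elim auto
qed

lemma exhaustion_balls: "exhaustion (\<lambda>k. cball 0 (real k))"
  by (auto simp: exhaustion_def incseq_def set_eq_iff intro: real_arch_simple)

lemma N_cc_restr:
  assumes "\<omega> \<in> configurations" "\<Delta> \<in> sets borel"
  shows "N_cc (restr \<Delta> \<omega>) = card (comps touch (points \<omega> \<inter> \<Delta> \<times> UNIV))"
  using assms by (subst N_cc_eq_card_comps) (simp_all add: restr_eq_cut points_cut cylinder_borel)

text \<open>This justifies the definite description in \<open>N_cc_loc\<close>: only finitely many
  points touch those over \<Lambda>, so the difference is constant once the window contains a
  suitable finite set, with a value independent of the exhaustion.\<close>

lemma N_cc_loc_eventually:
  assumes "tame r \<omega>" "\<Lambda> \<in> sets borel" "bounded \<Lambda>" "exhaustion \<Delta>"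
  shows "eventually (\<lambda>k. int (N_cc (restr (\<Delta> k) \<omega>)) - int (N_cc (restr (\<Delta> k - \<Lambda>) \<omega>)) = N_cc_loc \<Lambda> \<omega>)
    sequentially"
proof -
  note conf = tame_configurations[OF assms(1)]
  define L where "L = points \<omega> \<inter> \<Lambda> \<times> UNIV"
  obtain B where B: "\<Lambda> \<subseteq> cball 0 B" using assms(3) by (rule bounded_subset_cballE)
  have fL: "finite L" unfolding L_def by (rule tame_finite_points) fact+
  have "{p\<in>points \<omega>. \<exists>l\<in>L. touch l p} \<subseteq> points \<omega> \<inter> cball 0 (B + 2 * r) \<times> UNIV"
  proof safe
    fix y s x t assume p: "(y, s) \<in> points \<omega>" "(x, t) \<in> L" "touch (x, t) (y, s)"
    then have "dist x y \<le> t + s"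
      using points_snd_nonneg[OF conf] touch_iff[of "(x, t)" "(y, s)"] by (auto simp: L_def)
    moreover have "s \<le> r" "t \<le> r" using assms(1) p by (auto simp: tame_def L_def)
    moreover have "norm x \<le> B" using p B by (auto simp: L_def)
    moreover have "norm y \<le> norm x + dist x y"
      using norm_triangle_sub[of y x] by (simp add: dist_norm norm_minus_commute)
    ultimately show "y \<in> cball 0 (B + 2 * r)" by simp
  qed auto
  then have "finite {p\<in>points \<omega>. \<exists>l\<in>L. touch l p}"
    by (rule finite_subset) (rule tame_finite_points[OF assms(1) bounded_cball])
  then obtain F l where F: "finite F" "F \<subseteq> points \<omega>"
    and l: "\<And>V. finite V \<Longrightarrow> F \<subseteq> V \<Longrightarrow> V \<subseteq> points \<omega> \<Longrightarrow> touch.comps_diff L V = l"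
    using touch.comps_diff_eventually_const[OF fL, of "points \<omega>"] by (auto simp: L_def)
  have ev: "eventually (\<lambda>k. int (N_cc (restr (\<Delta> k) \<omega>)) - int (N_cc (restr (\<Delta> k - \<Lambda>) \<omega>)) = l) sequentially"
    if ex: "exhaustion \<Delta>" for \<Delta>
    using exhaustion_eventually_superset[OF ex finite_UnI[OF F(1) fL]]
  proof (eventually_elim)
    case (elim k)
    let ?V = "points \<omega> \<inter> \<Delta> k \<times> UNIV"
    have D: "\<Delta> k \<in> sets borel" "bounded (\<Delta> k)" using ex by (auto simp: exhaustion_def)
    have "touch.comps_diff L ?V = l"
      using elim F tame_finite_points[OF assms(1) D(2)] by (intro l) auto
    moreover have "?V \<union> L = ?V" "?V - L = points \<omega> \<inter> (\<Delta> k - \<Lambda>) \<times> UNIV"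
      using elim by (auto simp: L_def)
    ultimately show ?case
      using D assms(2) conf by (simp add: N_cc_restr touch.comps_diff_def)
  qed
  have "N_cc_loc \<Lambda> \<omega> = l"
    unfolding N_cc_loc_def
  proof (rule the_equality)
    show "\<forall>\<Delta>. exhaustion \<Delta> \<longrightarrow>
      (\<lambda>k. int (N_cc (restr (\<Delta> k) \<omega>)) - int (N_cc (restr (\<Delta> k - \<Lambda>) \<omega>))) \<longlonglongrightarrow> l"
      using ev by (blast intro: tendsto_eventually)
  next
    fix l' assume "\<forall>\<Delta>. exhaustion \<Delta> \<longrightarrow>
      (\<lambda>k. int (N_cc (restr (\<Delta> k) \<omega>)) - int (N_cc (restr (\<Delta> k - \<Lambda>) \<omega>))) \<longlonglongrightarrow> l'"
    with exhaustion_balls tendsto_eventually[OF ev[OF exhaustion_balls]] show "l' = l"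
      using LIMSEQ_unique by blast
  qed
  with ev[OF assms(4)] show ?thesis by simp
qed

text \<open>Removing \<Lambda> erases \<open>a\<close>, so the subtracted terms for both
  configurations agree and cancel. At one common stage of the exhaustion, large enough to contain
  \<open>F\<close>, two finite graphs remain to be compared.\<close>

lemma N_cc_loc_superpose:
  fixes F :: "((real ^ 'n::finite) \<times> real) set"
  assumes "tame r a" "tame r \<zeta>" "points a \<subseteq> \<Lambda> \<times> UNIV" "\<Lambda> \<in> sets borel" "bounded \<Lambda>" "finite F"
  shows "\<exists>\<Delta>. bounded \<Delta> \<and> F \<subseteq> \<Delta> \<times> UNIV \<and> points a \<subseteq> \<Delta> \<times> UNIV \<and>
    N_cc_loc \<Lambda> (superpose a \<zeta>) - N_cc_loc \<Lambda> \<zeta> =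
    int (card (comps touch (points \<zeta> \<inter> \<Delta> \<times> UNIV \<union> points a))) - int (card (comps touch (points \<zeta> \<inter> \<Delta> \<times> UNIV)))"
proof -
  note conf = assms(1,2)[THEN tame_configurations]
  have fa: "finite (points a)"
    using tame_finite_points[OF assms(1,5)] assms(3) by (simp add: Int_absorb2)
  have "eventually (\<lambda>k. \<exists>\<Delta>. bounded \<Delta> \<and> F \<subseteq> \<Delta> \<times> UNIV \<and> points a \<subseteq> \<Delta> \<times> UNIV \<and>
    N_cc_loc \<Lambda> (superpose a \<zeta>) - N_cc_loc \<Lambda> \<zeta> =
    int (card (comps touch (points \<zeta> \<inter> \<Delta> \<times> UNIV \<union> points a))) - int (card (comps touch (points \<zeta> \<inter> \<Delta> \<times> UNIV)))) sequentially"
    using N_cc_loc_eventually[OF tame_superpose[OF assms(1,2)] assms(4,5) exhaustion_balls]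
      N_cc_loc_eventually[OF assms(2,4,5) exhaustion_balls]
      exhaustion_eventually_superset[OF exhaustion_balls finite_UnI[OF assms(6) fa]]
  proof eventually_elim
    case (elim k)
    let ?D = "cball (0::real^'n) (real k)"
    have "points (superpose a \<zeta>) \<inter> ?D \<times> UNIV = points \<zeta> \<inter> ?D \<times> UNIV \<union> points a"
      using elim(3) by (auto simp: points_superpose conf)
    moreover have "points (superpose a \<zeta>) \<inter> (?D - \<Lambda>) \<times> UNIV = points \<zeta> \<inter> (?D - \<Lambda>) \<times> UNIV"
      using assms(3) by (auto simp: points_superpose conf)
    ultimately show ?case
      using elim conf assms(4) by (intro exI[of _ ?D]) (simp add: N_cc_restr)
  qed
  then show ?thesis using eventually_happens[of _ sequentially] by auto
qed

lemma N_cc_loc_superpose_ge: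
  assumes "tame r a" "tame r \<zeta>" "points a \<subseteq> \<Lambda> \<times> UNIV" "\<Lambda> \<in> sets borel" "bounded \<Lambda>"
    and Y: "finite Y" "Y \<subseteq> points \<zeta>"
    and touch: "\<And>p w. p \<in> points \<zeta> \<Longrightarrow> w \<in> points a \<Longrightarrow> touch p w \<Longrightarrow> \<exists>y\<in>Y. touch p y"
  shows "N_cc_loc \<Lambda> \<zeta> - int (card Y) \<le> N_cc_loc \<Lambda> (superpose a \<zeta>)"
proof -
  obtain \<Delta> where D: "bounded \<Delta>" "Y \<subseteq> \<Delta> \<times> UNIV" "points a \<subseteq> \<Delta> \<times> UNIV" and
    eq: "N_cc_loc \<Lambda> (superpose a \<zeta>) - N_cc_loc \<Lambda> \<zeta> =
    int (card (comps touch (points \<zeta> \<inter> \<Delta> \<times> UNIV \<union> points a))) - int (card (comps touch (points \<zeta> \<inter> \<Delta> \<times> UNIV)))"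
    using N_cc_loc_superpose[OF assms(1-5) Y(1)] by blast
  have "finite (points a)"
    using tame_finite_points[OF assms(1,5)] assms(3) by (simp add: Int_absorb2)
  then have "card (comps touch (points \<zeta> \<inter> \<Delta> \<times> UNIV)) \<le>
    card (comps touch (points \<zeta> \<inter> \<Delta> \<times> UNIV \<union> points a)) + card Y"
    using D Y touch tame_finite_points[OF assms(2) D(1)]
    by (intro touch.card_comps_le_Un) auto
  then show ?thesis using eq by linarith
qed

lemma N_cc_loc_superpose_le:
  assumes "tame r a" "tame r \<zeta>" "points a \<subseteq> \<Lambda> \<times> UNIV" "\<Lambda> \<in> sets borel" "bounded \<Lambda>"
    and "\<And>p w. p \<in> points a \<Longrightarrow> w \<in> points a \<Longrightarrow> touch p w"
  shows "N_cc_loc \<Lambda> (superpose a \<zeta>) \<le> N_cc_loc \<Lambda> \<zeta> + 1"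
proof -
  obtain \<Delta> where D: "bounded \<Delta>" and
    eq: "N_cc_loc \<Lambda> (superpose a \<zeta>) - N_cc_loc \<Lambda> \<zeta> =
    int (card (comps touch (points \<zeta> \<inter> \<Delta> \<times> UNIV \<union> points a))) - int (card (comps touch (points \<zeta> \<inter> \<Delta> \<times> UNIV)))"
    using N_cc_loc_superpose[OF assms(1-5) finite.emptyI] by blast
  have "finite (points a)"
    using tame_finite_points[OF assms(1,5)] assms(3) by (simp add: Int_absorb2)
  then have "card (comps touch (points \<zeta> \<inter> \<Delta> \<times> UNIV \<union> points a)) \<le>
    card (comps touch (points \<zeta> \<inter> \<Delta> \<times> UNIV)) + 1"
    using assms(6) tame_finite_points[OF assms(2) D(1)]
    by (intro touch.card_comps_Un_clique_le) auto
  then show ?thesis using eq by linarith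
qed

subsection \<open>Measurability and local events\<close>

lemma space_conf_algebra [simp]: "space conf_algebra = configurations"
  unfolding conf_algebra_def by (subst space_Sup_eq_UN) auto

lemma conf_algebra_bound_ne: "{\<Gamma>\<in>sets borel. bounded (\<Gamma> :: ((real ^ 'n::finite) \<times> real) set)} \<noteq> {}"
  by (auto intro: exI[of _ "{}"])

lemma measurable_emeasure_conf:
  assumes "bounded \<Gamma>" "\<Gamma> \<in> sets borel"
  shows "(\<lambda>\<omega>. emeasure \<omega> \<Gamma>) \<in> borel_measurable conf_algebra"
  unfolding conf_algebra_def using assms
  by (intro measurable_SUP1[of \<Gamma>] measurable_vimage_algebra1) auto

lemma measurable_conf_algebraI:
  assumes "\<And>x. x \<in> space M \<Longrightarrow> f x \<in> configurations"
    and "\<And>\<Gamma>. bounded \<Gamma> \<Longrightarrow> \<Gamma> \<in> sets borel \<Longrightarrow> (\<lambda>x. emeasure (f x) \<Gamma>) \<in> borel_measurable M"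
  shows "f \<in> measurable M conf_algebra"
  unfolding conf_algebra_def using assms conf_algebra_bound_ne
  by (intro measurable_SUP2 measurable_vimage_algebra2) auto

lemma measurable_cut:
  assumes "\<Gamma> \<in> sets borel" shows "cut \<Gamma> \<in> measurable conf_algebra conf_algebra"
proof (rule measurable_conf_algebraI)
  fix G :: "((real ^ 'a) \<times> real) set" assume G: "bounded G" "G \<in> sets borel"
  have "(\<lambda>\<omega>. emeasure \<omega> (G \<inter> \<Gamma>)) \<in> borel_measurable conf_algebra"
    using G assms by (intro measurable_emeasure_conf) (auto intro: bounded_subset)
  then show "(\<lambda>\<omega>. emeasure (cut \<Gamma> \<omega>) G) \<in> borel_measurable conf_algebra"
    by (subst measurable_cong[where g = "\<lambda>\<omega>. emeasure \<omega> (G \<inter> \<Gamma>)"]) (use G assms in \<open>auto simp: emeasure_cut\<close>)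
qed (use assms in auto)

lemma measurable_superpose:
  fixes f g :: "'a \<Rightarrow> ('n::finite) conf"
  assumes f: "f \<in> measurable M conf_algebra" and g: "g \<in> measurable M conf_algebra"
  shows "(\<lambda>x. superpose (f x) (g x)) \<in> measurable M conf_algebra"
proof (rule measurable_conf_algebraI)
  have conf: "f x \<in> configurations" "g x \<in> configurations" if "x \<in> space M" for x
    using measurable_space[OF f that] measurable_space[OF g that] by auto
  show "superpose (f x) (g x) \<in> configurations" if "x \<in> space M" for x using conf[OF that] by auto
  fix G :: "((real ^ 'n) \<times> real) set" assume G: "bounded G" "G \<in> sets borel"
  have "(\<lambda>x. emeasure (f x) G + emeasure (g x) G) \<in> borel_measurable M"
    using measurable_compose[OF f measurable_emeasure_conf[OF G]]
      measurable_compose[OF g measurable_emeasure_conf[OF G]] by simp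
  then show "(\<lambda>x. emeasure (superpose (f x) (g x)) G) \<in> borel_measurable M"
    by (subst measurable_cong[where g = "\<lambda>x. emeasure (f x) G + emeasure (g x) G"])
      (use G conf in \<open>auto simp: emeasure_superpose\<close>)
qed

lemma measurable_cnt:
  assumes "bounded \<Gamma>" "\<Gamma> \<in> sets borel"
  shows "(\<lambda>\<omega>. cnt \<omega> \<Gamma>) \<in> measurable conf_algebra (count_space UNIV)"
proof -
  note [measurable] = measurable_emeasure_conf[OF assms]
  show ?thesis unfolding cnt_def by measurable
qed

text \<open>Dependence on the points in \<Gamma> alone is phrased by \<open>cut\<close>, so that
  membership can be transferred directly between superpositions with the same points in
  \<Gamma>.\<close>

definition local_event :: "((real ^ 'n) \<times> real) set \<Rightarrow> ('n::finite) conf set \<Rightarrow> bool" where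
  "local_event \<Gamma> A \<longleftrightarrow> A \<in> sets conf_algebra \<and> (\<forall>\<omega>\<in>configurations. \<omega> \<in> A \<longleftrightarrow> cut \<Gamma> \<omega> \<in> A)"

lemma local_event_sets: "local_event \<Gamma> A \<Longrightarrow> A \<in> sets conf_algebra"
  by (simp add: local_event_def)

lemma local_event_cut: "local_event \<Gamma> A \<Longrightarrow> \<omega> \<in> configurations \<Longrightarrow> cut \<Gamma> \<omega> \<in> A \<longleftrightarrow> \<omega> \<in> A"
  by (simp add: local_event_def)

lemma sets_Collect_ball_finite:
  assumes "finite S" "\<And>i. i \<in> S \<Longrightarrow> {x\<in>space M. Pr i x} \<in> sets M"
  shows "{x\<in>space M. \<forall>i\<in>S. Pr i x} \<in> sets M"
proof (cases "S = {}")
  case False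
  then show ?thesis using assms by (intro sets.sets_Collect_finite_All') auto
qed simp

lemma local_event_Int: "local_event \<Gamma> A \<Longrightarrow> local_event \<Gamma> B \<Longrightarrow> local_event \<Gamma> (A \<inter> B)"
  by (auto simp: local_event_def)

lemma local_event_space: "\<Gamma> \<in> sets borel \<Longrightarrow> local_event \<Gamma> configurations"
  using sets.top[of conf_algebra] by (auto simp: local_event_def)

lemma local_event_INT:
  assumes "finite I" "\<And>i. i \<in> I \<Longrightarrow> local_event \<Gamma> (A i)" "\<Gamma> \<in> sets borel"
  shows "local_event \<Gamma> (configurations \<inter> (\<Inter>i\<in>I. A i))"
  using assms(1,2)
proof induction
  case (insert i I)
  have "local_event \<Gamma> (A i \<inter> (configurations \<inter> (\<Inter>i\<in>I. A i)))"
    by (rule local_event_Int) (use insert in blast)+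
  then show ?case by (simp add: Int_ac)
qed (simp add: local_event_space assms)

lemma local_event_cnt:
  assumes "\<Gamma>' \<subseteq> \<Gamma>" "bounded \<Gamma>'" "\<Gamma> \<in> sets borel" "\<Gamma>' \<in> sets borel"
  shows "local_event \<Gamma> {\<omega>\<in>configurations. Pr (cnt \<omega> \<Gamma>')}"
proof -
  have "cnt (cut \<Gamma> \<omega>) \<Gamma>' = cnt \<omega> \<Gamma>'" if "\<omega> \<in> configurations" for \<omega>
    unfolding cnt_def using that assms by (simp add: emeasure_cut Int_absorb2)
  moreover have "(\<lambda>\<omega>. cnt \<omega> \<Gamma>') -` {k. Pr k} \<inter> space conf_algebra \<in> sets conf_algebra"
    using measurable_cnt[OF assms(2,4)] by (rule measurable_sets) simp
  then have "{\<omega>\<in>configurations. Pr (cnt \<omega> \<Gamma>')} \<in> sets conf_algebra"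
    by (simp add: vimage_def Int_def conj_commute)
  ultimately show ?thesis using assms by (auto simp: local_event_def)
qed

subsection \<open>Independence of the Poisson process on disjoint regions\<close>

text \<open>\<open>poisson_law\<close> provides independence only for pairwise disjoint bounded
  sets; a family with overlaps is therefore decomposed into the atoms it generates.\<close>

lemma atoms_refine:
  fixes \<G> :: "('a::real_normed_vector) set set"
  assumes "finite \<G>" and G: "\<And>G. G \<in> \<G> \<Longrightarrow> G \<in> sets borel \<and> bounded G"
  obtains N :: nat and e where "\<forall>i<N. e i \<in> sets borel \<and> bounded (e i) \<and> e i \<noteq> {}"
    "disjoint_family_on e {..<N}" "\<forall>G\<in>\<G>. G = (\<Union>i\<in>{i. i < N \<and> e i \<subseteq> G}. e i)"
proof -
  define atom where "atom H = {x. {G\<in>\<G>. x \<in> G} = H}" for H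
  \<comment> \<open>The atom of points in no set of the family is unbounded and is left out. Empty
    atoms are removed so that a common atom of two disjoint regions is contradictory.\<close>
  define \<A> where "\<A> = atom ` (Pow \<G> - {{}}) - {{}}"
  have "finite \<A>" using assms(1) by (simp add: \<A>_def)
  then obtain e where "bij_betw e {0..<card \<A>} \<A>" using ex_bij_betw_nat_finite by blast
  then have e: "bij_betw e {..<card \<A>} \<A>" by (simp add: lessThan_atLeast0)
  have atom: "a \<in> sets borel \<and> bounded a \<and> a \<noteq> {}" if a: "a \<in> \<A>" for a
  proof -
    obtain H where H: "H \<subseteq> \<G>" "H \<noteq> {}" "a = atom H" "a \<noteq> {}" using a by (auto simp: \<A>_def)
    have eq: "atom H = \<Inter>H - \<Union>(\<G> - H)" using H by (auto simp: atom_def)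
    have "finite H" using H assms(1) finite_subset by blast
    then have "(\<Inter>G\<in>H. G) \<in> sets borel" using H G by (intro sets.finite_INT) auto
    then have "\<Inter>H \<in> sets borel" by simp
    moreover have "\<Union>(\<G> - H) \<in> sets borel" using assms(1) G by (intro sets.finite_Union) auto
    ultimately have "a \<in> sets borel" unfolding H(3) eq by simp
    moreover obtain G where "G \<in> H" using H by auto
    then have "a \<subseteq> G" "bounded G" unfolding H(3) eq using H(1) assms(2) by auto
    ultimately show ?thesis using H(4) bounded_subset by blast
  qed
  have disj: "a \<inter> b = {}" if "a \<in> \<A>" "b \<in> \<A>" "a \<noteq> b" for a b
    using that by (auto simp: \<A>_def atom_def)
  have "disjoint_family_on e {..<card \<A>}"
    unfolding disjoint_family_on_def
  proof (intro ballI impI)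
    fix i j assume "i \<in> {..<card \<A>}" "j \<in> {..<card \<A>}" "i \<noteq> j"
    then have "e i \<noteq> e j" "e i \<in> \<A>" "e j \<in> \<A>"
      using e by (auto simp: bij_betw_def inj_on_def)
    then show "e i \<inter> e j = {}" using disj by blast
  qed
  moreover have "G = (\<Union>i\<in>{i. i < card \<A> \<and> e i \<subseteq> G}. e i)" if "G \<in> \<G>" for G
  proof
    show "G \<subseteq> (\<Union>i\<in>{i. i < card \<A> \<and> e i \<subseteq> G}. e i)"
    proof
      fix x assume x: "x \<in> G"
      let ?a = "atom {G\<in>\<G>. x \<in> G}"
      have "x \<in> ?a" by (simp add: atom_def)
      then have "?a \<in> \<A>" using that x by (auto simp: \<A>_def)
      then have "?a \<in> e ` {..<card \<A>}" using e by (simp add: bij_betw_def)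
      then obtain i where i: "i < card \<A>" "e i = ?a" by auto
      have "?a \<subseteq> G" using that x by (auto simp: atom_def)
      then show "x \<in> (\<Union>i\<in>{i. i < card \<A> \<and> e i \<subseteq> G}. e i)" using i \<open>x \<in> ?a\<close> by auto
    qed
  qed auto
  moreover have "e i \<in> sets borel \<and> bounded (e i) \<and> e i \<noteq> {}" if "i < card \<A>" for i
    using e atom[of "e i"] that by (auto simp: bij_betw_def)
  ultimately show thesis using that by metis
qed

text \<open>A generator, stable under intersection, of the events determined by the points in
  \<Gamma>; independence extends from it to the generated \<sigma>-algebra.\<close>

definition count_events :: "((real ^ 'n) \<times> real) set \<Rightarrow> ('n::finite) conf set set" where
  "count_events \<Gamma> = {{\<omega>\<in>configurations. \<forall>G\<in>\<G>. emeasure \<omega> G \<in> B G} | \<G> B.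
     finite \<G> \<and> (\<forall>G\<in>\<G>. G \<in> sets borel \<and> bounded G \<and> G \<subseteq> \<Gamma> \<and> B G \<in> sets borel)}"

lemma count_eventsI:
  "finite \<G> \<Longrightarrow> (\<And>G. G \<in> \<G> \<Longrightarrow> G \<in> sets borel \<and> bounded G \<and> G \<subseteq> \<Gamma> \<and> B G \<in> sets borel) \<Longrightarrow>
    {\<omega>\<in>configurations. \<forall>G\<in>\<G>. emeasure \<omega> G \<in> B G} \<in> count_events \<Gamma>"
  unfolding count_events_def by blast

lemma Int_stable_count_events: "Int_stable (count_events \<Gamma>)"
proof (rule Int_stableI)
  fix a b assume "a \<in> count_events \<Gamma>" "b \<in> count_events \<Gamma>"
  then obtain \<G> B \<G>' B' where
    a: "a = {\<omega>\<in>configurations. \<forall>G\<in>\<G>. emeasure \<omega> G \<in> B G}" "finite \<G>"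
      "\<forall>G\<in>\<G>. G \<in> sets borel \<and> bounded G \<and> G \<subseteq> \<Gamma> \<and> B G \<in> sets borel" and
    b: "b = {\<omega>\<in>configurations. \<forall>G\<in>\<G>'. emeasure \<omega> G \<in> B' G}" "finite \<G>'"
      "\<forall>G\<in>\<G>'. G \<in> sets borel \<and> bounded G \<and> G \<subseteq> \<Gamma> \<and> B' G \<in> sets borel"
    unfolding count_events_def by blast
  define C where "C G = (if G \<in> \<G> then B G else UNIV) \<inter> (if G \<in> \<G>' then B' G else UNIV)" for G
  have "a \<inter> b = {\<omega>\<in>configurations. \<forall>G\<in>\<G> \<union> \<G>'. emeasure \<omega> G \<in> C G}"
    unfolding a(1) b(1) C_def by auto
  also have "\<dots> \<in> count_events \<Gamma>"
    using a b by (intro count_eventsI) (auto simp: C_def)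
  finally show "a \<inter> b \<in> count_events \<Gamma>" .
qed

lemma count_events_sets: "count_events \<Gamma> \<subseteq> sets conf_algebra"
proof
  fix a assume "a \<in> count_events \<Gamma>"
  then obtain \<G> B where
    a: "a = {\<omega>\<in>configurations. \<forall>G\<in>\<G>. emeasure \<omega> G \<in> B G}" "finite \<G>"
      "\<forall>G\<in>\<G>. G \<in> sets borel \<and> bounded G \<and> G \<subseteq> \<Gamma> \<and> B G \<in> sets borel"
    unfolding count_events_def by blast
  have "{\<omega>\<in>space conf_algebra. \<forall>G\<in>\<G>. emeasure \<omega> G \<in> B G} \<in> sets conf_algebra"
  proof (rule sets_Collect_ball_finite[OF a(2)])
    fix G assume "G \<in> \<G>"
    then have "(\<lambda>\<omega>. emeasure \<omega> G) -` B G \<inter> space conf_algebra \<in> sets conf_algebra"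
      using a(3) by (intro measurable_sets[OF measurable_emeasure_conf]) auto
    then show "{\<omega>\<in>space conf_algebra. emeasure \<omega> G \<in> B G} \<in> sets conf_algebra"
      by (simp add: vimage_def Int_def conj_commute)
  qed
  then show "a \<in> sets conf_algebra" unfolding a(1) by simp
qed

lemma cut_preimage_sigma:
  assumes "\<Gamma> \<in> sets borel" "A \<in> sets conf_algebra"
  shows "cut \<Gamma> -` A \<inter> configurations \<in> sigma_sets configurations (count_events \<Gamma>)"
proof -
  let ?M = "sigma configurations (count_events \<Gamma>)"
  have pow: "count_events \<Gamma> \<subseteq> Pow configurations" by (auto simp: count_events_def)
  have "cut \<Gamma> \<in> measurable ?M conf_algebra"
  proof (rule measurable_conf_algebraI)
    fix G :: "((real ^ 'a) \<times> real) set" assume G: "bounded G" "G \<in> sets borel"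
    have "(\<lambda>\<omega>. emeasure \<omega> (G \<inter> \<Gamma>)) \<in> borel_measurable ?M"
    proof (rule measurableI)
      fix B :: "ennreal set" assume B: "B \<in> sets borel"
      have "{\<omega>\<in>configurations. \<forall>G'\<in>{G \<inter> \<Gamma>}. emeasure \<omega> G' \<in> B} \<in> count_events \<Gamma>"
        using G B assms by (intro count_eventsI) (auto intro: bounded_subset)
      then show "(\<lambda>\<omega>. emeasure \<omega> (G \<inter> \<Gamma>)) -` B \<inter> space ?M \<in> sets ?M"
        using pow by (auto simp: space_measure_of_conv sets_measure_of vimage_def Int_def conj_commute)
    qed simp
    then show "(\<lambda>\<omega>. emeasure (cut \<Gamma> \<omega>) G) \<in> borel_measurable ?M"
      by (subst measurable_cong[where g = "\<lambda>\<omega>. emeasure \<omega> (G \<inter> \<Gamma>)"])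
        (use G assms in \<open>auto simp: emeasure_cut space_measure_of_conv\<close>)
  qed (use assms in \<open>auto simp: space_measure_of_conv\<close>)
  from measurable_sets[OF this assms(2)] show ?thesis
    using pow by (simp add: space_measure_of_conv sets_measure_of)
qed

text \<open>After refinement both events depend on counts of atoms, and a nonempty atom cannot lie
  in two disjoint regions. Grouping independent counts into two disjoint blocks of indices gives
  independent blocks.\<close>

lemma indep_count_events:
  fixes \<pi> :: "('n::finite) conf measure"
  assumes \<pi>: "poisson_law z Q \<pi>" and disj: "\<Gamma>1 \<inter> \<Gamma>2 = {}"
    and a: "a \<in> count_events \<Gamma>1" and b: "b \<in> count_events \<Gamma>2"
  shows "measure \<pi> (a \<inter> b) = measure \<pi> a * measure \<pi> b"
proof -
  interpret \<pi>: prob_space \<pi> using \<pi> by (simp add: poisson_law_def)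
  have sets_\<pi>: "sets \<pi> = sets conf_algebra" using \<pi> by (simp add: poisson_law_def)
  have space_\<pi>: "space \<pi> = configurations" using sets_eq_imp_space_eq[OF sets_\<pi>] by simp
  obtain \<G>1 B1 where
    a: "a = {\<omega>\<in>configurations. \<forall>G\<in>\<G>1. emeasure \<omega> G \<in> B1 G}" "finite \<G>1"
      "\<And>G. G \<in> \<G>1 \<Longrightarrow> G \<in> sets borel \<and> bounded G \<and> G \<subseteq> \<Gamma>1 \<and> B1 G \<in> sets borel"
    using a unfolding count_events_def by blast
  obtain \<G>2 B2 where
    b: "b = {\<omega>\<in>configurations. \<forall>G\<in>\<G>2. emeasure \<omega> G \<in> B2 G}" "finite \<G>2"
      "\<And>G. G \<in> \<G>2 \<Longrightarrow> G \<in> sets borel \<and> bounded G \<and> G \<subseteq> \<Gamma>2 \<and> B2 G \<in> sets borel"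
    using b unfolding count_events_def by blast
  have "finite (\<G>1 \<union> \<G>2)" "\<And>G. G \<in> \<G>1 \<union> \<G>2 \<Longrightarrow> G \<in> sets borel \<and> bounded G"
    using a(2,3) b(2,3) by auto
  then obtain N :: nat and e where e': "\<forall>i<N. e i \<in> sets borel \<and> bounded (e i) \<and> e i \<noteq> {}"
    and ed: "disjoint_family_on e {..<N}"
    and ref': "\<forall>G\<in>\<G>1 \<union> \<G>2. G = (\<Union>i\<in>{i. i < N \<and> e i \<subseteq> G}. e i)"
    by (rule atoms_refine) blast
  note e = e'[rule_format] and ref = ref'[rule_format]
  let ?X = "\<lambda>i \<omega>. emeasure \<omega> (e i)"
  define idx where "idx \<G> = {i. i < N \<and> (\<exists>G\<in>\<G>. e i \<subseteq> G)}" for \<G>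
  have indep: "\<pi>.indep_vars (\<lambda>_. borel) ?X {..<N}"
    using \<pi> e ed unfolding poisson_law_def by blast
  have "idx \<G>1 \<inter> idx \<G>2 = {}"
  proof (rule ccontr)
    assume "idx \<G>1 \<inter> idx \<G>2 \<noteq> {}"
    then obtain i G G' where "i < N" "G \<in> \<G>1" "G' \<in> \<G>2" "e i \<subseteq> G" "e i \<subseteq> G'"
      by (auto simp: idx_def)
    then have "e i \<subseteq> \<Gamma>1 \<inter> \<Gamma>2" using a(3) b(3) by blast
    then show False using e[OF \<open>i < N\<close>] disj by auto
  qed
  then have ind: "\<pi>.indep_var (PiM (idx \<G>1) (\<lambda>_. borel)) (\<lambda>\<omega>. restrict (\<lambda>i. ?X i \<omega>) (idx \<G>1))
      (PiM (idx \<G>2) (\<lambda>_. borel)) (\<lambda>\<omega>. restrict (\<lambda>i. ?X i \<omega>) (idx \<G>2))"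
    using indep by (intro \<pi>.indep_var_restrict[where I = "{..<N}"]) (auto simp: idx_def)
  define S where "S \<G> B = {f\<in>space (PiM (idx \<G>) (\<lambda>_. borel :: ennreal measure)).
    \<forall>G\<in>\<G>. (\<Sum>i\<in>{i. i < N \<and> e i \<subseteq> G}. f i) \<in> B G}" for \<G> and B :: "_ \<Rightarrow> ennreal set"
  have S: "S \<G> B \<in> sets (PiM (idx \<G>) (\<lambda>_. borel))"
    if "finite \<G>" "\<And>G. G \<in> \<G> \<Longrightarrow> B G \<in> sets borel" for \<G> and B :: "_ \<Rightarrow> ennreal set"
    unfolding S_def
  proof (rule sets_Collect_ball_finite[OF that(1)])
    fix G assume G: "G \<in> \<G>"
    have [measurable]: "(\<lambda>f. \<Sum>i\<in>{i. i < N \<and> e i \<subseteq> G}. f i) \<in> borel_measurable (PiM (idx \<G>) (\<lambda>_. borel :: ennreal measure))"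
      using G by (intro borel_measurable_sum measurable_component_singleton) (auto simp: idx_def)
    show "{f\<in>space (PiM (idx \<G>) (\<lambda>_. borel)). (\<Sum>i\<in>{i. i < N \<and> e i \<subseteq> G}. f i) \<in> B G}
        \<in> sets (PiM (idx \<G>) (\<lambda>_. borel))"
      using that(2)[OF G] by measurable
  qed
  have pre: "(\<lambda>\<omega>. restrict (\<lambda>i. ?X i \<omega>) (idx \<G>)) -` S \<G> B \<inter> space \<pi> = {\<omega>\<in>configurations. \<forall>G\<in>\<G>. emeasure \<omega> G \<in> B G}"
    if "\<G> \<subseteq> \<G>1 \<union> \<G>2" for \<G> and B :: "_ \<Rightarrow> ennreal set"
  proof -
    have "(\<Sum>i\<in>{i. i < N \<and> e i \<subseteq> G}. restrict (\<lambda>i. ?X i \<omega>) (idx \<G>) i) = emeasure \<omega> G"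
      if \<omega>: "\<omega> \<in> configurations" and G: "G \<in> \<G>" for \<omega> G
    proof -
      have "emeasure \<omega> G = emeasure \<omega> (\<Union>i\<in>{i. i < N \<and> e i \<subseteq> G}. e i)"
        using ref[of G] G \<open>\<G> \<subseteq> \<G>1 \<union> \<G>2\<close> by auto
      also have "\<dots> = (\<Sum>i\<in>{i. i < N \<and> e i \<subseteq> G}. ?X i \<omega>)"
        using \<omega> e ed by (intro sum_emeasure[symmetric]) (auto simp: disjoint_family_on_def)
      also have "\<dots> = (\<Sum>i\<in>{i. i < N \<and> e i \<subseteq> G}. restrict (\<lambda>i. ?X i \<omega>) (idx \<G>) i)"
        using G by (intro sum.cong) (auto simp: idx_def)
      finally show ?thesis by simp
    qed
    then show ?thesis by (auto simp: S_def space_\<pi> space_PiM)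
  qed
  have "measure \<pi> ((\<lambda>x. (restrict (\<lambda>i. ?X i x) (idx \<G>1), restrict (\<lambda>i. ?X i x) (idx \<G>2))) -` (S \<G>1 B1 \<times> S \<G>2 B2) \<inter> space \<pi>)
      = measure \<pi> a * measure \<pi> b"
    using \<pi>.indep_varD[OF ind S S] a b by (simp add: pre)
  moreover have "(\<lambda>x. (restrict (\<lambda>i. ?X i x) (idx \<G>1), restrict (\<lambda>i. ?X i x) (idx \<G>2))) -` (S \<G>1 B1 \<times> S \<G>2 B2) \<inter> space \<pi>
     = ((\<lambda>\<omega>. restrict (\<lambda>i. ?X i \<omega>) (idx \<G>1)) -` S \<G>1 B1 \<inter> space \<pi>) \<inter> ((\<lambda>\<omega>. restrict (\<lambda>i. ?X i \<omega>) (idx \<G>2)) -` S \<G>2 B2 \<inter> space \<pi>)"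
    by auto
  ultimately show ?thesis using a(1) b(1) by (simp add: pre)
qed

lemma poisson_indep_cut:
  assumes \<pi>: "poisson_law z Q \<pi>" and disj: "\<Gamma>1 \<inter> \<Gamma>2 = {}" and "\<Gamma>1 \<in> sets borel" "\<Gamma>2 \<in> sets borel"
  shows "prob_space.indep_var \<pi> conf_algebra (cut \<Gamma>1) conf_algebra (cut \<Gamma>2)"
proof -
  interpret \<pi>: prob_space \<pi> using \<pi> by (simp add: poisson_law_def)
  have sets_\<pi>: "sets \<pi> = sets conf_algebra" using \<pi> by (simp add: poisson_law_def)
  have space_\<pi>: "space \<pi> = configurations" using sets_eq_imp_space_eq[OF sets_\<pi>] by simp
  have "\<pi>.indep_set (count_events \<Gamma>1) (count_events \<Gamma>2)"
    unfolding \<pi>.indep_sets2_eq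
    using indep_count_events[OF \<pi> disj] count_events_sets sets_\<pi> by auto
  then have ind: "\<pi>.indep_set (sigma_sets (space \<pi>) (count_events \<Gamma>1)) (sigma_sets (space \<pi>) (count_events \<Gamma>2))"
    by (intro \<pi>.indep_set_sigma_sets Int_stable_count_events)
  have sub: "sigma_sets (space \<pi>) {cut \<Gamma> -` A \<inter> space \<pi> |A. A \<in> sets conf_algebra} \<subseteq> sigma_sets (space \<pi>) (count_events \<Gamma>)"
    if "\<Gamma> \<in> sets borel" for \<Gamma>
    by (intro sigma_sets_mono) (auto simp: space_\<pi> intro: cut_preimage_sigma[OF that])
  have "\<pi>.indep_set (sigma_sets (space \<pi>) {cut \<Gamma>1 -` A \<inter> space \<pi> |A. A \<in> sets conf_algebra})
     (sigma_sets (space \<pi>) {cut \<Gamma>2 -` A \<inter> space \<pi> |A. A \<in> sets conf_algebra})"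
    unfolding \<pi>.indep_set_def
    by (rule \<pi>.indep_sets_mono_sets[OF ind[unfolded \<pi>.indep_set_def]])
      (use sub assms in \<open>auto split: bool.split\<close>)
  moreover have "cut \<Gamma> \<in> measurable \<pi> conf_algebra" if "\<Gamma> \<in> sets borel" for \<Gamma>
    using measurable_cut[OF that] by (simp add: measurable_cong_sets[OF sets_\<pi> refl])
  ultimately show ?thesis using assms by (simp add: \<pi>.indep_var_eq)
qed

text \<open>Independence makes the joint law of the two parts a product, so they may be sampled from
  two separate copies and integrated one after the other.\<close>

lemma poisson_nn_integral_split:
  assumes \<pi>: "poisson_law z Q \<pi>" and disj: "\<Gamma>1 \<inter> \<Gamma>2 = {}" and \<Gamma>: "\<Gamma>1 \<in> sets borel" "\<Gamma>2 \<in> sets borel"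
    and F: "F \<in> borel_measurable (conf_algebra \<Otimes>\<^sub>M conf_algebra)"
  shows "(\<integral>\<^sup>+\<omega>. F (cut \<Gamma>1 \<omega>, cut \<Gamma>2 \<omega>) \<partial>\<pi>) = (\<integral>\<^sup>+b. (\<integral>\<^sup>+a. F (cut \<Gamma>1 b, cut \<Gamma>2 a) \<partial>\<pi>) \<partial>\<pi>)"
proof -
  interpret \<pi>: prob_space \<pi> using \<pi> by (simp add: poisson_law_def)
  have sets_\<pi>: "sets \<pi> = sets conf_algebra" using \<pi> by (simp add: poisson_law_def)
  have m: "cut \<Gamma>1 \<in> measurable \<pi> conf_algebra" "cut \<Gamma>2 \<in> measurable \<pi> conf_algebra"
    using measurable_cut \<Gamma> by (simp_all add: measurable_cong_sets[OF sets_\<pi> refl])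
  let ?D1 = "distr \<pi> conf_algebra (cut \<Gamma>1)" and ?D2 = "distr \<pi> conf_algebra (cut \<Gamma>2)"
  interpret D2: prob_space ?D2 by (rule \<pi>.prob_space_distr) fact
  have F': "F \<in> borel_measurable (?D1 \<Otimes>\<^sub>M ?D2)" using F by simp
  have "(\<integral>\<^sup>+\<omega>. F (cut \<Gamma>1 \<omega>, cut \<Gamma>2 \<omega>) \<partial>\<pi>)
      = (\<integral>\<^sup>+p. F p \<partial>distr \<pi> (conf_algebra \<Otimes>\<^sub>M conf_algebra) (\<lambda>\<omega>. (cut \<Gamma>1 \<omega>, cut \<Gamma>2 \<omega>)))"
    using F m by (subst nn_integral_distr) auto
  also have "\<dots> = (\<integral>\<^sup>+p. F p \<partial>(?D1 \<Otimes>\<^sub>M ?D2))"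
    using poisson_indep_cut[OF \<pi> disj \<Gamma>] by (simp add: \<pi>.indep_var_distribution_eq)
  also have "\<dots> = (\<integral>\<^sup>+x. (\<integral>\<^sup>+y. F (x, y) \<partial>?D2) \<partial>?D1)"
    by (rule D2.nn_integral_fst[OF F', symmetric])
  also have "\<dots> = (\<integral>\<^sup>+b. (\<integral>\<^sup>+y. F (cut \<Gamma>1 b, y) \<partial>?D2) \<partial>\<pi>)"
    using D2.borel_measurable_nn_integral_fst[OF F'] m by (subst nn_integral_distr) auto
  also have "\<dots> = (\<integral>\<^sup>+b. (\<integral>\<^sup>+a. F (cut \<Gamma>1 b, cut \<Gamma>2 a) \<partial>\<pi>) \<partial>\<pi>)"
  proof (rule nn_integral_cong)
    fix b assume "b \<in> space \<pi>"
    then have "cut \<Gamma>1 b \<in> space conf_algebra" using measurable_space[OF m(1)] by simp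
    then have "(\<lambda>y. F (cut \<Gamma>1 b, y)) \<in> borel_measurable conf_algebra"
      using measurable_Pair2[OF F] by blast
    then show "(\<integral>\<^sup>+y. F (cut \<Gamma>1 b, y) \<partial>?D2) = (\<integral>\<^sup>+a. F (cut \<Gamma>1 b, cut \<Gamma>2 a) \<partial>\<pi>)"
      using m by (subst nn_integral_distr) auto
  qed
  finally show ?thesis .
qed

subsection \<open>Consequences of the DLR equations\<close>

locale crcm =
  fixes z q R\<^sub>0 :: real and Q :: "real measure" and P \<pi> :: "('n::finite) conf measure"
  assumes z_pos: "0 < z" and q_pos: "0 < q" and q_less: "q < 1" and R0_pos: "0 < R\<^sub>0"
    and prob_Q: "prob_space Q" and sets_Q: "sets Q = sets borel" and Q_R0: "emeasure Q {0..R\<^sub>0} = 1"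
    and prob_P: "prob_space P" and sets_P: "sets P = sets conf_algebra"
    and poisson: "poisson_law z Q \<pi>"
    and partition_fun_AE: "\<And>\<Lambda>. \<Lambda> \<in> sets borel \<Longrightarrow> bounded \<Lambda> \<Longrightarrow>
      AE \<omega> in P. 0 < partition_fun q \<pi> \<Lambda> (restr (- \<Lambda>) \<omega>) \<and> partition_fun q \<pi> \<Lambda> (restr (- \<Lambda>) \<omega>) < \<infinity>"
    and DLR: "\<And>\<Lambda> f. \<Lambda> \<in> sets borel \<Longrightarrow> bounded \<Lambda> \<Longrightarrow> f \<in> borel_measurable conf_algebra \<Longrightarrow>
      (\<exists>B. \<forall>\<omega>\<in>configurations. \<bar>f \<omega>\<bar> \<le> B) \<Longrightarrow>
      (\<integral>\<omega>. f \<omega> \<partial>P) = (\<integral>\<omega>. (\<integral>\<omega>'. f (superpose \<omega>' (restr (- \<Lambda>) \<omega>)) *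
         (q powi N_cc_loc \<Lambda> (superpose \<omega>' (restr (- \<Lambda>) \<omega>)) /
          enn2real (partition_fun q \<pi> \<Lambda> (restr (- \<Lambda>) \<omega>))) \<partial>project \<Lambda> \<pi>) \<partial>P)"
begin

sublocale P: prob_space P by (rule prob_P)
sublocale \<pi>: prob_space \<pi> using poisson by (simp add: poisson_law_def)
sublocale Q: prob_space Q by (rule prob_Q)

lemma sets_\<pi>: "sets \<pi> = sets conf_algebra"
  using poisson by (simp add: poisson_law_def)

lemma space_\<pi> [simp]: "space \<pi> = configurations"
  using sets_eq_imp_space_eq[OF sets_\<pi>] by simp

lemma space_P [simp]: "space P = configurations"
  using sets_eq_imp_space_eq[OF sets_P] by simp

section \<open>Intensity measure and the almost sure bound on the radii\<close>

definition mu :: "((real ^ 'n) \<times> real) set \<Rightarrow> real" where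
  "mu \<Gamma> = z * measure (lborel \<Otimes>\<^sub>M Q) \<Gamma>"

lemma mu_nonneg: "0 \<le> mu \<Gamma>"
  using z_pos by (simp add: mu_def)

lemma prob_cnt:
  assumes "bounded \<Gamma>" "\<Gamma> \<in> sets borel"
  shows "measure \<pi> {\<omega>\<in>configurations. cnt \<omega> \<Gamma> = k} = mu \<Gamma> ^ k / fact k * exp (- mu \<Gamma>)"
proof -
  have "measure \<pi> {\<omega>\<in>space \<pi>. emeasure \<omega> \<Gamma> = of_nat k} = mu \<Gamma> ^ k / fact k * exp (- mu \<Gamma>)"
    using poisson assms unfolding poisson_law_def mu_def Let_def by blast
  moreover have "{\<omega>\<in>space \<pi>. emeasure \<omega> \<Gamma> = of_nat k} = {\<omega>\<in>configurations. cnt \<omega> \<Gamma> = k}"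
    using assms by (auto simp: emeasure_eq_of_nat_iff)
  ultimately show ?thesis by simp
qed

lemma cnt_event: "bounded \<Gamma> \<Longrightarrow> \<Gamma> \<in> sets borel \<Longrightarrow> {\<omega>\<in>configurations. Pr (cnt \<omega> \<Gamma>)} \<in> sets conf_algebra"
  using local_event_cnt[of \<Gamma> UNIV Pr] by (auto simp: local_event_def)

lemma sets_lborel_Q: "sets (lborel \<Otimes>\<^sub>M Q) = sets (borel :: ((real ^ 'n) \<times> real) measure)"
proof -
  have "sets (lborel \<Otimes>\<^sub>M Q) = sets ((borel :: (real ^ 'n) measure) \<Otimes>\<^sub>M (borel :: real measure))"
    by (intro sets_pair_measure_cong) (simp_all add: sets_Q)
  then show ?thesis unfolding borel_prod .
qed

lemma mu_Times:
  assumes "\<Lambda> \<in> sets borel" "I \<in> sets borel" "bounded \<Lambda>"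
  shows "mu (\<Lambda> \<times> I) = z * (measure lborel \<Lambda> * measure Q I)"
  using assms sets_Q
  by (simp add: mu_def measure_def Q.emeasure_pair_measure_Times enn2real_mult)

lemma Q_large: "\<lbrakk>I \<in> sets borel; I \<inter> {0..R\<^sub>0} = {}\<rbrakk> \<Longrightarrow> measure Q I = 0"
proof -
  assume I: "I \<in> sets borel" "I \<inter> {0..R\<^sub>0} = {}"
  have "measure Q {0..R\<^sub>0} = 1" using Q_R0 by (simp add: measure_def)
  moreover have "measure Q (I \<union> {0..R\<^sub>0}) = measure Q I + measure Q {0..R\<^sub>0}"
    using I sets_Q by (intro Q.finite_measure_Union) auto
  moreover have "measure Q (I \<union> {0..R\<^sub>0}) \<le> 1" by simp
  ultimately show "measure Q I = 0" using measure_nonneg[of Q I] by linarith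
qed

text \<open>Counts are controlled on bounded sets only, so the excluded radii above
  \<open>R\<^sub>0\<close> are exhausted by countably many bounded sets.\<close>

definition big :: "nat \<Rightarrow> ((real ^ 'n) \<times> real) set" where
  "big n = cball 0 (real n) \<times> {R\<^sub>0<..real n}"

lemma big: "bounded (big n)" "big n \<in> sets borel"
proof -
  show "bounded (big n)" unfolding big_def by (intro bounded_Times) auto
  have "cball (0 :: real ^ 'n) (real n) \<times> {R\<^sub>0<..real n} \<in> sets (borel \<Otimes>\<^sub>M borel)" by (intro pair_measureI) auto
  then show "big n \<in> sets borel" unfolding big_def borel_prod .
qed

lemma tameI:
  assumes "\<omega> \<in> configurations" "\<And>n. points \<omega> \<inter> big n = {}" shows "tame R\<^sub>0 \<omega>"
  unfolding tame_def
proof (intro conjI ballI assms(1))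
  fix p assume p: "p \<in> points \<omega>"
  obtain n :: nat where n: "max (norm (fst p)) (snd p) \<le> real n" using real_arch_simple by blast
  show "snd p \<le> R\<^sub>0"
  proof (rule ccontr)
    assume "\<not> snd p \<le> R\<^sub>0"
    then have "p \<in> big n" using n by (cases p) (auto simp: big_def)
    then show False using assms(2) p by blast
  qed
qed

lemma AE_\<pi>_big: "AE \<omega> in \<pi>. cnt \<omega> (big n) = 0"
proof -
  have "mu (big n) = 0"
  proof -
    have "measure Q {R\<^sub>0<..real n} = 0" by (rule Q_large) auto
    then show ?thesis unfolding big_def by (subst mu_Times) simp_all
  qed
  then have "measure \<pi> {\<omega>\<in>configurations. cnt \<omega> (big n) = 0} = 1" by (simp add: prob_cnt big)
  moreover have "{\<omega>\<in>configurations. cnt \<omega> (big n) = 0} \<in> sets \<pi>" unfolding sets_\<pi> by (intro cnt_event big)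
  ultimately have "AE \<omega> in \<pi>. \<omega> \<in> {\<omega>\<in>configurations. cnt \<omega> (big n) = 0}" by (simp only: \<pi>.prob_eq_1)
  then show ?thesis by eventually_elim auto
qed

lemma AE_\<pi>_tame: "AE \<omega> in \<pi>. tame R\<^sub>0 \<omega>"
proof -
  have "AE \<omega> in \<pi>. \<forall>n. cnt \<omega> (big n) = 0" using AE_\<pi>_big by (simp add: AE_all_countable)
  then show ?thesis using AE_space
    by eventually_elim (auto intro!: tameI simp: cnt_eq_0_iff big)
qed

lemma AE_project:
  assumes "\<Lambda> \<in> sets borel" "AE \<omega> in \<pi>. R (restr \<Lambda> \<omega>)" "{\<omega>\<in>configurations. R \<omega>} \<in> sets conf_algebra"
  shows "AE \<omega> in project \<Lambda> \<pi>. R \<omega>"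
proof -
  have "restr \<Lambda> \<in> measurable \<pi> conf_algebra"
    using measurable_cut[OF cylinder_borel[OF assms(1)]]
    unfolding restr_eq_cut[abs_def] by (simp add: measurable_cong_sets[OF sets_\<pi> refl] eta_contract_eq)
  then show ?thesis unfolding project_def using assms by (subst AE_distr_iff) auto
qed

lemma indicator_bounded: "\<exists>B. \<forall>\<omega>\<in>S. \<bar>indicator A \<omega> :: real\<bar> \<le> B"
  by (intro exI[of _ 1]) (auto simp: indicator_def)

lemma prob_DLR:
  assumes "A \<in> sets conf_algebra" "\<Lambda> \<in> sets borel" "bounded \<Lambda>"
  shows "measure P A = (\<integral>\<omega>. (\<integral>\<omega>'. indicator A (superpose \<omega>' (restr (- \<Lambda>) \<omega>)) *
         (q powi N_cc_loc \<Lambda> (superpose \<omega>' (restr (- \<Lambda>) \<omega>)) /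
          enn2real (partition_fun q \<pi> \<Lambda> (restr (- \<Lambda>) \<omega>))) \<partial>project \<Lambda> \<pi>) \<partial>P)"
proof -
  have "(\<integral>\<omega>. indicator A \<omega> \<partial>P) = measure P A" using assms(1) sets_P sets.sets_into_space[OF assms(1)]
    by (simp add: Int_absorb2)
  then show ?thesis
    using assms by (subst DLR[OF assms(2,3) _ indicator_bounded, symmetric]) auto
qed

text \<open>Resampling over \<open>cball 0 n\<close> replaces all points that could lie in
  \<open>big n\<close> by Poisson points, which almost surely have no radius above
  \<open>R\<^sub>0\<close>; the weight cannot change a null event.\<close>

lemma AE_P_big: "AE \<omega> in P. cnt \<omega> (big n) = 0"
proof -
  let ?\<Lambda> = "cball (0 :: real ^ 'n) (real n)" and ?A = "{\<omega>\<in>configurations. cnt \<omega> (big n) \<noteq> 0}"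
  have A: "?A \<in> sets conf_algebra" by (intro cnt_event big)
  have cb: "{\<omega>\<in>configurations. cnt \<omega> (big n) = 0} \<in> sets conf_algebra" by (intro cnt_event big)
  have "measure P ?A = (\<integral>\<omega>. 0 \<partial>P)"
  proof (subst prob_DLR[OF A, of ?\<Lambda>], simp, simp, rule Bochner_Integration.integral_cong[OF refl])
    fix \<omega> assume \<omega>: "\<omega> \<in> space P"
    have "cnt (restr ?\<Lambda> \<omega>') (big n) = cnt \<omega>' (big n)" if "\<omega>' \<in> configurations" for \<omega>' :: "'n conf"
      using that by (simp add: cnt_def restr_eq_cut emeasure_cut cylinder_borel big)
         (simp add: big_def Times_Int_Times)
    then have "AE \<omega>' in project ?\<Lambda> \<pi>. cnt \<omega>' (big n) = 0"
      using AE_\<pi>_big[of n] AE_space[of \<pi>] by (intro AE_project cb) (auto elim: eventually_elim2)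
    moreover have "AE \<omega>' in project ?\<Lambda> \<pi>. \<omega>' \<in> configurations"
      using AE_space[of "project ?\<Lambda> \<pi>"] by (simp add: project_def)
    ultimately have "AE \<omega>' in project ?\<Lambda> \<pi>. superpose \<omega>' (restr (- ?\<Lambda>) \<omega>) \<notin> ?A"
    proof eventually_elim
      case (elim \<omega>')
      have "emeasure (restr (- ?\<Lambda>) \<omega>) (big n) = 0"
        using \<omega> by (simp add: restr_eq_cut emeasure_cut cylinder_borel big)
         (simp add: big_def Times_Int_Times)
      moreover have "emeasure \<omega>' (big n) = 0" using elim by (simp add: emeasure_eq_cnt big)
      ultimately show ?case using elim \<omega> by (auto simp: cnt_def emeasure_superpose big)
    qed
    then show "(\<integral>\<omega>'. indicator ?A (superpose \<omega>' (restr (- ?\<Lambda>) \<omega>)) *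
         (q powi N_cc_loc ?\<Lambda> (superpose \<omega>' (restr (- ?\<Lambda>) \<omega>)) /
          enn2real (partition_fun q \<pi> ?\<Lambda> (restr (- ?\<Lambda>) \<omega>))) \<partial>project ?\<Lambda> \<pi>) = 0"
      by (intro integral_eq_zero_AE) (auto elim: eventually_mono)
  qed
  then have "AE \<omega> in P. \<omega> \<notin> ?A" using A sets_P by (intro AE_not_in) (auto simp: null_sets_def P.emeasure_eq_measure)
  then show ?thesis using AE_space by eventually_elim auto
qed

lemma AE_P_tame: "AE \<omega> in P. tame R\<^sub>0 \<omega>"
proof -
  have "AE \<omega> in P. \<forall>n. cnt \<omega> (big n) = 0" using AE_P_big by (simp add: AE_all_countable)
  then show ?thesis using AE_space
    by eventually_elim (auto intro!: tameI simp: cnt_eq_0_iff big)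
qed

section \<open>Conditional weights: measurability, normalization and comparison\<close>

text \<open>
  Testing the DLR equation with the constant function 1 shows that the weight is measurable
  for almost every boundary condition, as otherwise its Bochner integral would be 0.
\<close>

lemma weight_measurable_AE:
  assumes \<Lambda>: "\<Lambda> \<in> sets borel" "bounded \<Lambda>"
  shows "AE \<omega> in P. (\<lambda>\<omega>'. q powi N_cc_loc \<Lambda> (superpose \<omega>' (restr (- \<Lambda>) \<omega>))) \<in> borel_measurable conf_algebra"
proof -
  let ?W = "\<lambda>\<omega> \<omega>'. q powi N_cc_loc \<Lambda> (superpose \<omega>' (restr (- \<Lambda>) \<omega>))"
  let ?Z = "\<lambda>\<omega>. partition_fun q \<pi> \<Lambda> (restr (- \<Lambda>) \<omega>)"
  define g where "g \<omega> = (\<integral>\<omega>'. ?W \<omega> \<omega>' / enn2real (?Z \<omega>) \<partial>project \<Lambda> \<pi>)" for \<omega>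
  have "(\<integral>\<omega>. 1 \<partial>P) = (\<integral>\<omega>. (\<integral>\<omega>'. 1 * (?W \<omega> \<omega>' / enn2real (?Z \<omega>)) \<partial>project \<Lambda> \<pi>) \<partial>P)"
    by (rule DLR[OF \<Lambda>]) (auto intro: exI[of _ 1])
  then have int_g: "(\<integral>\<omega>. g \<omega> \<partial>P) = 1" using P.prob_space by (simp add: g_def)
  \<comment> \<open>The Bochner integral of a non-integrable function is 0, so the value 1 yields
    integrability.\<close>
  then have g: "integrable P g" using not_integrable_integral_eq[of P g] by auto
  have dich: "(?W \<omega> \<in> borel_measurable conf_algebra \<longrightarrow> g \<omega> = 1) \<and> (?W \<omega> \<notin> borel_measurable conf_algebra \<longrightarrow> g \<omega> = 0)"
    if Z: "0 < ?Z \<omega>" "?Z \<omega> < \<infinity>" for \<omega>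
  proof -
    obtain r where r: "?Z \<omega> = ennreal r" "0 < r"
      using Z by (cases "?Z \<omega>") (auto simp: ennreal_less_zero_iff)
    have "g \<omega> = 1" if m: "?W \<omega> \<in> borel_measurable conf_algebra"
    proof -
      have m': "?W \<omega> \<in> borel_measurable (project \<Lambda> \<pi>)" using m by (simp add: project_def)
      have "g \<omega> = enn2real (\<integral>\<^sup>+\<omega>'. ennreal (?W \<omega> \<omega>' / enn2real (?Z \<omega>)) \<partial>project \<Lambda> \<pi>)"
        unfolding g_def using m' q_pos r by (intro integral_eq_nn_integral) auto
      also have "(\<integral>\<^sup>+\<omega>'. ennreal (?W \<omega> \<omega>' / enn2real (?Z \<omega>)) \<partial>project \<Lambda> \<pi>)
          = (\<integral>\<^sup>+\<omega>'. ennreal (?W \<omega> \<omega>') * ennreal (1 / r) \<partial>project \<Lambda> \<pi>)"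
        using r q_pos by (intro nn_integral_cong) (simp flip: ennreal_mult)
      also have "\<dots> = ?Z \<omega> * ennreal (1 / r)"
        unfolding partition_fun_def using m' by (intro nn_integral_multc) simp
      also have "\<dots> = 1" using r by (simp flip: ennreal_mult)
      finally show ?thesis by simp
    qed
    moreover have "g \<omega> = 0" if m: "?W \<omega> \<notin> borel_measurable conf_algebra"
    proof -
      have "\<not> integrable (project \<Lambda> \<pi>) (\<lambda>\<omega>'. ?W \<omega> \<omega>' / enn2real (?Z \<omega>))"
      proof
        assume "integrable (project \<Lambda> \<pi>) (\<lambda>\<omega>'. ?W \<omega> \<omega>' / enn2real (?Z \<omega>))"
        then have "(\<lambda>\<omega>'. ?W \<omega> \<omega>' / enn2real (?Z \<omega>)) \<in> borel_measurable conf_algebra"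
          using borel_measurable_integrable by (fastforce simp: project_def)
        then have "(\<lambda>\<omega>'. ?W \<omega> \<omega>' / enn2real (?Z \<omega>) * r) \<in> borel_measurable conf_algebra" by measurable
        then show False using m r by simp
      qed
      then show ?thesis unfolding g_def by (rule not_integrable_integral_eq)
    qed
    ultimately show ?thesis by blast
  qed
  have le: "AE \<omega> in P. 0 \<le> 1 - g \<omega>"
    using partition_fun_AE[OF \<Lambda>]
  proof eventually_elim
    case (elim \<omega>)
    then show ?case using dich[of \<omega>] by (cases "?W \<omega> \<in> borel_measurable conf_algebra") auto
  qed
  \<comment> \<open>Since \<open>g\<close> only takes the values 0 and 1 and has integral 1, it
    equals 1 almost everywhere, which excludes the non-measurable case.\<close>
  have "(\<integral>\<omega>. 1 - g \<omega> \<partial>P) = 0" using g int_g P.prob_space by simp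
  then have "AE \<omega> in P. 1 - g \<omega> = 0"
    using g le by (subst (asm) integral_nonneg_eq_0_iff_AE) auto
  then show ?thesis using partition_fun_AE[OF \<Lambda>]
  proof eventually_elim
    case (elim \<omega>)
    then show ?case using dich[of \<omega>] by fastforce
  qed
qed

text \<open>The unnormalized conditional weight of \<open>A\<close> given the boundary configuration
  \<eta>. Extended non-negative values avoid integrability questions in the comparison.\<close>

definition weight_sum :: "(real ^ 'n) set \<Rightarrow> 'n conf \<Rightarrow> 'n conf set \<Rightarrow> ennreal" where
  "weight_sum \<Lambda> \<eta> A = (\<integral>\<^sup>+\<omega>'. indicator A (superpose (restr \<Lambda> \<omega>') \<eta>) *
     ennreal (q powi N_cc_loc \<Lambda> (superpose (restr \<Lambda> \<omega>') \<eta>)) \<partial>\<pi>)"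

text \<open>\<open>J\<close> is the inner integral of the DLR equation. It is kept as a separate
  function because the quotient is identified with it only almost everywhere and its measurability
  is not established.\<close>

lemma prob_eq_integral_weight_sum:
  assumes A: "A \<in> sets conf_algebra" and \<Lambda>: "\<Lambda> \<in> sets borel" "bounded \<Lambda>"
  shows "\<exists>J. measure P A = (\<integral>\<omega>. J \<omega> \<partial>P) \<and>
    (AE \<omega> in P. J \<omega> = enn2real (weight_sum \<Lambda> (restr (- \<Lambda>) \<omega>) A) / enn2real (partition_fun q \<pi> \<Lambda> (restr (- \<Lambda>) \<omega>)))
    \<and> (AE \<omega> in P. weight_sum \<Lambda> (restr (- \<Lambda>) \<omega>) A < \<infinity>)"
proof -
  let ?W = "\<lambda>\<omega> \<omega>'. q powi N_cc_loc \<Lambda> (superpose \<omega>' (restr (- \<Lambda>) \<omega>))"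
  let ?Z = "\<lambda>\<omega>. partition_fun q \<pi> \<Lambda> (restr (- \<Lambda>) \<omega>)"
  define J where "J \<omega> = (\<integral>\<omega>'. indicator A (superpose \<omega>' (restr (- \<Lambda>) \<omega>)) * (?W \<omega> \<omega>' / enn2real (?Z \<omega>)) \<partial>project \<Lambda> \<pi>)" for \<omega>
  have restr_m: "restr \<Lambda> \<in> measurable \<pi> conf_algebra"
    using measurable_cut[OF cylinder_borel[OF \<Lambda>(1)]]
    unfolding restr_eq_cut[abs_def] by (simp add: measurable_cong_sets[OF sets_\<pi> refl] eta_contract_eq)
  have "AE \<omega> in P. weight_sum \<Lambda> (restr (- \<Lambda>) \<omega>) A < \<infinity> \<and>
    J \<omega> = enn2real (weight_sum \<Lambda> (restr (- \<Lambda>) \<omega>) A) / enn2real (?Z \<omega>)"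
    using partition_fun_AE[OF \<Lambda>] weight_measurable_AE[OF \<Lambda>] AE_space
  proof eventually_elim
    case (elim \<omega>)
    let ?\<eta> = "restr (- \<Lambda>) \<omega>"
    have \<eta>: "?\<eta> \<in> configurations" using elim \<Lambda> by auto
    have "(\<lambda>\<omega>'. superpose \<omega>' ?\<eta>) \<in> measurable conf_algebra conf_algebra"
      using \<eta> by (intro measurable_superpose) auto
    then have ind: "(\<lambda>\<omega>'. indicator A (superpose \<omega>' ?\<eta>) :: ennreal) \<in> borel_measurable conf_algebra"
      "(\<lambda>\<omega>'. indicator A (superpose \<omega>' ?\<eta>) :: real) \<in> borel_measurable conf_algebra"
      using A by (auto intro: measurable_compose[OF _ borel_measurable_indicator])
    note [measurable] = elim(2)
    have m: "(\<lambda>\<omega>'. indicator A (superpose \<omega>' ?\<eta>) * ennreal (?W \<omega> \<omega>')) \<in> borel_measurable conf_algebra"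
      using ind by measurable
    have eq: "weight_sum \<Lambda> ?\<eta> A = (\<integral>\<^sup>+\<omega>'. indicator A (superpose \<omega>' ?\<eta>) * ennreal (?W \<omega> \<omega>') \<partial>project \<Lambda> \<pi>)"
      unfolding weight_sum_def project_def using restr_m m by (subst nn_integral_distr) auto
    have "\<dots> \<le> ?Z \<omega>"
      unfolding partition_fun_def by (intro nn_integral_mono) (auto simp: indicator_def)
    then have fin: "weight_sum \<Lambda> ?\<eta> A < \<infinity>" using elim eq by (auto simp: le_less_trans)
    have nn: "(\<integral>\<^sup>+\<omega>'. ennreal (indicator A (superpose \<omega>' ?\<eta>) * (?W \<omega> \<omega>' / enn2real (?Z \<omega>))) \<partial>project \<Lambda> \<pi>)
        = weight_sum \<Lambda> ?\<eta> A * ennreal (1 / enn2real (?Z \<omega>))"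
    proof -
      have "(\<integral>\<^sup>+\<omega>'. ennreal (indicator A (superpose \<omega>' ?\<eta>) * (?W \<omega> \<omega>' / enn2real (?Z \<omega>))) \<partial>project \<Lambda> \<pi>)
        = (\<integral>\<^sup>+\<omega>'. indicator A (superpose \<omega>' ?\<eta>) * ennreal (?W \<omega> \<omega>') * ennreal (1 / enn2real (?Z \<omega>)) \<partial>project \<Lambda> \<pi>)"
        using q_pos by (intro nn_integral_cong) (auto simp: indicator_def simp flip: ennreal_mult)
      also have "\<dots> = weight_sum \<Lambda> ?\<eta> A * ennreal (1 / enn2real (?Z \<omega>))"
        unfolding eq using m by (intro nn_integral_multc) (simp add: project_def)
      finally show ?thesis .
    qed
    have "J \<omega> = enn2real (\<integral>\<^sup>+\<omega>'. ennreal (indicator A (superpose \<omega>' ?\<eta>) * (?W \<omega> \<omega>' / enn2real (?Z \<omega>))) \<partial>project \<Lambda> \<pi>)"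
      unfolding J_def using q_pos ind by (intro integral_eq_nn_integral) (auto simp: project_def)
    also have "\<dots> = enn2real (weight_sum \<Lambda> ?\<eta> A) / enn2real (?Z \<omega>)"
      unfolding nn by (simp add: enn2real_mult)
    finally show ?case using fin by simp
  qed
  then have "AE \<omega> in P. J \<omega> = enn2real (weight_sum \<Lambda> (restr (- \<Lambda>) \<omega>) A) / enn2real (?Z \<omega>)"
    "AE \<omega> in P. weight_sum \<Lambda> (restr (- \<Lambda>) \<omega>) A < \<infinity>" by auto
  then show ?thesis using prob_DLR[OF A \<Lambda>] unfolding J_def by blast
qed

text \<open>Both probabilities average quotients with the same partition function, so an inequality
  between the numerators is enough.\<close>

lemma prob_le_if_weight_sum_le:
  assumes A: "A \<in> sets conf_algebra" and B: "B \<in> sets conf_algebra" "A \<subseteq> B" and \<Lambda>: "\<Lambda> \<in> sets borel" "bounded \<Lambda>"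
    and "0 \<le> \<kappa>" and le: "AE \<omega> in P. weight_sum \<Lambda> (restr (- \<Lambda>) \<omega>) A \<le> ennreal \<kappa> * weight_sum \<Lambda> (restr (- \<Lambda>) \<omega>) B"
  shows "measure P A \<le> \<kappa> * measure P B"
proof (cases "measure P A = 0")
  case True
  then show ?thesis using assms(6) by simp
next
  case False
  have "measure P A \<le> measure P B" using B sets_P by (intro P.finite_measure_mono) auto
  \<comment> \<open>Non-zero values of the integrals make \<open>J\<close> and \<open>K\<close>
    integrable, as needed for monotonicity.\<close>
  then have nz: "measure P A \<noteq> 0" "measure P B \<noteq> 0"
    using False measure_nonneg[of P A] by linarith+
  obtain J where J: "measure P A = (\<integral>\<omega>. J \<omega> \<partial>P)"
    "AE \<omega> in P. J \<omega> = enn2real (weight_sum \<Lambda> (restr (- \<Lambda>) \<omega>) A) / enn2real (partition_fun q \<pi> \<Lambda> (restr (- \<Lambda>) \<omega>))"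
    using prob_eq_integral_weight_sum[OF A \<Lambda>] by blast
  obtain K where K: "measure P B = (\<integral>\<omega>. K \<omega> \<partial>P)"
    "AE \<omega> in P. K \<omega> = enn2real (weight_sum \<Lambda> (restr (- \<Lambda>) \<omega>) B) / enn2real (partition_fun q \<pi> \<Lambda> (restr (- \<Lambda>) \<omega>))"
    "AE \<omega> in P. weight_sum \<Lambda> (restr (- \<Lambda>) \<omega>) B < \<infinity>"
    using prob_eq_integral_weight_sum[OF B(1) \<Lambda>] by blast
  have "integrable P J" "integrable P K"
    using nz J(1) K(1) not_integrable_integral_eq by metis+
  have "(\<integral>\<omega>. J \<omega> \<partial>P) \<le> (\<integral>\<omega>. \<kappa> * K \<omega> \<partial>P)"
  proof (rule integral_mono_AE)
    show "AE \<omega> in P. J \<omega> \<le> \<kappa> * K \<omega>"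
      using J(2) K(2,3) le
    proof eventually_elim
      case (elim \<omega>)
      let ?a = "weight_sum \<Lambda> (restr (- \<Lambda>) \<omega>) A" and ?b = "weight_sum \<Lambda> (restr (- \<Lambda>) \<omega>) B"
      have "enn2real ?a \<le> enn2real (ennreal \<kappa> * ?b)"
        using elim by (intro enn2real_mono) (auto simp: ennreal_mult_less_top)
      also have "\<dots> = \<kappa> * enn2real ?b" using assms(6) by (simp add: enn2real_mult)
      finally show ?case
        unfolding elim(1,2) by (simp add: divide_right_mono)
    qed
  qed (use \<open>integrable P J\<close> \<open>integrable P K\<close> in auto)
  then show ?thesis using J(1) K(1) by simp
qed

text \<open>The DLR equation resamples a whole cylinder over \<Lambda>, but only the points in
  \<Gamma> should vary. The Poisson points over \<Lambda> are split into those in \<Gamma> and an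
  independent remainder; with the remainder frozen into \<zeta>, the hypothesis \<open>key\<close>
  compares the inner integrals.\<close>

lemma prob_compare:
  assumes \<Gamma>: "\<Gamma> \<in> sets borel" "bounded \<Gamma>" and A: "local_event \<Gamma> A" and B: "local_event (- \<Gamma>) B"
    and "0 \<le> \<kappa>"
    and key: "\<And>\<Lambda> \<zeta>. \<lbrakk>\<Lambda> \<in> sets borel; bounded \<Lambda>; \<Gamma> \<subseteq> \<Lambda> \<times> UNIV; tame R\<^sub>0 \<zeta>; points \<zeta> \<inter> \<Gamma> = {}; \<zeta> \<in> B\<rbrakk> \<Longrightarrow>
      (\<integral>\<^sup>+\<omega>. indicator A \<omega> * ennreal (q powi N_cc_loc \<Lambda> (superpose (cut \<Gamma> \<omega>) \<zeta>)) \<partial>\<pi>) \<le>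
      ennreal \<kappa> * (\<integral>\<^sup>+\<omega>. ennreal (q powi N_cc_loc \<Lambda> (superpose (cut \<Gamma> \<omega>) \<zeta>)) \<partial>\<pi>)"
  shows "measure P (A \<inter> B) \<le> \<kappa> * measure P B"
proof -
  obtain r where r: "fst ` \<Gamma> \<subseteq> cball 0 r" using bounded_fst[OF \<Gamma>(2)] by (rule bounded_subset_cballE)
  define \<Lambda> where "\<Lambda> = cball (0 :: real ^ 'n) r"
  have \<Lambda>: "\<Lambda> \<in> sets borel" "bounded \<Lambda>" "\<Gamma> \<subseteq> \<Lambda> \<times> UNIV" using r by (force simp: \<Lambda>_def)+
  define \<Gamma>' where "\<Gamma>' = \<Lambda> \<times> UNIV - \<Gamma>"
  have \<Gamma>': "\<Gamma>' \<in> sets borel" "\<Gamma>' \<inter> \<Gamma> = {}" "\<Gamma>' \<union> \<Gamma> = \<Lambda> \<times> UNIV"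
    using \<Lambda> \<Gamma> cylinder_borel[OF \<Lambda>(1)] by (auto simp: \<Gamma>'_def)
  note sA = local_event_sets[OF A] and sB = local_event_sets[OF B]
  show ?thesis
  proof (rule prob_le_if_weight_sum_le[OF _ sB _ \<Lambda>(1,2) \<open>0 \<le> \<kappa>\<close>])
    show "AE \<omega> in P. weight_sum \<Lambda> (restr (- \<Lambda>) \<omega>) (A \<inter> B) \<le> ennreal \<kappa> * weight_sum \<Lambda> (restr (- \<Lambda>) \<omega>) B"
      using weight_measurable_AE[OF \<Lambda>(1,2)] AE_P_tame
    proof eventually_elim
      case (elim \<omega>)
      define \<eta> where "\<eta> = restr (- \<Lambda>) \<omega>"
      have cl: "(- \<Lambda>) \<times> (UNIV :: real set) \<in> sets borel" using \<Lambda> by (intro cylinder_borel) auto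
      have \<eta>t: "tame R\<^sub>0 \<eta>" unfolding \<eta>_def restr_eq_cut by (rule tame_cut[OF elim(2) cl])
      note \<eta>c = tame_configurations[OF \<eta>t]
      have \<eta>p: "points \<eta> \<inter> \<Lambda> \<times> UNIV = {}"
        unfolding \<eta>_def restr_eq_cut using tame_configurations[OF elim(2)] cl by (auto simp: points_cut)
      define h where "h \<omega>' = ennreal (q powi N_cc_loc \<Lambda> (superpose \<omega>' \<eta>))" for \<omega>'
      have h[measurable]: "h \<in> borel_measurable conf_algebra"
        unfolding h_def using elim(1) by (auto simp: \<eta>_def)
      have sup1: "(\<lambda>b. superpose b \<eta>) \<in> measurable conf_algebra conf_algebra"
        using \<eta>c by (intro measurable_superpose) auto
      have sup2: "(\<lambda>p. superpose (snd p) (fst p)) \<in> measurable (conf_algebra \<Otimes>\<^sub>M conf_algebra) conf_algebra"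
        by (intro measurable_superpose) auto
      have iB: "(\<lambda>b. indicator B (superpose b \<eta>) :: ennreal) \<in> borel_measurable conf_algebra"
        using sup1 sB by (rule measurable_compose[OF _ borel_measurable_indicator])
      have iA: "(indicator A :: _ \<Rightarrow> ennreal) \<in> borel_measurable conf_algebra" using sA by simp
      have hs: "(\<lambda>p. h (superpose (snd p) (fst p))) \<in> borel_measurable (conf_algebra \<Otimes>\<^sub>M conf_algebra)"
        by (rule measurable_compose[OF sup2 h])
      have split: "superpose (superpose (cut \<Gamma> \<omega>') (cut \<Gamma>' \<omega>')) \<eta> = superpose (restr \<Lambda> \<omega>') \<eta>" if "\<omega>' \<in> configurations" for \<omega>'
        using superpose_cut_cut[OF that \<Gamma>(1) \<Gamma>'(1)] \<Gamma>' by (simp add: restr_eq_cut Int_commute Un_commute)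
      \<comment> \<open>\<open>B\<close> sees only the outside of \<Gamma>, so membership is
        unaffected by the points inside; conversely \<open>A\<close> sees only those.\<close>
      have memB: "superpose (restr \<Lambda> \<omega>') \<eta> \<in> B \<longleftrightarrow> superpose (cut \<Gamma>' \<omega>') \<eta> \<in> B" if c: "\<omega>' \<in> configurations" for \<omega>'
      proof -
        have "cut (- \<Gamma>) (superpose (restr \<Lambda> \<omega>') \<eta>) = cut (- \<Gamma>) (superpose (cut \<Gamma>' \<omega>') \<eta>)"
          using c \<Gamma> \<Gamma>' \<Lambda> \<eta>c cylinder_borel[OF \<Lambda>(1)]
          by (simp add: cut_superpose restr_eq_cut cut_cut) (simp add: \<Gamma>'_def Int_commute Diff_eq Int_ac)
        moreover have "superpose (restr \<Lambda> \<omega>') \<eta> \<in> configurations" "superpose (cut \<Gamma>' \<omega>') \<eta> \<in> configurations"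
          using c \<Gamma>' \<Lambda> \<eta>c by auto
        ultimately show ?thesis using local_event_cut[OF B] by metis
      qed
      have memA: "superpose (restr \<Lambda> \<omega>') \<eta> \<in> A \<longleftrightarrow> cut \<Gamma> \<omega>' \<in> A" if c: "\<omega>' \<in> configurations" for \<omega>'
      proof -
        have "points (cut \<Gamma> \<eta>) = {}" using \<eta>p \<eta>c \<Gamma> \<Lambda>(3) by (auto simp: points_cut)
        then have "emeasure (cut \<Gamma> \<eta>) X = 0" if "X \<in> sets borel" for X
          using emeasure_eq_0_iff_points[of "cut \<Gamma> \<eta>" X] that \<eta>c \<Gamma> by auto
        then have "cut \<Gamma> (superpose (restr \<Lambda> \<omega>') \<eta>) = cut \<Gamma> \<omega>'"
          using c \<Gamma> \<Lambda> \<eta>c cylinder_borel[OF \<Lambda>(1)]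
          by (intro configuration_eqI)
            (auto simp: cut_superpose emeasure_superpose restr_eq_cut cut_cut Int_absorb2)
        moreover have "superpose (restr \<Lambda> \<omega>') \<eta> \<in> configurations" using c \<Lambda> \<eta>c by auto
        ultimately show ?thesis using local_event_cut[OF A] c by metis
      qed
      \<comment> \<open>Stated for a general \<open>D\<close>, so that the same formula serves for
        \<open>A\<close> in the numerator and for all configurations in the denominator.\<close>
      have expand: "weight_sum \<Lambda> \<eta> (D \<inter> B) =
        (\<integral>\<^sup>+b. (\<integral>\<^sup>+a. indicator D (cut \<Gamma> a) * indicator B (superpose (cut \<Gamma>' b) \<eta>) * h (superpose (cut \<Gamma> a) (cut \<Gamma>' b)) \<partial>\<pi>) \<partial>\<pi>)"
        if D: "D \<in> sets conf_algebra" "\<And>\<omega>'. \<omega>' \<in> configurations \<Longrightarrow> superpose (restr \<Lambda> \<omega>') \<eta> \<in> D \<longleftrightarrow> cut \<Gamma> \<omega>' \<in> D" for D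
      proof -
        let ?F = "\<lambda>p. indicator D (snd p) * indicator B (superpose (fst p) \<eta>) * h (superpose (snd p) (fst p))"
        have iD: "(indicator D :: _ \<Rightarrow> ennreal) \<in> borel_measurable conf_algebra" using D by simp
        have "?F \<in> borel_measurable (conf_algebra \<Otimes>\<^sub>M conf_algebra)"
          by (intro borel_measurable_times_ennreal hs measurable_compose[OF measurable_snd iD] measurable_compose[OF measurable_fst iB])
        from poisson_nn_integral_split[OF poisson \<Gamma>'(2,1) \<Gamma>(1) this]
        have "(\<integral>\<^sup>+\<omega>'. indicator D (cut \<Gamma> \<omega>') * indicator B (superpose (cut \<Gamma>' \<omega>') \<eta>) * h (superpose (cut \<Gamma> \<omega>') (cut \<Gamma>' \<omega>')) \<partial>\<pi>) =
          (\<integral>\<^sup>+b. (\<integral>\<^sup>+a. indicator D (cut \<Gamma> a) * indicator B (superpose (cut \<Gamma>' b) \<eta>) * h (superpose (cut \<Gamma> a) (cut \<Gamma>' b)) \<partial>\<pi>) \<partial>\<pi>)"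
          by simp
        moreover have "weight_sum \<Lambda> \<eta> (D \<inter> B) = (\<integral>\<^sup>+\<omega>'. indicator D (cut \<Gamma> \<omega>') * indicator B (superpose (cut \<Gamma>' \<omega>') \<eta>) * h (superpose (cut \<Gamma> \<omega>') (cut \<Gamma>' \<omega>')) \<partial>\<pi>)"
          unfolding weight_sum_def
          by (intro nn_integral_cong) (auto simp: h_def split memB D(2) indicator_def)
        ultimately show ?thesis by simp
      qed
      have Bc: "weight_sum \<Lambda> \<eta> B = weight_sum \<Lambda> \<eta> (configurations \<inter> B)"
        unfolding weight_sum_def using \<eta>c \<Lambda> by (intro nn_integral_cong) (auto simp: indicator_def)
      have "weight_sum \<Lambda> \<eta> (A \<inter> B) =
        (\<integral>\<^sup>+b. (\<integral>\<^sup>+a. indicator A (cut \<Gamma> a) * indicator B (superpose (cut \<Gamma>' b) \<eta>) * h (superpose (cut \<Gamma> a) (cut \<Gamma>' b)) \<partial>\<pi>) \<partial>\<pi>)"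
        by (rule expand[OF sA memA])
      also have "\<dots> \<le> (\<integral>\<^sup>+b. ennreal \<kappa> * (\<integral>\<^sup>+a. indicator configurations (cut \<Gamma> a) * indicator B (superpose (cut \<Gamma>' b) \<eta>) * h (superpose (cut \<Gamma> a) (cut \<Gamma>' b)) \<partial>\<pi>) \<partial>\<pi>)"
      proof (rule nn_integral_mono_AE)
        show "AE b in \<pi>. (\<integral>\<^sup>+a. indicator A (cut \<Gamma> a) * indicator B (superpose (cut \<Gamma>' b) \<eta>) * h (superpose (cut \<Gamma> a) (cut \<Gamma>' b)) \<partial>\<pi>) \<le>
          ennreal \<kappa> * (\<integral>\<^sup>+a. indicator configurations (cut \<Gamma> a) * indicator B (superpose (cut \<Gamma>' b) \<eta>) * h (superpose (cut \<Gamma> a) (cut \<Gamma>' b)) \<partial>\<pi>)"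
          using AE_\<pi>_tame
        proof eventually_elim
          case (elim b)
          let ?\<zeta> = "superpose (cut \<Gamma>' b) \<eta>"
          note bc = tame_configurations[OF elim]
          have \<zeta>: "tame R\<^sub>0 ?\<zeta>" by (intro tame_superpose tame_cut elim \<eta>t \<Gamma>')
          have "points ?\<zeta> \<inter> \<Gamma> = {}"
            using bc \<eta>c \<Gamma>' \<eta>p \<Lambda>(3) by (auto simp: points_superpose points_cut)
          show ?case
          proof (cases "?\<zeta> \<in> B")
            case True
            have heq: "h (superpose (cut \<Gamma> a) (cut \<Gamma>' b)) = ennreal (q powi N_cc_loc \<Lambda> (superpose (cut \<Gamma> a) ?\<zeta>))"
              if "a \<in> configurations" for a
              unfolding h_def using that bc \<eta>c \<Gamma> \<Gamma>' by (simp add: superpose_assoc)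
            have "(\<integral>\<^sup>+a. indicator A (cut \<Gamma> a) * indicator B ?\<zeta> * h (superpose (cut \<Gamma> a) (cut \<Gamma>' b)) \<partial>\<pi>)
              = (\<integral>\<^sup>+a. indicator A a * ennreal (q powi N_cc_loc \<Lambda> (superpose (cut \<Gamma> a) ?\<zeta>)) \<partial>\<pi>)"
              using True by (intro nn_integral_cong) (simp add: heq indicator_def local_event_cut[OF A])
            moreover have "(\<integral>\<^sup>+a. indicator configurations (cut \<Gamma> a) * indicator B ?\<zeta> * h (superpose (cut \<Gamma> a) (cut \<Gamma>' b)) \<partial>\<pi>)
              = (\<integral>\<^sup>+a. ennreal (q powi N_cc_loc \<Lambda> (superpose (cut \<Gamma> a) ?\<zeta>)) \<partial>\<pi>)"
              using True \<Gamma> by (intro nn_integral_cong) (simp add: heq)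
            ultimately show ?thesis using key[OF \<Lambda> \<zeta> \<open>points ?\<zeta> \<inter> \<Gamma> = {}\<close> True] by simp
          qed simp
        qed
      qed
      also have "\<dots> = ennreal \<kappa> * weight_sum \<Lambda> \<eta> (configurations \<inter> B)"
      proof -
        let ?G = "\<lambda>b. \<integral>\<^sup>+a. indicator configurations (cut \<Gamma> a) * indicator B (superpose (cut \<Gamma>' b) \<eta>) * h (superpose (cut \<Gamma> a) (cut \<Gamma>' b)) \<partial>\<pi>"
        have "(\<lambda>p. indicator configurations (cut \<Gamma> (snd p)) * indicator B (superpose (cut \<Gamma>' (fst p)) \<eta>) * h (superpose (cut \<Gamma> (snd p)) (cut \<Gamma>' (fst p)))) \<in> borel_measurable (conf_algebra \<Otimes>\<^sub>M conf_algebra)"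
        proof -
          have c1: "(\<lambda>p. cut \<Gamma> (snd p)) \<in> measurable (conf_algebra \<Otimes>\<^sub>M conf_algebra) conf_algebra"
            by (rule measurable_compose[OF measurable_snd measurable_cut[OF \<Gamma>(1)]])
          have c2: "(\<lambda>p. cut \<Gamma>' (fst p)) \<in> measurable (conf_algebra \<Otimes>\<^sub>M conf_algebra) conf_algebra"
            by (rule measurable_compose[OF measurable_fst measurable_cut[OF \<Gamma>'(1)]])
          have i0: "(indicator configurations :: _ \<Rightarrow> ennreal) \<in> borel_measurable conf_algebra"
            using sets.top[of conf_algebra] by (intro borel_measurable_indicator) simp
          show ?thesis
            by (intro borel_measurable_times_ennreal measurable_compose[OF c1 i0] measurable_compose[OF c2 iB]
              measurable_compose[OF measurable_superpose[OF c1 c2] h])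
        qed
        then have "?G \<in> borel_measurable \<pi>"
          by (intro \<pi>.borel_measurable_nn_integral)
            (simp add: case_prod_unfold measurable_cong_sets[OF sets_pair_measure_cong[OF sets_\<pi> sets_\<pi>] refl])
        then have "(\<integral>\<^sup>+b. ennreal \<kappa> * ?G b \<partial>\<pi>) = ennreal \<kappa> * (\<integral>\<^sup>+b. ?G b \<partial>\<pi>)"
          by (rule nn_integral_cmult)
        moreover have "weight_sum \<Lambda> \<eta> (configurations \<inter> B) = (\<integral>\<^sup>+b. ?G b \<partial>\<pi>)"
          using sets.top[of conf_algebra] \<eta>c \<Gamma> \<Lambda> by (intro expand) auto
        ultimately show ?thesis by simp
      qed
      finally show ?case unfolding \<eta>_def[symmetric] Bc .
    qed
  qed (use sA sB in auto)
qed

section \<open>The two basic estimates: merging and vacancy\<close>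

lemma prob_empty:
  assumes "bounded \<Gamma>" "\<Gamma> \<in> sets borel"
  shows "emeasure \<pi> {\<omega>\<in>configurations. cnt \<omega> \<Gamma> = 0} = ennreal (exp (- mu \<Gamma>))"
    "emeasure \<pi> {\<omega>\<in>configurations. cnt \<omega> \<Gamma> \<noteq> 0} = ennreal (1 - exp (- mu \<Gamma>))"
proof -
  let ?E = "{\<omega>\<in>configurations. cnt \<omega> \<Gamma> = 0}"
  have E: "?E \<in> sets \<pi>" unfolding sets_\<pi> by (intro cnt_event assms)
  have m: "measure \<pi> ?E = exp (- mu \<Gamma>)" using prob_cnt[OF assms, of 0] by simp
  then show "emeasure \<pi> ?E = ennreal (exp (- mu \<Gamma>))" by (simp add: \<pi>.emeasure_eq_measure)
  have "{\<omega>\<in>configurations. cnt \<omega> \<Gamma> \<noteq> 0} = space \<pi> - ?E" by auto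
  then show "emeasure \<pi> {\<omega>\<in>configurations. cnt \<omega> \<Gamma> \<noteq> 0} = ennreal (1 - exp (- mu \<Gamma>))"
    using \<pi>.prob_compl[OF E] m by (simp add: \<pi>.emeasure_eq_measure)
qed

lemma cut_empty_superpose:
  assumes "\<omega> \<in> configurations" "\<zeta> \<in> configurations" "bounded \<Gamma>" "\<Gamma> \<in> sets borel" "cnt \<omega> \<Gamma> = 0"
  shows "superpose (cut \<Gamma> \<omega>) \<zeta> = \<zeta>"
  using assms by (intro superpose_null) (auto simp: points_cut cnt_eq_0_iff)

text \<open>
  If the points in \<open>\<Gamma>\<close> can only touch the neighbours of at most \<open>K\<close> points outside \<open>\<Gamma>\<close>, then they
  merge at most \<open>K\<close> components, so the weight gains at most the factor \<open>(1/q)\<^sup>K\<close>; the empty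
  configuration in \<open>\<Gamma>\<close> bounds the partition function from below.
\<close>

lemma prob_le_merging:
  assumes \<Gamma>: "\<Gamma> \<in> sets borel" "bounded \<Gamma>" and A: "local_event \<Gamma> A" and B: "local_event (- \<Gamma>) B"
    and merge: "\<And>a \<zeta>. \<lbrakk>tame R\<^sub>0 a; points a \<subseteq> \<Gamma>; a \<in> A; tame R\<^sub>0 \<zeta>; points \<zeta> \<inter> \<Gamma> = {}; \<zeta> \<in> B\<rbrakk> \<Longrightarrow>
      \<exists>Y. finite Y \<and> Y \<subseteq> points \<zeta> \<and> card Y \<le> K \<and>
        (\<forall>p\<in>points \<zeta>. \<forall>w\<in>points a. touch p w \<longrightarrow> (\<exists>y\<in>Y. touch p y))"
  shows "measure P (A \<inter> B) \<le> (1 / q) ^ K * exp (mu \<Gamma>) * measure \<pi> A * measure P B"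
proof (rule prob_compare[OF \<Gamma> A B])
  show "0 \<le> (1 / q) ^ K * exp (mu \<Gamma>) * measure \<pi> A" using q_pos by simp
next
  fix \<Lambda> \<zeta> assume \<Lambda>: "\<Lambda> \<in> sets borel" "bounded \<Lambda>" "\<Gamma> \<subseteq> \<Lambda> \<times> UNIV"
    and \<zeta>: "tame R\<^sub>0 \<zeta>" "points \<zeta> \<inter> \<Gamma> = {}" "\<zeta> \<in> B"
  let ?N = "\<lambda>\<zeta>. N_cc_loc \<Lambda> \<zeta>"
  let ?c = "q powi ?N \<zeta>"
  have c: "0 < ?c" using q_pos by simp
  have A': "A \<in> sets \<pi>" using local_event_sets[OF A] sets_\<pi> by simp
  let ?E = "{\<omega>\<in>configurations. cnt \<omega> \<Gamma> = 0}"
  have E: "?E \<in> sets \<pi>" unfolding sets_\<pi> by (intro cnt_event \<Gamma>)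
  have "(\<integral>\<^sup>+\<omega>. indicator A \<omega> * ennreal (q powi ?N (superpose (cut \<Gamma> \<omega>) \<zeta>)) \<partial>\<pi>)
      \<le> (\<integral>\<^sup>+\<omega>. ennreal (?c * (1 / q) ^ K) * indicator A \<omega> \<partial>\<pi>)"
  proof (rule nn_integral_mono_AE)
    show "AE \<omega> in \<pi>. indicator A \<omega> * ennreal (q powi ?N (superpose (cut \<Gamma> \<omega>) \<zeta>)) \<le> ennreal (?c * (1 / q) ^ K) * indicator A \<omega>"
      using AE_\<pi>_tame
    proof eventually_elim
      case (elim \<omega>)
      let ?a = "cut \<Gamma> \<omega>"
      have a: "tame R\<^sub>0 ?a" "points ?a \<subseteq> \<Gamma>"
        using elim \<Gamma> tame_configurations[OF elim] by (auto intro: tame_cut simp: points_cut)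
      show ?case
      proof (cases "\<omega> \<in> A")
        case True
        then have "?a \<in> A" using local_event_cut[OF A tame_configurations[OF elim]] by simp
        from merge[OF a this \<zeta>] obtain Y where Y: "finite Y" "Y \<subseteq> points \<zeta>" "card Y \<le> K"
          "\<forall>p\<in>points \<zeta>. \<forall>w\<in>points ?a. touch p w \<longrightarrow> (\<exists>y\<in>Y. touch p y)" by blast
        have "?N \<zeta> - int (card Y) \<le> ?N (superpose ?a \<zeta>)"
          using a \<Lambda> \<zeta> Y by (intro N_cc_loc_superpose_ge[where r = R\<^sub>0]) auto
        then have "?N \<zeta> - int K \<le> ?N (superpose ?a \<zeta>)" using Y(3) by linarith
        \<comment> \<open>Because \<open>q < 1\<close>, fewer components mean a larger
          weight.\<close>
        then have "q powi ?N (superpose ?a \<zeta>) \<le> q powi (?N \<zeta> - int K)"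
          using q_pos q_less by (intro power_int_decreasing) auto
        also have "\<dots> = ?c * (1 / q) ^ K" using q_pos by (simp add: power_int_diff power_divide)
        finally show ?thesis using True by (simp add: ennreal_leI)
      qed simp
    qed
  qed
  also have "\<dots> = ennreal (?c * (1 / q) ^ K) * emeasure \<pi> A"
    using A' by (rule nn_integral_cmult_indicator)
  \<comment> \<open>The factor \<open>exp (mu \<Gamma>)\<close> is compensated by the void
    probability, so the last product is the contribution of the empty region to the integral on the
    right-hand side.\<close>
  also have "\<dots> = ennreal ((1 / q) ^ K * exp (mu \<Gamma>) * measure \<pi> A) * (ennreal ?c * ennreal (exp (- mu \<Gamma>)))"
    using q_pos by (simp add: \<pi>.emeasure_eq_measure ac_simps exp_minus flip: ennreal_mult)
  also have "ennreal ?c * ennreal (exp (- mu \<Gamma>)) = (\<integral>\<^sup>+\<omega>. ennreal ?c * indicator ?E \<omega> \<partial>\<pi>)"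
    using E prob_empty(1)[OF \<Gamma>(2,1)] by (simp add: nn_integral_cmult_indicator)
  also have "\<dots> \<le> (\<integral>\<^sup>+\<omega>. ennreal (q powi ?N (superpose (cut \<Gamma> \<omega>) \<zeta>)) \<partial>\<pi>)"
    using \<Gamma> tame_configurations[OF \<zeta>(1)]
    by (intro nn_integral_mono) (auto simp: indicator_def cut_empty_superpose)
  finally show "(\<integral>\<^sup>+\<omega>. indicator A \<omega> * ennreal (q powi ?N (superpose (cut \<Gamma> \<omega>) \<zeta>)) \<partial>\<pi>)
    \<le> ennreal ((1 / q) ^ K * exp (mu \<Gamma>) * measure \<pi> A) * (\<integral>\<^sup>+\<omega>. ennreal (q powi ?N (superpose (cut \<Gamma> \<omega>) \<zeta>)) \<partial>\<pi>)"
    by (simp add: mult_left_mono)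
qed

text \<open>The probability of an empty region of Poisson mean \<open>m\<close> when every nonempty
  state has relative weight exactly \<open>q\<close>, the least favourable case.\<close>

definition vacancy :: "real \<Rightarrow> real" where
  "vacancy m = exp (- m) / (exp (- m) + (1 - exp (- m)) * q)"

lemma vacancy_denominator: "0 \<le> m \<Longrightarrow> 0 < exp (- m) + (1 - exp (- m)) * q"
  using q_pos by (intro add_pos_nonneg mult_nonneg_nonneg) auto

lemma vacancy_nonneg: "0 \<le> m \<Longrightarrow> 0 \<le> vacancy m"
  unfolding vacancy_def using vacancy_denominator[of m] by (intro divide_nonneg_pos) auto

lemma vacancy_less_1: "0 < m \<Longrightarrow> vacancy m < 1"
  unfolding vacancy_def using vacancy_denominator[of m] q_pos by (subst divide_less_eq_1_pos) auto

lemma vacancy_le: "0 \<le> m \<Longrightarrow> vacancy m \<le> exp (- m) / q"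
proof -
  assume m: "0 \<le> m"
  have "q * exp (- m) + (1 - exp (- m)) * q \<le> exp (- m) + (1 - exp (- m)) * q"
    using q_less by (simp add: mult_left_le_one_le)
  then have "q \<le> exp (- m) + (1 - exp (- m)) * q" by (simp add: algebra_simps)
  then show ?thesis unfolding vacancy_def using q_pos by (intro divide_left_mono) (auto intro: vacancy_denominator m mult_pos_pos)
qed

text \<open>Mutually touching balls form a single component, so filling \<open>\<Gamma>\<close> costs at most the factor \<open>q\<close>.\<close>

lemma prob_vacant_le:
  assumes \<Gamma>: "\<Gamma> \<in> sets borel" "bounded \<Gamma>" and B: "local_event (- \<Gamma>) B"
    and clique: "\<And>p w. \<lbrakk>p \<in> \<Gamma>; w \<in> \<Gamma>; 0 \<le> snd p; 0 \<le> snd w\<rbrakk> \<Longrightarrow> touch p w"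
  shows "measure P ({\<omega>\<in>configurations. cnt \<omega> \<Gamma> = 0} \<inter> B) \<le> vacancy (mu \<Gamma>) * measure P B"
proof (rule prob_compare[OF \<Gamma> _ B vacancy_nonneg[OF mu_nonneg]])
  let ?E = "{\<omega>\<in>configurations. cnt \<omega> \<Gamma> = 0}" and ?F = "{\<omega>\<in>configurations. cnt \<omega> \<Gamma> \<noteq> 0}"
  show "local_event \<Gamma> ?E" using \<Gamma> by (intro local_event_cnt) auto
  fix \<Lambda> \<zeta> assume \<Lambda>: "\<Lambda> \<in> sets borel" "bounded \<Lambda>" "\<Gamma> \<subseteq> \<Lambda> \<times> UNIV"
    and \<zeta>: "tame R\<^sub>0 \<zeta>" "points \<zeta> \<inter> \<Gamma> = {}" "\<zeta> \<in> B"
  let ?N = "\<lambda>\<zeta>. N_cc_loc \<Lambda> \<zeta>"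
  let ?c = "q powi ?N \<zeta>" and ?e = "exp (- mu \<Gamma>)"
  have c: "0 < ?c" using q_pos by simp
  have e: "0 \<le> ?e" "?e \<le> 1" using mu_nonneg by auto
  have E: "?E \<in> sets \<pi>" "?F \<in> sets \<pi>" unfolding sets_\<pi> by (intro cnt_event \<Gamma>)+
  have "(\<integral>\<^sup>+\<omega>. indicator ?E \<omega> * ennreal (q powi ?N (superpose (cut \<Gamma> \<omega>) \<zeta>)) \<partial>\<pi>)
      = (\<integral>\<^sup>+\<omega>. ennreal ?c * indicator ?E \<omega> \<partial>\<pi>)"
    using \<Gamma> tame_configurations[OF \<zeta>(1)]
    by (intro nn_integral_cong) (auto simp: indicator_def cut_empty_superpose)
  also have "\<dots> = ennreal ?c * ennreal ?e"
    using E prob_empty(1)[OF \<Gamma>(2,1)] by (simp add: nn_integral_cmult_indicator)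
  also have "\<dots> = ennreal (?c * ?e)" using c e by (simp flip: ennreal_mult)
  also have "?c * ?e = vacancy (mu \<Gamma>) * (?c * ?e + ?c * q * (1 - ?e))"
    using vacancy_denominator[OF mu_nonneg, of \<Gamma>] by (simp add: vacancy_def field_simps)
  also have "ennreal \<dots> = ennreal (vacancy (mu \<Gamma>)) * (ennreal ?c * ennreal ?e + ennreal (?c * q) * ennreal (1 - ?e))"
    using c e q_pos vacancy_nonneg[OF mu_nonneg, of \<Gamma>] by (simp flip: ennreal_mult ennreal_plus)
  also have "ennreal ?c * ennreal ?e + ennreal (?c * q) * ennreal (1 - ?e)
      = (\<integral>\<^sup>+\<omega>. ennreal ?c * indicator ?E \<omega> + ennreal (?c * q) * indicator ?F \<omega> \<partial>\<pi>)"
    using E prob_empty[OF \<Gamma>(2,1)] by (subst nn_integral_add) (auto simp: nn_integral_cmult_indicator)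
  also have "\<dots> \<le> (\<integral>\<^sup>+\<omega>. ennreal (q powi ?N (superpose (cut \<Gamma> \<omega>) \<zeta>)) \<partial>\<pi>)"
  proof (rule nn_integral_mono_AE)
    show "AE \<omega> in \<pi>. ennreal ?c * indicator ?E \<omega> + ennreal (?c * q) * indicator ?F \<omega> \<le> ennreal (q powi ?N (superpose (cut \<Gamma> \<omega>) \<zeta>))"
      using AE_\<pi>_tame
    proof eventually_elim
      case (elim \<omega>)
      note oc = tame_configurations[OF elim]
      let ?a = "cut \<Gamma> \<omega>"
      show ?case
      proof (cases "cnt \<omega> \<Gamma> = 0")
        case True
        then show ?thesis using oc \<Gamma> tame_configurations[OF \<zeta>(1)] by (simp add: cut_empty_superpose)
      next
        case False
        have a: "tame R\<^sub>0 ?a" "points ?a \<subseteq> \<Gamma>" using elim \<Gamma> oc by (auto intro: tame_cut simp: points_cut)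
        have "?N (superpose ?a \<zeta>) \<le> ?N \<zeta> + 1"
          using a \<Lambda> \<zeta> clique points_snd_nonneg[OF oc] oc \<Gamma>
          by (intro N_cc_loc_superpose_le[where r = R\<^sub>0]) (auto simp: points_cut)
        then have "q powi (?N \<zeta> + 1) \<le> q powi ?N (superpose ?a \<zeta>)"
          using q_pos q_less by (intro power_int_decreasing) auto
        then show ?thesis using False oc q_pos by (simp add: power_int_add ennreal_leI)
      qed
    qed
  qed
  finally show "(\<integral>\<^sup>+\<omega>. indicator ?E \<omega> * ennreal (q powi ?N (superpose (cut \<Gamma> \<omega>) \<zeta>)) \<partial>\<pi>)
    \<le> ennreal (vacancy (mu \<Gamma>)) * (\<integral>\<^sup>+\<omega>. ennreal (q powi ?N (superpose (cut \<Gamma> \<omega>) \<zeta>)) \<partial>\<pi>)"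
    by (simp add: mult_left_mono)
qed

end

subsection \<open>Cubes\<close>

text \<open>Half-open, so that the cubes with fixed side \<open>s\<close> and origin
  \<open>a\<close> partition the space.\<close>

definition cube :: "real \<Rightarrow> real ^ 'n \<Rightarrow> ('n \<Rightarrow> int) \<Rightarrow> (real ^ 'n::finite) set" where
  "cube s a c = {x. \<forall>i. a $ i + s * c i \<le> x $ i \<and> x $ i < a $ i + s * (c i + 1)}"

lemma cube_eq_floor:
  assumes "0 < s"
  shows "x \<in> cube s a c \<longleftrightarrow> c = (\<lambda>i. \<lfloor>(x $ i - a $ i) / s\<rfloor>)"
proof -
  have "a $ i + s * c i \<le> x $ i \<and> x $ i < a $ i + s * (c i + 1) \<longleftrightarrow> \<lfloor>(x $ i - a $ i) / s\<rfloor> = c i" for i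
    using assms by (simp add: floor_eq_iff pos_le_divide_eq pos_divide_less_eq algebra_simps)
  then show ?thesis by (auto simp: cube_def fun_eq_iff)
qed

lemma cube_disjoint: "0 < s \<Longrightarrow> c \<noteq> c' \<Longrightarrow> cube s a c \<inter> cube s a c' = {}"
  by (auto simp: cube_eq_floor)

lemma cube_ex: "0 < s \<Longrightarrow> \<exists>c. x \<in> cube s a c"
  by (auto simp: cube_eq_floor)

lemma cube_borel [measurable]: "cube s a c \<in> sets borel"
proof -
  have "(\<lambda>x. x $ i) -` {a $ i + s * c i..<a $ i + s * (c i + 1)} \<inter> space borel \<in> sets borel" for i
    by (rule measurable_sets[of "\<lambda>x. x $ i" borel borel])
      (auto intro!: borel_measurable_continuous_onI continuous_intros)
  then have "(\<Inter>i. (\<lambda>x. x $ i) -` {a $ i + s * c i..<a $ i + s * (c i + 1)} \<inter> space borel) \<in> sets borel"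
    by (intro sets.finite_INT) auto
  moreover have "(\<Inter>i. (\<lambda>x. x $ i) -` {a $ i + s * c i..<a $ i + s * (c i + 1)} \<inter> space borel) = cube s a c"
    by (auto simp: cube_def)
  ultimately show ?thesis by simp
qed

lemma cube_subset_cbox: "cube s a c \<subseteq> cbox (\<chi> i. a $ i + s * c i) (\<chi> i. a $ i + s * (c i + 1))"
  unfolding cube_def subset_iff mem_box_cart by (simp add: order_le_less)

lemma cube_bounded: "bounded (cube s a c)"
  by (rule bounded_subset[OF bounded_cbox cube_subset_cbox])

lemma measure_cube:
  assumes "0 < s" shows "measure lborel (cube s a c :: (real ^ 'n::finite) set) = s ^ CARD('n)"
proof -
  let ?l = "\<chi> i. a $ i + s * c i" and ?u = "\<chi> i. a $ i + s * (c i + 1)"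
  have "\<forall>i. ?l $ i \<le> ?u $ i" using assms by simp
  then have "cbox ?l ?u \<noteq> {}" by (simp add: interval_ne_empty_cart)
  then have cb: "measure lborel (cbox ?l ?u) = s ^ CARD('n)"
    by (simp add: content_cbox_cart algebra_simps)
  have "box ?l ?u \<subseteq> cube s a c"
    unfolding cube_def subset_iff mem_box_cart by (simp add: order_le_less)
  then have "measure lborel (box ?l ?u) \<le> measure lborel (cube s a c)"
    using emeasure_bounded_finite[OF cube_bounded[of s a c]]
    by (intro measure_mono_fmeasurable) (auto simp: fmeasurable_def)
  moreover have "measure lborel (cube s a c) \<le> measure lborel (cbox ?l ?u)"
    using cube_subset_cbox[of s a c] by (intro measure_mono_fmeasurable) auto
  moreover have "measure lborel (box ?l ?u) = measure lborel (cbox ?l ?u)"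
    by (simp add: measure_lborel_box_eq measure_lborel_cbox_eq)
  ultimately show ?thesis using cb by simp
qed

text \<open>The Euclidean norm is bounded by the sum of the coordinates, hence the factor
  \<open>CARD('n)\<close>; the side of a cube can be chosen to absorb it.\<close>

lemma dist_cube_le:
  fixes x y :: "real ^ 'n::finite"
  assumes "0 < s" "x \<in> cube s a c" "y \<in> cube s a c'" "\<And>i. \<bar>c i - c' i\<bar> \<le> k"
  shows "dist x y \<le> s * (of_int k + 1) * CARD('n)"
proof -
  have "\<bar>x $ i - y $ i\<bar> \<le> s * (of_int k + 1)" for i
  proof -
    have 1: "a $ i + s * c i \<le> x $ i" "x $ i < a $ i + s * (c i + 1)"
      "a $ i + s * c' i \<le> y $ i" "y $ i < a $ i + s * (c' i + 1)"
      using assms by (auto simp: cube_def)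
    have "s * of_int (c i - c' i) \<le> s * of_int k" "s * of_int (c' i - c i) \<le> s * of_int k"
      using assms(1) assms(4)[of i] by (auto intro!: mult_left_mono)
    then show ?thesis using 1 by (auto simp: abs_le_iff algebra_simps)
  qed
  then have "(\<Sum>i\<in>UNIV. \<bar>(x - y) $ i\<bar>) \<le> (\<Sum>i\<in>(UNIV :: 'n set). s * (of_int k + 1))"
    by (intro sum_mono) simp
  then show ?thesis using norm_le_l1_cart[of "x - y"] by (simp add: dist_norm mult.commute)
qed

text \<open>Half-openness makes the index difference strictly less than \<open>k + 1\<close>, and
  integrality improves this to \<open>k\<close>.\<close>

lemma cube_index_close:
  fixes x y :: "real ^ 'n::finite"
  assumes "0 < s" "x \<in> cube s a c" "y \<in> cube s a c'" "dist x y \<le> s * of_int k"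
  shows "\<bar>c i - c' i\<bar> \<le> k"
proof -
  have 1: "a $ i + s * c i \<le> x $ i" "x $ i < a $ i + s * (c i + 1)"
    "a $ i + s * c' i \<le> y $ i" "y $ i < a $ i + s * (c' i + 1)"
    using assms by (auto simp: cube_def)
  have "\<bar>x $ i - y $ i\<bar> \<le> s * of_int k"
    using assms(4) component_le_norm_cart[of "x - y" i] by (simp add: dist_norm)
  then have "s * (of_int (c i) - of_int (c' i)) < s * (of_int k + 1)" "s * (of_int (c' i) - of_int (c i)) < s * (of_int k + 1)"
    using 1 by (auto simp: abs_le_iff algebra_simps)
  then have "real_of_int (c i) - of_int (c' i) < of_int k + 1" "real_of_int (c' i) - of_int (c i) < of_int k + 1"
    using assms(1) by (auto simp: mult_less_cancel_left_pos)
  then show ?thesis by linarith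
qed

lemma cylinder_cube:
  assumes "I \<in> sets borel" "bounded I"
  shows "cube s a c \<times> (I :: real set) \<in> sets borel" "bounded (cube s a c \<times> I)"
proof -
  have "cube s a c \<times> I \<in> sets (borel \<Otimes>\<^sub>M borel)" using assms by (intro pair_measureI) auto
  then show "cube s a c \<times> I \<in> sets borel" unfolding borel_prod .
  show "bounded (cube s a c \<times> I)" by (intro bounded_Times cube_bounded assms)
qed

lemma (in crcm) mu_cube:
  assumes "0 < s" "I \<in> sets borel"
  shows "mu (cube s a c \<times> I) = z * s ^ CARD('n) * measure Q I"
  using assms by (subst mu_Times) (auto simp: cube_bounded measure_cube)

text \<open>If all intervals bounded away from 0 were null, so would be their countable union, and
  the whole mass would sit at 0.\<close>

lemma ex_radius_charged:
  assumes "prob_space Q" "sets Q = sets borel" "Q \<noteq> return borel (0::real)" "emeasure Q {0..R} = 1"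
  shows "\<exists>r>0. measure Q {r..R} > 0"
proof (rule ccontr)
  assume *: "\<not> ?thesis"
  interpret Q: prob_space Q by fact
  have 0: "measure Q {r..R} = 0" if "0 < r" for r
  proof -
    have "\<not> 0 < measure Q {r..R}" using * that by blast
    then show ?thesis using measure_nonneg[of Q "{r..R}"] by linarith
  qed
  have "emeasure Q (\<Union>n. {inverse (real (Suc n))..R}) = 0"
  proof (rule emeasure_UN_eq_0)
    fix n
    have "measure Q {inverse (real (Suc n))..R} = 0" by (rule 0) (simp del: of_nat_Suc)
    then show "emeasure Q {inverse (real (Suc n))..R} = 0" by (simp only: Q.emeasure_eq_measure ennreal_0)
  qed (simp add: assms(2) image_subset_iff)
  moreover have "(\<Union>n. {inverse (real (Suc n))..R}) = {0<..R}"
  proof (intro equalityI subsetI)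
    fix x assume "x \<in> {0<..R}"
    then obtain n where "inverse (real (Suc n)) < x" using reals_Archimedean[of x] by auto
    then have "x \<in> {inverse (real (Suc n))..R}" using \<open>x \<in> {0<..R}\<close> by (simp del: of_nat_Suc)
    then show "x \<in> (\<Union>n. {inverse (real (Suc n))..R})" by blast
  next
    fix x assume "x \<in> (\<Union>n. {inverse (real (Suc n))..R})"
    then obtain n where "inverse (real (Suc n)) \<le> x" "x \<le> R" by auto
    moreover have "0 < inverse (real (Suc n))" by simp
    ultimately show "x \<in> {0<..R}" unfolding greaterThanAtMost_iff by linarith
  qed
  ultimately have pos: "measure Q {0<..R} = 0" by (simp add: measure_def)
  have one: "measure Q {0..R} = 1" using assms(4) by (simp add: measure_def)
  then have "0 \<le> R" by (cases "0 \<le> R") auto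
  then have "{0..R} = {0} \<union> {0<..R}" by auto
  then have "measure Q {0..R} \<le> measure Q {0} + measure Q {0<..R}"
    by (simp only:) (rule measure_Un_le; simp add: assms(2))
  then have Q0: "measure Q {0} = 1" using one pos by (intro antisym) auto
  have "Q = return borel 0"
  proof (rule measure_eqI)
    fix A assume A: "A \<in> sets Q"
    show "emeasure Q A = emeasure (return borel 0) A"
    proof (cases "0 \<in> A")
      case True
      then have "measure Q {0} \<le> measure Q A" using A by (intro Q.finite_measure_mono) auto
      then have "measure Q A = 1" using Q0 by (intro antisym) auto
      then show ?thesis using True A assms(2) by (simp add: Q.emeasure_eq_measure)
    next
      case False
      have "measure Q ({0} \<union> A) = measure Q {0} + measure Q A"
        using A False assms(2) by (intro Q.finite_measure_Union) auto
      then have "measure Q A = 0" using Q0 Q.prob_le_1[of "{0} \<union> A"] measure_nonneg[of Q A] by linarith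
      then show ?thesis using False A assms(2) by (simp add: Q.emeasure_eq_measure)
    qed
  qed (use assms(2) in simp)
  then show False using assms(3) by simp
qed

subsection \<open>Renormalization on the square lattice\<close>

definition T9 :: "(int \<times> int) set" where
  "T9 = {0, 1, 2} \<times> {0, 1, 2}"

definition sub :: "int \<times> int \<Rightarrow> int \<times> int \<Rightarrow> int \<times> int" where
  "sub c u = (3 * fst c + fst u, 3 * snd c + snd u)"

text \<open>That at most one subblock is bad is stated through pairs, so that badness supplies two
  distinct bad subblocks, which squares the probability.\<close>

fun good :: "(int \<times> int \<Rightarrow> bool) \<Rightarrow> nat \<Rightarrow> int \<times> int \<Rightarrow> bool" where
  "good op 0 c = op c"
| "good op (Suc k) c = (\<forall>u\<in>T9. \<forall>v\<in>T9. u \<noteq> v \<longrightarrow> good op k (sub c u) \<or> good op k (sub c v))"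

fun cluster :: "(int \<times> int \<Rightarrow> bool) \<Rightarrow> nat \<Rightarrow> int \<times> int \<Rightarrow> (int \<times> int) set" where
  "cluster op 0 c = {c}"
| "cluster op (Suc k) c = (\<Union>u\<in>{u\<in>T9. good op k (sub c u)}. cluster op k (sub c u))"

lemma sub_inj:
  assumes "u \<in> T9" "v \<in> T9" "sub c u = sub c' v" shows "c = c' \<and> u = v"
proof -
  have digit: "a = b \<and> i = j" if "3 * a + i = 3 * b + j" "0 \<le> i" "i < 3" "0 \<le> j" "j < 3" for a b i j :: int
    using that by presburger
  have "0 \<le> fst w \<and> fst w < 3 \<and> 0 \<le> snd w \<and> snd w < 3" if "w \<in> T9" for w
    using that by (auto simp: T9_def)
  from this[OF assms(1)] this[OF assms(2)] show ?thesis
    using assms(3) digit[of "fst c" "fst u" "fst c'" "fst v"] digit[of "snd c" "snd u" "snd c'" "snd v"]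
    by (simp add: sub_def prod_eq_iff)
qed

text \<open>With at most one bad position some line \<open>i0\<close> is entirely good and serves as
  a hub. Transitivity requires a good middle position because \<open>L\<close> will quantify over
  clusters, and the cluster of a bad block may be empty.\<close>

lemma grid_linked:
  fixes g :: "int \<times> int \<Rightarrow> bool" and L :: "int \<times> int \<Rightarrow> int \<times> int \<Rightarrow> bool"
  assumes one: "\<And>u v. u \<in> T9 \<Longrightarrow> v \<in> T9 \<Longrightarrow> u \<noteq> v \<Longrightarrow> g u \<or> g v"
    and refl: "\<And>u. g u \<Longrightarrow> L u u"
    and sym: "\<And>u v. L u v \<Longrightarrow> L v u"
    and trans: "\<And>u v w. g v \<Longrightarrow> L u v \<Longrightarrow> L v w \<Longrightarrow> L u w"
    and right: "\<And>i j. g (i, j) \<Longrightarrow> g (i + 1, j) \<Longrightarrow> L (i, j) (i + 1, j)"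
    and up: "\<And>i j. g (i, j) \<Longrightarrow> g (i, j + 1) \<Longrightarrow> L (i, j) (i, j + 1)"
    and u: "u \<in> T9" "g u" and v: "v \<in> T9" "g v"
  shows "L u v"
proof -
  let ?D = "{0, 1, 2} :: int set"
  have row: "L (i, j) (i, j')" if "\<And>j. j \<in> ?D \<Longrightarrow> g (i, j)" "j \<in> ?D" "j' \<in> ?D" for i j j'
  proof -
    have g: "g (i, 0)" "g (i, 1)" "g (i, 2)" using that(1) by auto
    have 1: "L (i, 0) (i, 1)" "L (i, 1) (i, 2)" using up[of i 0] up[of i 1] g by auto
    then have "L (i, 0) (i, 2)" using trans g by blast
    then show ?thesis using 1 refl g sym that(2,3) by auto
  qed
  have col: "L (i, j) (i', j)" if "\<And>i. i \<in> ?D \<Longrightarrow> g (i, j)" "i \<in> ?D" "i' \<in> ?D" for i i' j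
  proof -
    have g: "g (0, j)" "g (1, j)" "g (2, j)" using that(1) by auto
    have 1: "L (0, j) (1, j)" "L (1, j) (2, j)" using right[of 0 j] right[of 1 j] g by auto
    then have "L (0, j) (2, j)" using trans g by blast
    then show ?thesis using 1 refl g sym that(2,3) by auto
  qed
  have ex_row: "\<exists>i\<in>?D. \<forall>j\<in>?D. g (i, j)"
  proof (rule ccontr)
    assume "\<not> ?thesis"
    then obtain j j' where "j \<in> ?D" "j' \<in> ?D" "\<not> g (0, j)" "\<not> g (1, j')" by auto
    then show False using one[of "(0, j)" "(1, j')"] by (auto simp: T9_def)
  qed
  then obtain i0 where i0: "i0 \<in> ?D" "\<And>j. j \<in> ?D \<Longrightarrow> g (i0, j)" by blast
  have to0: "L w (i0, 0)" if w: "w \<in> T9" "g w" for w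
  proof -
    obtain i j where ij: "w = (i, j)" "i \<in> ?D" "j \<in> ?D" using w(1) by (auto simp: T9_def)
    show ?thesis
    proof (cases "\<forall>i'\<in>?D. g (i', j)")
      case True
      then have "L (i, j) (i0, j)" using ij i0(1) by (intro col) auto
      moreover have "L (i0, j) (i0, 0)" using i0(2) ij by (intro row) auto
      ultimately show ?thesis using trans i0(2) ij by blast
    next
      \<comment> \<open>The only bad position shares the second coordinate \<open>j\<close> with
        \<open>w\<close>. Everything else is good, so a move to another \<open>j'\<close> allows a
        detour around it.\<close>
      case False
      then obtain ib where ib: "ib \<in> ?D" "\<not> g (ib, j)" by blast
      have others: "g (i', j')" if "i' \<in> ?D" "j' \<in> ?D" "(i', j') \<noteq> (ib, j)" for i' j'
        using one[of "(ib, j)" "(i', j')"] ib that ij by (auto simp: T9_def)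
      have "ib \<noteq> i" using w(2) ib ij by auto
      have "\<exists>j'. j' \<in> ?D \<and> j' \<noteq> j" by (rule exI[of _ "if j = 0 then 1 else 0"]) auto
      then obtain j' where j': "j' \<in> ?D" "j' \<noteq> j" by blast
      have 1: "L (i, j) (i, j')" using others \<open>ib \<noteq> i\<close> ij j' by (intro row) auto
      have 2: "L (i, j') (i0, j')" using others j' ij i0(1) by (intro col) auto
      have 3: "L (i0, j') (i0, 0)" using i0(2) j' by (intro row) auto
      have "g (i, j')" "g (i0, j')" using others \<open>ib \<noteq> i\<close> ij j' i0(2) by auto
      then show ?thesis using 1 2 3 trans ij(1) by blast
    qed
  qed
  show ?thesis using to0[OF u] sym[OF to0[OF v]] trans[of "(i0, 0)" u v] i0(2)[of 0] by auto
qed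

lemma good_cluster_nonempty: "good op k c \<Longrightarrow> cluster op k c \<noteq> {}"
proof (induction k arbitrary: c)
  case (Suc k)
  have "good op k (sub c (0, 0)) \<or> good op k (sub c (0, 1))"
    using Suc.prems by (auto simp: T9_def)
  then obtain u where "u \<in> T9" "good op k (sub c u)" by (auto simp: T9_def)
  moreover obtain x where "x \<in> cluster op k (sub c u)" using Suc.IH[OF calculation(2)] by blast
  ultimately have "x \<in> cluster op (Suc k) c" unfolding cluster.simps by blast
  then show ?case by blast
qed simp

lemma cluster_open: "good op k c \<Longrightarrow> x \<in> cluster op k c \<Longrightarrow> op x"
proof (induction k arbitrary: c)
  case (Suc k)
  from Suc.prems(2) obtain u where "good op k (sub c u)" "x \<in> cluster op k (sub c u)"
    unfolding cluster.simps by blast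
  then show ?case by (rule Suc.IH)
qed simp

lemma cluster_fst_ge: "x \<in> cluster op k c \<Longrightarrow> 3 ^ k * fst c \<le> fst x"
proof (induction k arbitrary: c)
  case (Suc k)
  then obtain u where u: "u \<in> T9" "x \<in> cluster op k (sub c u)" by auto
  have "3 ^ Suc k * fst c \<le> 3 ^ k * fst (sub c u)" using u(1) by (auto simp: T9_def sub_def algebra_simps)
  then show ?case using Suc.IH[OF u(2)] by linarith
qed simp

text \<open>Induction on the scale: within a good block the good subblocks are linked, and across a
  common side two good subblocks face each other.\<close>

lemma cluster_linked:
  fixes C :: "int \<times> int \<Rightarrow> int \<times> int \<Rightarrow> bool"
  assumes sym: "\<And>x y. C x y \<Longrightarrow> C y x" and trans: "\<And>x y z. C x y \<Longrightarrow> C y z \<Longrightarrow> C x z"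
    and nb: "\<And>c d. op c \<Longrightarrow> op d \<Longrightarrow> d = c \<or> d = (fst c + 1, snd c) \<or> d = (fst c, snd c + 1) \<Longrightarrow> C c d"
  shows "good op k c \<Longrightarrow> good op k d \<Longrightarrow> d = c \<or> d = (fst c + 1, snd c) \<or> d = (fst c, snd c + 1) \<Longrightarrow>
    x \<in> cluster op k c \<Longrightarrow> y \<in> cluster op k d \<Longrightarrow> C x y"
proof (induction k arbitrary: c d x y)
  case 0
  then show ?case using nb by auto
next
  case (Suc k)
  let ?D = "{0, 1, 2} :: int set"
  define g where "g c u = good op k (sub c u)" for c u
  define L where "L c u v \<longleftrightarrow> (\<forall>x\<in>cluster op k (sub c u). \<forall>y\<in>cluster op k (sub c v). C x y)" for c u v
  have ne: "\<exists>x. x \<in> cluster op k (sub c u)" if "g c u" for c u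
    using good_cluster_nonempty[of op k "sub c u"] that by (auto simp: g_def)
  have inner: "L c u v" if c: "good op (Suc k) c" and uv: "u \<in> T9" "g c u" "v \<in> T9" "g c v" for c u v
  proof (rule grid_linked[where g = "g c"])
    show "g c u' \<or> g c v'" if "u' \<in> T9" "v' \<in> T9" "u' \<noteq> v'" for u' v'
      using c that by (auto simp: g_def)
    show "L c u' u'" if "g c u'" for u'
      using that Suc.IH[of "sub c u'" "sub c u'"] by (auto simp: g_def L_def)
    show "L c v' u'" if "L c u' v'" for u' v' using that sym by (auto simp: L_def)
    show "L c u' w" if "g c v'" "L c u' v'" "L c v' w" for u' v' w
      using ne[OF that(1)] that(2,3) trans unfolding L_def by blast
    show "L c (i, j) (i + 1, j)" if "g c (i, j)" "g c (i + 1, j)" for i j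
      using that Suc.IH[of "sub c (i, j)" "sub c (i + 1, j)"] by (auto simp: g_def L_def sub_def)
    show "L c (i, j) (i, j + 1)" if "g c (i, j)" "g c (i, j + 1)" for i j
      using that Suc.IH[of "sub c (i, j)" "sub c (i, j + 1)"] by (auto simp: g_def L_def sub_def)
  qed (use uv in auto)
  obtain u where u: "u \<in> T9" "g c u" "x \<in> cluster op k (sub c u)" using Suc.prems by (auto simp: g_def)
  obtain v where v: "v \<in> T9" "g d v" "y \<in> cluster op k (sub d v)" using Suc.prems by (auto simp: g_def)
  \<comment> \<open>Three pairs of subblocks face each other across the side. Each block has at most
    one bad subblock, so at most two pairs are spoiled.\<close>
  have pair: "\<exists>j\<in>?D. g c (f j) \<and> g d (h j)"
    if f: "\<And>j. j \<in> ?D \<Longrightarrow> f j \<in> T9 \<and> h j \<in> T9" "inj f" "inj h" for f h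
  proof (rule ccontr)
    assume "\<not> ?thesis"
    then have no: "\<not> g c (f j) \<or> \<not> g d (h j)" if "j \<in> ?D" for j using that by blast
    have A: "g c (f j) \<or> g c (f j')" "g d (h j) \<or> g d (h j')" if "j \<in> ?D" "j' \<in> ?D" "j \<noteq> j'" for j j'
      using Suc.prems(1,2) f(1)[OF that(1)] f(1)[OF that(2)] f(2,3) that(3) by (auto simp: g_def inj_eq)
    show False using no[of 0] no[of 1] no[of 2] A[of 0 1] A[of 0 2] A[of 1 2] by auto
  qed
  have step: "C x y" if f: "u' \<in> T9" "v' \<in> T9" "g c u'" "g d v'"
    and adj: "sub d v' = (fst (sub c u') + 1, snd (sub c u')) \<or> sub d v' = (fst (sub c u'), snd (sub c u') + 1)" for u' v'
  proof -
    obtain x' where x': "x' \<in> cluster op k (sub c u')" using ne[OF f(3)] by blast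
    obtain y' where y': "y' \<in> cluster op k (sub d v')" using ne[OF f(4)] by blast
    have "C x x'" using inner[OF Suc.prems(1) u(1,2) f(1,3)] u(3) x' by (auto simp: L_def)
    moreover have "C x' y'" using Suc.IH[OF _ _ _ x' y'] f adj by (auto simp: g_def)
    moreover have "C y' y" using inner[OF Suc.prems(2) f(2,4) v(1,2)] v(3) y' by (auto simp: L_def)
    ultimately show ?thesis using trans by blast
  qed
  consider "d = c" | "d = (fst c + 1, snd c)" | "d = (fst c, snd c + 1)" using Suc.prems(3) by auto
  then show ?case
  proof cases
    case 1
    then show ?thesis using inner[OF Suc.prems(1) u(1,2), of v] u v by (auto simp: L_def)
  next
    case 2
    \<comment> \<open>Offset 2 in the left block and offset 0 in the right one give consecutive
      coordinates after \<open>sub\<close>; the vertical case is analogous.\<close>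
    obtain j where "j \<in> ?D" "g c (2, j)" "g d (0, j)"
      using pair[of "\<lambda>j. (2, j)" "\<lambda>j. (0, j)"] by (auto simp: T9_def inj_def)
    then show ?thesis using 2 by (intro step[of "(2, j)" "(0, j)"]) (auto simp: T9_def sub_def)
  next
    case 3
    obtain j where "j \<in> ?D" "g c (j, 2)" "g d (j, 0)"
      using pair[of "\<lambda>j. (j, 2)" "\<lambda>j. (j, 0)"] by (auto simp: T9_def inj_def)
    then show ?thesis using 3 by (intro step[of "(j, 2)" "(j, 0)"]) (auto simp: T9_def sub_def)
  qed
qed

text \<open>The block \<open>(0, 0)\<close> is a subblock of the block \<open>(0, 0)\<close> at the
  next scale, so a point of the cluster at scale \<open>K\<close> stays in all later ones. A good
  subblock with first offset 2 contains points whose first coordinate grows like a power of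
  3.\<close>

lemma good_unbounded_cluster:
  fixes C :: "int \<times> int \<Rightarrow> int \<times> int \<Rightarrow> bool"
  assumes "\<And>x y. C x y \<Longrightarrow> C y x" and "\<And>x y z. C x y \<Longrightarrow> C y z \<Longrightarrow> C x z"
    and "\<And>c d. op c \<Longrightarrow> op d \<Longrightarrow> d = c \<or> d = (fst c + 1, snd c) \<or> d = (fst c, snd c + 1) \<Longrightarrow> C c d"
    and good: "\<And>k. K \<le> k \<Longrightarrow> good op k (0, 0)"
  shows "\<exists>x. op x \<and> (\<forall>n::nat. \<exists>y. op y \<and> C x y \<and> int n \<le> fst y)"
proof -
  obtain x where x: "x \<in> cluster op K (0, 0)" using good_cluster_nonempty[OF good[of K]] by auto
  have nest: "x \<in> cluster op (K + n) (0, 0)" for n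
  proof (induction n)
    case (Suc n)
    have "sub (0, 0) (0, 0) = (0, 0)" by (simp add: sub_def)
    then have "(0, 0) \<in> {u\<in>T9. good op (K + n) (sub (0, 0) u)}"
      using good[of "K + n"] by (simp add: T9_def)
    then show ?case using Suc \<open>sub (0, 0) (0, 0) = (0, 0)\<close> by force
  qed (use x in simp)
  have "\<exists>y. op y \<and> C x y \<and> int n \<le> fst y" for n
  proof -
    have "good op (Suc (K + n)) (0, 0)" by (rule good) simp
    then have "good op (K + n) (sub (0, 0) (2, 0)) \<or> good op (K + n) (sub (0, 0) (2, 1))"
      by (auto simp: T9_def)
    then obtain u where u: "u \<in> T9" "fst u = 2" "good op (K + n) (sub (0, 0) u)" by (force simp: T9_def)
    obtain y where y: "y \<in> cluster op (K + n) (sub (0, 0) u)" using good_cluster_nonempty[OF u(3)] by auto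
    then have y': "y \<in> cluster op (K + Suc n) (0, 0)"
      unfolding add_Suc_right cluster.simps using u by blast
    have "int n \<le> 3 ^ (K + n) * 2"
    proof -
      have "n < 3 ^ n" by (induction n) auto
      also have "(3::nat) ^ n \<le> 3 ^ (K + n) * 2" by (simp add: power_add)
      finally have "n < 3 ^ (K + n) * 2" .
      then have "int n < int (3 ^ (K + n) * 2)" by (simp only: of_nat_less_iff)
      then show ?thesis by simp
    qed
    also have "\<dots> \<le> fst y" using cluster_fst_ge[OF y] u(2) by (simp add: sub_def)
    finally have "int n \<le> fst y" .
    moreover have "op y" by (rule cluster_open[OF u(3) y])
    moreover have "C x y"
      by (rule cluster_linked[OF assms(1-3) good good _ nest[of "Suc n"] y']) auto
    ultimately show ?thesis by blast
  qed
  moreover have "op x" by (rule cluster_open[OF good x]) simp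
  ultimately show ?thesis by blast
qed

text \<open>The bound for arbitrary finite families replaces independence and is inherited: a family
  of bad blocks forces twice as many distinct bad blocks one scale below. The union bound over at
  most 81 ordered pairs per block gives the recursion
  \<open>e (Suc k) = 81 * (e k)\<^sup>2\<close>.\<close>

lemma (in prob_space) good_blocks:
  fixes X :: "int \<times> int \<Rightarrow> 'a set"
  assumes sets: "\<And>c. X c \<in> events"
    and le: "\<And>S. finite S \<Longrightarrow> prob (space M \<inter> (\<Inter>c\<in>S. X c)) \<le> \<alpha> ^ card S"
    and \<alpha>: "0 \<le> \<alpha>" "81 * \<alpha> \<le> 1 / 2"
  shows "AE \<omega> in M. \<exists>K. \<forall>k\<ge>K. good (\<lambda>c. \<omega> \<notin> X c) k (0, 0)"
proof -
  define B where "B k c = {\<omega>\<in>space M. \<not> good (\<lambda>c. \<omega> \<notin> X c) k c}" for k c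
  have T9: "finite T9" "card T9 = 9" by (simp_all add: T9_def)
  have B_Suc: "B (Suc k) c = (\<Union>u\<in>T9. \<Union>v\<in>T9 - {u}. B k (sub c u) \<inter> B k (sub c v))" for k c
    unfolding B_def good.simps by blast
  have B_sets: "B k c \<in> events" for k c
  proof (induction k arbitrary: c)
    case 0
    have "B 0 c = X c" using sets.sets_into_space[OF sets[of c]] by (auto simp: B_def)
    then show ?case using sets by simp
  next
    case (Suc k)
    then show ?case unfolding B_Suc using T9 by (intro sets.finite_UN sets.Int) auto
  qed
  \<comment> \<open>The solution of this recursion with \<open>e 0\<close> equal to
    \<alpha>.\<close>
  define e where "e k = (81 * \<alpha>) ^ (2 ^ k) / 81" for k :: nat
  have e0: "0 \<le> e k" for k using \<alpha> by (simp add: e_def)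
  have e_Suc: "81 * (e k)\<^sup>2 = e (Suc k)" for k
  proof -
    have "2 ^ Suc k = 2 ^ k * (2 :: nat)" by simp
    then have "(81 * \<alpha>) ^ 2 ^ Suc k = ((81 * \<alpha>) ^ 2 ^ k)\<^sup>2" by (simp only: power_mult)
    then show ?thesis by (simp add: e_def power2_eq_square)
  qed
  have B_le: "finite S \<Longrightarrow> prob (space M \<inter> (\<Inter>c\<in>S. B k c)) \<le> e k ^ card S" for S k
  proof (induction k arbitrary: S)
    case 0
    have "(\<Inter>c\<in>S. B 0 c) \<inter> space M = (\<Inter>c\<in>S. X c) \<inter> space M" by (auto simp: B_def)
    then show ?case using le[OF 0] by (simp add: e_def Int_commute)
  next
    case (Suc k)
    define Pr where "Pr = {p\<in>T9 \<times> T9. fst p \<noteq> snd p}"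
    have Pr: "finite Pr" "card Pr \<le> 81"
    proof -
      have "Pr \<subseteq> T9 \<times> T9" "finite (T9 \<times> T9)" "card (T9 \<times> T9) = 81" using T9 by (auto simp: Pr_def)
      then show "finite Pr" "card Pr \<le> 81" using card_mono[of "T9 \<times> T9" Pr] finite_subset by auto
    qed
    \<comment> \<open>A function in \<open>F\<close> chooses a pair of bad subblocks in every block
      of \<open>S\<close>; \<open>G f\<close> collects the chosen subblocks, which are distinct by
      \<open>sub_inj\<close>.\<close>
    define F where "F = (\<Pi>\<^sub>E c\<in>S. Pr)"
    have F: "finite F" "card F \<le> 81 ^ card S"
      using Pr Suc.prems by (auto simp: F_def card_PiE intro: finite_PiE power_mono)
    define G where "G f = (\<Union>c\<in>S. {sub c (fst (f c)), sub c (snd (f c))})" for f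
    have G: "finite (G f)" "card (G f) = 2 * card S" if f: "f \<in> F" for f
    proof -
      show "finite (G f)" using Suc.prems by (simp add: G_def)
      have f': "fst (f c) \<in> T9" "snd (f c) \<in> T9" "fst (f c) \<noteq> snd (f c)" if "c \<in> S" for c
      proof -
        have "f c \<in> Pr" using f that unfolding F_def by (rule PiE_mem)
        then show "fst (f c) \<in> T9" "snd (f c) \<in> T9" "fst (f c) \<noteq> snd (f c)"
          unfolding Pr_def by (simp_all add: mem_Times_iff)
      qed
      have "card (G f) = (\<Sum>c\<in>S. card {sub c (fst (f c)), sub c (snd (f c))})"
        unfolding G_def
      proof (rule card_UN_disjoint)
        show "\<forall>c\<in>S. \<forall>d\<in>S. c \<noteq> d \<longrightarrow> {sub c (fst (f c)), sub c (snd (f c))} \<inter> {sub d (fst (f d)), sub d (snd (f d))} = {}"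
        proof (intro ballI impI)
          fix c d assume cd: "c \<in> S" "d \<in> S" "c \<noteq> d"
          then have "sub c u \<noteq> sub d v" if "u \<in> T9" "v \<in> T9" for u v using sub_inj[OF that] by blast
          then show "{sub c (fst (f c)), sub c (snd (f c))} \<inter> {sub d (fst (f d)), sub d (snd (f d))} = {}"
            using f'[OF cd(1)] f'[OF cd(2)] by simp
        qed
      qed (use Suc.prems in auto)
      also have "\<dots> = (\<Sum>c\<in>S. 2)"
      proof (rule sum.cong[OF refl])
        fix c assume c: "c \<in> S"
        then have "sub c (fst (f c)) \<noteq> sub c (snd (f c))" using sub_inj f'[OF c] by blast
        then show "card {sub c (fst (f c)), sub c (snd (f c))} = 2" by simp
      qed
      finally show "card (G f) = 2 * card S" by simp
    qed
    have "space M \<inter> (\<Inter>c\<in>S. B (Suc k) c) \<subseteq> (\<Union>f\<in>F. space M \<inter> (\<Inter>d\<in>G f. B k d))"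
    proof
      fix \<omega> assume \<omega>: "\<omega> \<in> space M \<inter> (\<Inter>c\<in>S. B (Suc k) c)"
      then have "\<exists>p. p \<in> Pr \<and> \<omega> \<in> B k (sub c (fst p)) \<and> \<omega> \<in> B k (sub c (snd p))" if "c \<in> S" for c
        using that by (fastforce simp: B_Suc Pr_def)
      then obtain f where f: "\<And>c. c \<in> S \<Longrightarrow> f c \<in> Pr \<and> \<omega> \<in> B k (sub c (fst (f c))) \<and> \<omega> \<in> B k (sub c (snd (f c)))"
        by metis
      then have "restrict f S \<in> F" by (auto simp: F_def)
      moreover have "\<omega> \<in> space M \<inter> (\<Inter>d\<in>G (restrict f S). B k d)" using f \<omega> by (auto simp: G_def)
      ultimately show "\<omega> \<in> (\<Union>f\<in>F. space M \<inter> (\<Inter>d\<in>G f. B k d))" by blast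
    qed
    moreover have ev: "space M \<inter> (\<Inter>d\<in>G f. B k d) \<in> events" if "f \<in> F" for f
    proof (cases "G f = {}")
      case False
      then show ?thesis using G(1)[OF that] B_sets by (intro sets.Int sets.finite_INT) auto
    qed simp
    ultimately have "prob (space M \<inter> (\<Inter>c\<in>S. B (Suc k) c)) \<le> prob (\<Union>f\<in>F. space M \<inter> (\<Inter>d\<in>G f. B k d))"
      using F by (intro finite_measure_mono sets.finite_UN) auto
    also have "\<dots> \<le> (\<Sum>f\<in>F. prob (space M \<inter> (\<Inter>d\<in>G f. B k d)))"
      using F ev by (intro finite_measure_subadditive_finite) auto
    also have "\<dots> \<le> (\<Sum>f\<in>F. e k ^ (2 * card S))"
      using Suc.IH G by (intro sum_mono) force
    also have "\<dots> \<le> 81 ^ card S * e k ^ (2 * card S)"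
      using F(2) e0[of k] of_nat_mono[OF F(2), where 'a = real] by (simp add: mult_right_mono)
    also have "\<dots> = e (Suc k) ^ card S"
      by (simp add: e_Suc[symmetric] power_mult power_mult_distrib)
    finally show ?case .
  qed
  have small: "prob (B k (0, 0)) \<le> (1 / 2) ^ k" for k
  proof -
    have "space M \<inter> (\<Inter>c\<in>{(0, 0)}. B k c) = B k (0, 0)" by (auto simp: B_def)
    then have "prob (B k (0, 0)) \<le> e k" using B_le[of "{(0, 0)}" k] by simp
    also have "\<dots> \<le> (81 * \<alpha>) ^ 2 ^ k" using \<alpha> by (simp add: e_def)
    also have "\<dots> \<le> (1 / 2) ^ 2 ^ k" using \<alpha> by (intro power_mono) auto
    also have "\<dots> \<le> (1 / 2) ^ k" by (intro power_decreasing) (auto intro: less_imp_le)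
    finally show ?thesis .
  qed
  have "summable (\<lambda>k. prob (B k (0, 0)))"
  proof (rule summable_comparison_test')
    show "summable (\<lambda>k. (1 / 2 :: real) ^ k)" by (rule summable_geometric) simp
    show "norm (prob (B k (0, 0))) \<le> (1 / 2) ^ k" if "0 \<le> k" for k using small[of k] by simp
  qed
  \<comment> \<open>By Borel-Cantelli only finitely many scales are bad at the origin.\<close>
  then have "AE \<omega> in M. eventually (\<lambda>k. \<omega> \<in> space M - B k (0, 0)) sequentially"
    using B_sets by (intro borel_cantelli_AE1) (simp_all add: emeasure_eq_measure)
  then show ?thesis
  proof eventually_elim
    case (elim \<omega>)
    then show ?case by (auto simp: B_def eventually_sequentially)
  qed
qed

subsection \<open>Percolation at high intensity\<close>

lemma percolatesI:
  assumes p: "p \<in> points \<omega>" "0 \<le> snd p"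
    and far: "\<And>n::nat. \<exists>y\<in>points \<omega>. (p, y) \<in> (adj touch (points \<omega>))\<^sup>* \<and> 0 \<le> snd y \<and> real n \<le> norm (fst y)"
  shows "percolates \<omega>"
proof -
  let ?C = "{y. connected_in \<omega> (fst p) y}"
  have fp: "fst p \<in> germ_ball p" using p by (simp add: germ_ball_def)
  then have "fst p \<in> covered \<omega>" using p by (auto simp: covered_def)
  then have "?C \<in> conn_components \<omega>" by (auto simp: conn_components_def quotient_def)
  moreover have "\<not> bounded ?C"
  proof
    assume "bounded ?C"
    then obtain b where b: "\<And>y. y \<in> ?C \<Longrightarrow> norm y \<le> b" by (auto simp: bounded_iff)
    obtain n :: nat where n: "b < real n" using reals_Archimedean2 by blast
    obtain y where y: "y \<in> points \<omega>" "(p, y) \<in> (adj touch (points \<omega>))\<^sup>*" "0 \<le> snd y" "real n \<le> norm (fst y)"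
      using far[of n] by blast
    have "fst y \<in> germ_ball y" using y by (simp add: germ_ball_def)
    then have "fst y \<in> ?C" unfolding mem_Collect_eq connected_in_iff using y p fp by blast
    then show False using b y n by force
  qed
  ultimately show ?thesis unfolding percolates_def by blast
qed

context crcm
begin

text \<open>The vacancy of the remaining regions is an event outside \<open>\<Gamma> c\<close>, so
  regions can be split off one at a time, each at the cost of one factor.\<close>

lemma prob_all_vacant_le:
  assumes S: "finite S" "\<And>c. c \<in> S \<Longrightarrow> \<Gamma> c \<in> sets borel" "\<And>c. c \<in> S \<Longrightarrow> bounded (\<Gamma> c)"
    and disj: "\<And>c d. c \<in> S \<Longrightarrow> d \<in> S \<Longrightarrow> c \<noteq> d \<Longrightarrow> \<Gamma> c \<inter> \<Gamma> d = {}"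
    and m: "\<And>c. c \<in> S \<Longrightarrow> mu (\<Gamma> c) = m"
    and clique: "\<And>c p w. \<lbrakk>c \<in> S; p \<in> \<Gamma> c; w \<in> \<Gamma> c; 0 \<le> snd p; 0 \<le> snd w\<rbrakk> \<Longrightarrow> touch p w"
    and m0: "0 \<le> m"
  shows "measure P (configurations \<inter> (\<Inter>c\<in>S. {\<omega>\<in>configurations. cnt \<omega> (\<Gamma> c) = 0})) \<le> vacancy m ^ card S"
  using S disj m clique
proof (induction S)
  case empty
  then show ?case by simp
next
  case (insert c S)
  let ?E = "\<lambda>c. {\<omega>\<in>configurations. cnt \<omega> (\<Gamma> c) = 0}"
  let ?B = "configurations \<inter> (\<Inter>c\<in>S. ?E c)"
  have B: "local_event (- \<Gamma> c) ?B"
  proof (rule local_event_INT)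
    fix d assume d: "d \<in> S"
    then have "\<Gamma> d \<inter> \<Gamma> c = {}" using insert.prems(3)[of d c] insert.hyps by auto
    then show "local_event (- \<Gamma> c) (?E d)"
      using insert.prems(1)[of c] insert.prems(1)[of d] insert.prems(2)[of d] d
      by (intro local_event_cnt) auto
  qed (use insert in auto)
  have "configurations \<inter> (\<Inter>c\<in>insert c S. ?E c) = ?E c \<inter> ?B" by auto
  also have "measure P \<dots> \<le> vacancy (mu (\<Gamma> c)) * measure P ?B"
  proof (rule prob_vacant_le[OF _ _ B])
    show "touch p w" if "p \<in> \<Gamma> c" "w \<in> \<Gamma> c" "0 \<le> snd p" "0 \<le> snd w" for p w
      by (rule insert.prems(5)[OF insertI1 that])
  qed (rule insert.prems; simp)+
  also have "\<dots> \<le> vacancy m * vacancy m ^ card S"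
  proof (rule mult_mono)
    show "measure P ?B \<le> vacancy m ^ card S" by (rule insert.IH; rule insert.prems; simp)
    show "vacancy (mu (\<Gamma> c)) \<le> vacancy m" using insert.prems(4)[of c] by simp
  qed (simp_all add: vacancy_nonneg[OF m0])
  finally show ?case using insert.hyps by simp
qed

lemma percolates_AE:
  assumes "2 \<le> CARD('n)" and r: "0 < r" and \<beta>: "0 < measure Q {r..R\<^sub>0}"
    and large: "81 * (exp (- (z * (r / CARD('n)) ^ CARD('n) * measure Q {r..R\<^sub>0})) / q) \<le> 1 / 2"
  shows "AE \<omega> in P. percolates \<omega>"
proof -
  have "\<not> is_singleton (UNIV :: 'n set)" using assms(1) by (simp add: is_singleton_altdef)
  then obtain a b :: 'n where ab: "a \<noteq> b" by (metis UNIV_I is_singletonI' UNIV_not_empty)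
  \<comment> \<open>With this side, points of equal or adjacent cubes are at distance at most
    \<open>2 * r\<close>, so balls of radius at least \<open>r\<close> centred there touch.\<close>
  define s where "s = r / CARD('n)"
  have s: "0 < s" using r by (simp add: s_def)
  \<comment> \<open>The square lattice is placed in the coordinate plane of \<open>a\<close> and
    \<open>b\<close>; an unbounded component is already found there.\<close>
  define emb where "emb c k = (if k = a then fst c else if k = b then snd c else 0)" for c :: "int \<times> int" and k
  define \<Gamma> where "\<Gamma> c = cube s (0 :: real ^ 'n) (emb c) \<times> {r..R\<^sub>0}" for c
  have \<Gamma>: "\<Gamma> c \<in> sets borel" "bounded (\<Gamma> c)" for c unfolding \<Gamma>_def by (intro cylinder_cube; simp)+
  define m where "m = z * s ^ CARD('n) * measure Q {r..R\<^sub>0}"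
  have m: "mu (\<Gamma> c) = m" "0 \<le> m" for c
    using s z_pos by (simp_all add: \<Gamma>_def m_def mu_cube)
  have emb_inj: "c = d" if "emb c = emb d" for c d
    using fun_cong[OF that, of a] fun_cong[OF that, of b] ab by (simp add: emb_def prod_eq_iff)
  have near: "touch p w" if "p \<in> \<Gamma> c" "w \<in> \<Gamma> d" "\<And>k. \<bar>emb c k - emb d k\<bar> \<le> 1" for p w c d
  proof -
    have "dist (fst p) (fst w) \<le> s * (of_int 1 + 1) * CARD('n)"
      using that s by (intro dist_cube_le[of s _ 0 "emb c" _ "emb d"]) (auto simp: \<Gamma>_def)
    also have "\<dots> = 2 * r" by (simp add: s_def)
    also have "\<dots> \<le> snd p + snd w" using that by (auto simp: \<Gamma>_def)
    finally show ?thesis using that r by (subst touch_iff) (auto simp: \<Gamma>_def)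
  qed
  let ?E = "\<lambda>c. {\<omega>\<in>configurations. cnt \<omega> (\<Gamma> c) = 0}"
  have "AE \<omega> in P. \<exists>K. \<forall>k\<ge>K. good (\<lambda>c. \<omega> \<notin> ?E c) k (0, 0)"
  proof (rule P.good_blocks)
    show "?E c \<in> P.events" for c unfolding sets_P by (intro cnt_event \<Gamma>)
    show "measure P (space P \<inter> (\<Inter>c\<in>S. ?E c)) \<le> vacancy m ^ card S" if "finite S" for S
      unfolding space_P
    proof (rule prob_all_vacant_le[OF that \<Gamma> _ m(1) _ m(2)])
      show "\<Gamma> c \<inter> \<Gamma> d = {}" if "c \<noteq> d" for c d
      proof -
        have "cube s (0 :: real ^ 'n) (emb c) \<inter> cube s 0 (emb d) = {}"
          by (rule cube_disjoint[OF s]) (use emb_inj that in blast)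
        then show ?thesis unfolding \<Gamma>_def Times_Int_Times by simp
      qed
      show "touch p w" if "p \<in> \<Gamma> c" "w \<in> \<Gamma> c" for c p w using near[OF that] by simp
    qed
    show "0 \<le> vacancy m" by (rule vacancy_nonneg[OF m(2)])
    have "vacancy m \<le> exp (- m) / q" by (rule vacancy_le[OF m(2)])
    then show "81 * vacancy m \<le> 1 / 2" using large unfolding m_def s_def by linarith
  qed
  then show ?thesis using AE_space
  proof eventually_elim
    case (elim \<omega>)
    then have \<omega>: "\<omega> \<in> configurations" by simp
    define op where "op c \<longleftrightarrow> points \<omega> \<inter> \<Gamma> c \<noteq> {}" for c
    have "(\<lambda>c. \<omega> \<notin> ?E c) = op" by (rule ext) (simp add: op_def cnt_eq_0_iff \<omega> \<Gamma>)
    then obtain K where K: "\<And>k. K \<le> k \<Longrightarrow> good op k (0, 0)" using elim(1) by auto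
    define pt where "pt c = (SOME p. p \<in> points \<omega> \<inter> \<Gamma> c)" for c
    have pt: "pt c \<in> points \<omega>" "pt c \<in> \<Gamma> c" if "op c" for c
      using that someI_ex[of "\<lambda>p. p \<in> points \<omega> \<inter> \<Gamma> c"] unfolding op_def pt_def by blast+
    have "\<exists>x. op x \<and> (\<forall>n::nat. \<exists>y. op y \<and> (pt x, pt y) \<in> (adj touch (points \<omega>))\<^sup>* \<and> int n \<le> fst y)"
    proof (rule good_unbounded_cluster[OF _ _ _ K])
      fix c d assume cd: "op c" "op d" "d = c \<or> d = (fst c + 1, snd c) \<or> d = (fst c, snd c + 1)"
      have "touch (pt c) (pt d)" using cd by (intro near[of _ c _ d] pt) (auto simp: emb_def)
      then show "(pt c, pt d) \<in> (adj touch (points \<omega>))\<^sup>*" using pt(1)[OF cd(1)] pt(1)[OF cd(2)] by (intro r_into_rtrancl) (simp add: adj_def)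
    qed (auto intro: touch.adj_rtrancl_sym)
    then obtain x where x: "op x" "\<And>n::nat. \<exists>y. op y \<and> (pt x, pt y) \<in> (adj touch (points \<omega>))\<^sup>* \<and> int n \<le> fst y"
      by blast
    show ?case
    proof (rule percolatesI[of "pt x"])
      fix n :: nat
      \<comment> \<open>Converts a Euclidean distance into a number of cubes of side
        \<open>s\<close>.\<close>
      obtain N :: nat where N: "real n / s \<le> real N" using real_arch_simple by blast
      obtain y where y: "op y" "(pt x, pt y) \<in> (adj touch (points \<omega>))\<^sup>*" "int N \<le> fst y" using x(2) by blast
      have "s * of_int (fst y) \<le> fst (pt y) $ a"
        using pt(2)[OF y(1)] by (auto simp: \<Gamma>_def cube_def emb_def dest: spec[of _ a])
      moreover have "real n \<le> s * of_int (fst y)"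
      proof -
        have "real N \<le> of_int (fst y)" using y(3) by linarith
        then have "real n / s \<le> of_int (fst y)" using N by linarith
        then show ?thesis using s by (simp add: pos_divide_le_eq mult.commute)
      qed
      moreover have "fst (pt y) $ a \<le> norm (fst (pt y))" using component_le_norm_cart[of "fst (pt y)" a] by simp
      ultimately have "real n \<le> norm (fst (pt y))" by linarith
      then show "\<exists>y\<in>points \<omega>. (pt x, y) \<in> (adj touch (points \<omega>))\<^sup>* \<and> 0 \<le> snd y \<and> real n \<le> norm (fst y)"
        using y pt points_snd_nonneg[OF \<omega>] by blast
    qed (use x pt points_snd_nonneg[OF \<omega>] in auto)
  qed
qed

end

subsection \<open>Lattice paths\<close>

definition nbhd :: "nat \<Rightarrow> ('n::finite \<Rightarrow> int) \<Rightarrow> ('n \<Rightarrow> int) set" where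
  "nbhd k c = {d. \<forall>i. \<bar>d i - c i\<bar> \<le> int k}"

lemma nbhd_eq_PiE: "nbhd k c = PiE UNIV (\<lambda>i. {c i - int k..c i + int k})"
  by (auto simp: nbhd_def PiE_def Pi_def abs_le_iff) (smt (verit))+

lemma finite_nbhd: "finite (nbhd k c)"
  unfolding nbhd_eq_PiE by (intro finite_PiE) auto

lemma card_nbhd: "card (nbhd k (c :: 'n::finite \<Rightarrow> int)) = (2 * k + 1) ^ CARD('n)"
proof -
  have "card {c i - int k..c i + int k} = 2 * k + 1" for i by simp
  then show ?thesis unfolding nbhd_eq_PiE by (simp only: card_PiE finite prod_constant)
qed

text \<open>The start \<open>c\<close> is not listed, since its cell need not be occupied. Staying
  in place is allowed, so each step has exactly \<open>3 ^ CARD('n)\<close> choices.\<close>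

fun paths :: "nat \<Rightarrow> ('n::finite \<Rightarrow> int) \<Rightarrow> ('n \<Rightarrow> int) list set" where
  "paths 0 c = {[]}"
| "paths (Suc n) c = (\<Union>d\<in>nbhd 1 c. (#) d ` paths n d)"

lemma finite_paths: "finite (paths n c)"
  by (induction n arbitrary: c) (auto intro: finite_nbhd)

lemma card_paths_le: "card (paths n (c :: 'n::finite \<Rightarrow> int)) \<le> (3 ^ CARD('n)) ^ n"
proof (induction n arbitrary: c)
  case (Suc n)
  have "card (paths (Suc n) c) \<le> (\<Sum>d\<in>nbhd 1 c. card ((#) d ` paths n d))"
    unfolding paths.simps by (rule card_UN_le[OF finite_nbhd])
  also have "\<dots> \<le> (\<Sum>d\<in>nbhd 1 c. (3 ^ CARD('n)) ^ n)"
    using Suc.IH card_image_le[OF finite_paths] order_trans by (intro sum_mono) blast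
  also have "\<dots> = (3 ^ CARD('n)) ^ Suc n" by (simp add: card_nbhd numeral_3_eq_3)
  finally show ?case .
qed simp

lemma paths_length: "l \<in> paths n c \<Longrightarrow> length l = n"
  by (induction n arbitrary: c l) auto

lemma successively_paths:
  "successively (\<lambda>c d. d \<in> nbhd 1 c) (c # l) \<Longrightarrow> l \<in> paths (length l) c"
proof (induction l arbitrary: c)
  case (Cons d l)
  then have "d \<in> nbhd 1 c" "l \<in> paths (length l) d" by auto
  then show ?case by auto
qed simp

lemma successively_displacement:
  "successively (\<lambda>c d. d \<in> nbhd 1 c) (c # l) \<Longrightarrow> \<bar>last (c # l) i - c i\<bar> \<le> int (length l)"
proof (induction l arbitrary: c)
  case (Cons d l)
  then have "\<bar>d i - c i\<bar> \<le> 1" "\<bar>last (d # l) i - d i\<bar> \<le> int (length l)" by (auto simp: nbhd_def)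
  then have "\<bar>last (d # l) i - c i\<bar> \<le> int (length l) + 1" by linarith
  then show ?case by simp
qed simp

text \<open>Loop erasure: if the new start already occurs, the path is shortened to the part from
  that occurrence on.\<close>

lemma rtrancl_distinct_path:
  assumes "(u, v) \<in> E\<^sup>*"
  shows "\<exists>l. distinct (u # l) \<and> successively (\<lambda>a b. (a, b) \<in> E) (u # l) \<and> last (u # l) = v"
  using assms
proof (induction rule: converse_rtrancl_induct)
  case base
  then show ?case by (intro exI[of _ "[]"]) simp
next
  case (step u w)
  then obtain l where l: "distinct (w # l)" "successively (\<lambda>a b. (a, b) \<in> E) (w # l)" "last (w # l) = v" by blast
  show ?case
  proof (cases "u \<in> set (w # l)")
    case False
    then show ?thesis using l step(1) by (intro exI[of _ "w # l"]) simp
  next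
    case True
    then obtain xs ys where s: "w # l = xs @ u # ys" using split_list by metis
    have "distinct (u # ys)" using l(1) unfolding s by simp
    moreover have "successively (\<lambda>a b. (a, b) \<in> E) (u # ys)"
      using l(2) unfolding s by (simp add: successively_append_iff)
    moreover have "last (u # ys) = v" using l(3) unfolding s by simp
    ultimately show ?thesis by blast
  qed
qed

lemma power_over_exp_tendsto: "(\<lambda>k. (2 * real k + 1) ^ e / 2 ^ k) \<longlonglongrightarrow> 0"
proof -
  \<comment> \<open>Chosen so that \<open>exp (b * (2 * k + 1))\<close> is \<open>2 ^ k\<close> up
    to a constant, which reduces the claim to a power over an exponential.\<close>
  define b :: real where "b = ln 2 / 2"
  have b: "0 < b" by (simp add: b_def)
  have lim: "filterlim (\<lambda>k. b * (2 * real k + 1)) at_top sequentially"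
    using b by real_asymp
  have "(\<lambda>k. (b * (2 * real k + 1)) ^ e / exp (b * (2 * real k + 1))) \<longlonglongrightarrow> 0"
    by (rule filterlim_compose[OF tendsto_power_div_exp_0 lim])
  then have "(\<lambda>k. (exp b / b ^ e) * ((b * (2 * real k + 1)) ^ e / exp (b * (2 * real k + 1)))) \<longlonglongrightarrow> (exp b / b ^ e) * 0"
    by (intro tendsto_mult tendsto_const)
  moreover have "(exp b / b ^ e) * ((b * (2 * real k + 1)) ^ e / exp (b * (2 * real k + 1))) = (2 * real k + 1) ^ e / 2 ^ k" for k
  proof -
    have "exp (b * (2 * real k + 1)) = exp (real k * ln 2) * exp b" by (simp add: b_def algebra_simps flip: exp_add)
    also have "exp (real k * ln 2) = 2 ^ k" by (simp add: exp_of_nat_mult)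
    finally show ?thesis using b by (simp add: power_mult_distrib)
  qed
  ultimately show ?thesis by simp
qed

text \<open>\<open>n ^ n / fact n\<close> is a single term of the exponential series at
  \<open>n\<close>.\<close>

lemma power_le_exp_fact:
  assumes "0 \<le> x" shows "x ^ n / fact n \<le> (exp 1 * x / real n) ^ n"
proof (cases "n = 0")
  case False
  have "real n ^ n / fact n \<le> exp (real n)"
  proof -
    have "(\<lambda>k. real n ^ k / fact k) sums exp (real n)"
      using exp_converges[of "real n"] by (simp add: scaleR_conv_of_real field_simps)
    then have "(\<Sum>k\<in>{n}. real n ^ k / fact k) \<le> exp (real n)"
      by (metis (no_types, lifting) sums_iff sum_le_suminf finite.emptyI finite.insertI divide_nonneg_nonneg of_nat_0_le_iff zero_le_power fact_ge_zero)
    then show ?thesis by simp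
  qed
  then have "real n ^ n / fact n * (x / real n) ^ n \<le> exp (real n) * (x / real n) ^ n"
    using assms by (intro mult_right_mono) auto
  moreover have "exp (real n) = exp 1 ^ n" by (simp add: exp_of_nat_mult[of n 1, simplified])
  ultimately show ?thesis using False by (simp add: power_mult_distrib power_divide)
qed simp

context crcm
begin

subsection \<open>Cells\<close>

text \<open>Balls of radius at most \<open>R\<^sub>0\<close> touch only if their centres are within
  \<open>2 * R\<^sub>0\<close>, so touching points lie in equal or neighbouring cells.\<close>

definition cell :: "('n \<Rightarrow> int) \<Rightarrow> ((real ^ 'n) \<times> real) set" where
  "cell c = cube (2 * R\<^sub>0) 0 c \<times> {0..R\<^sub>0}"

definition cells :: "('n \<Rightarrow> int) set \<Rightarrow> ((real ^ 'n) \<times> real) set" where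
  "cells S = (\<Union>c\<in>S. cell c)"

lemma cell_meas: "cell c \<in> sets borel" "bounded (cell c)"
  unfolding cell_def by (intro cylinder_cube; simp)+

lemma cells_meas: "finite S \<Longrightarrow> cells S \<in> sets borel" "finite S \<Longrightarrow> bounded (cells S)"
  unfolding cells_def using cell_meas by auto

lemma cell_disjoint: "c \<noteq> d \<Longrightarrow> cell c \<inter> cell d = {}"
  using cube_disjoint[of "2 * R\<^sub>0" c d 0] R0_pos by (simp add: cell_def Times_Int_Times)

text \<open>\<open>measure\<close> returns 0 on sets of infinite measure, so the larger set must be
  shown to have finite measure; a cylinder over a ball dominates it.\<close>

lemma mu_mono:
  assumes "\<Gamma> \<subseteq> \<Gamma>'" "\<Gamma> \<in> sets borel" "\<Gamma>' \<in> sets borel" "bounded \<Gamma>'"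
  shows "mu \<Gamma> \<le> mu \<Gamma>'"
proof -
  obtain B where "fst ` \<Gamma>' \<subseteq> cball 0 B" using bounded_fst[OF assms(4)] by (rule bounded_subset_cballE)
  moreover have "space Q = UNIV" using sets_eq_imp_space_eq[OF sets_Q] by simp
  ultimately have sub: "\<Gamma>' \<subseteq> cball 0 B \<times> space Q" by force
  have "cball (0 :: real ^ 'n) B \<times> space Q \<in> sets (lborel \<Otimes>\<^sub>M Q)" by (intro pair_measureI) auto
  with sub have "emeasure (lborel \<Otimes>\<^sub>M Q) \<Gamma>' \<le> emeasure (lborel \<Otimes>\<^sub>M Q) (cball (0 :: real ^ 'n) B \<times> space Q)"
    by (rule emeasure_mono)
  also have "\<dots> = emeasure lborel (cball (0 :: real ^ 'n) B) * emeasure Q (space Q)"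
    by (intro Q.emeasure_pair_measure_Times) auto
  also have "\<dots> < \<infinity>" using Q.emeasure_space_1 emeasure_bounded_finite[of "cball (0 :: real ^ 'n) B"] by simp
  finally have "\<Gamma>' \<in> fmeasurable (lborel \<Otimes>\<^sub>M Q)" using assms sets_lborel_Q by (auto simp: fmeasurable_def)
  then show ?thesis
    unfolding mu_def using z_pos assms sets_lborel_Q by (intro mult_left_mono measure_mono_fmeasurable) auto
qed

lemma mu_cell: "mu (cell c) = z * (2 * R\<^sub>0) ^ CARD('n)"
  using R0_pos Q_R0 by (simp add: cell_def mu_cube measure_def)

lemma mu_cells_le:
  assumes "finite S" shows "mu (cells S) \<le> real (card S) * (z * (2 * R\<^sub>0) ^ CARD('n))"
proof -
  have "measure (lborel \<Otimes>\<^sub>M Q) (cells S) \<le> (\<Sum>c\<in>S. measure (lborel \<Otimes>\<^sub>M Q) (cell c))"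
    unfolding cells_def using assms cell_meas sets_lborel_Q by (intro measure_UNION_le) auto
  then have "mu (cells S) \<le> (\<Sum>c\<in>S. mu (cell c))"
    using z_pos by (simp add: mu_def sum_distrib_left[symmetric])
  then show ?thesis by (simp add: mu_cell)
qed

lemma point_in_cell:
  assumes "tame R\<^sub>0 \<omega>" "p \<in> points \<omega>" "fst p \<in> cube (2 * R\<^sub>0) 0 c" shows "p \<in> cell c"
  using assms points_snd_nonneg[OF tame_configurations[OF assms(1)] assms(2)]
  by (cases p) (auto simp: cell_def tame_def)

lemma touch_cells_close:
  assumes "p \<in> cell c" "w \<in> cell d" "touch p w" shows "c \<in> nbhd 1 d"
proof -
  have "0 \<le> snd p" "0 \<le> snd w" "snd p \<le> R\<^sub>0" "snd w \<le> R\<^sub>0" using assms by (auto simp: cell_def)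
  then have "dist (fst p) (fst w) \<le> 2 * R\<^sub>0 * of_int 1" using assms(3) by (simp add: touch_iff)
  then have "\<bar>c i - d i\<bar> \<le> 1" for i
    using assms R0_pos by (intro cube_index_close[of "2 * R\<^sub>0" "fst p" 0 c "fst w"]) (auto simp: cell_def)
  then show ?thesis by (simp add: nbhd_def)
qed

subsection \<open>A uniform tail bound for the number of points in a cell\<close>

text \<open>Jointly with any event outside \<open>\<Gamma> c\<close>, that region is vacant with at
  most the fraction \<open>vacancy m\<close>, so filling it keeps at least the rest. The event
  \<open>B\<close> stays arbitrary so that it can later prescribe the number of points in a
  cell.\<close>

lemma prob_all_filled_ge:
  assumes S: "finite S" "\<And>c. c \<in> S \<Longrightarrow> \<Gamma> c \<in> sets borel" "\<And>c. c \<in> S \<Longrightarrow> bounded (\<Gamma> c)"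
    and disj: "\<And>c d. c \<in> S \<Longrightarrow> d \<in> S \<Longrightarrow> c \<noteq> d \<Longrightarrow> \<Gamma> c \<inter> \<Gamma> d = {}"
    and m: "\<And>c. c \<in> S \<Longrightarrow> mu (\<Gamma> c) = m"
    and clique: "\<And>c p w. \<lbrakk>c \<in> S; p \<in> \<Gamma> c; w \<in> \<Gamma> c; 0 \<le> snd p; 0 \<le> snd w\<rbrakk> \<Longrightarrow> touch p w"
    and m0: "0 < m"
    and B: "\<And>c. c \<in> S \<Longrightarrow> local_event (- \<Gamma> c) B" "B \<in> sets conf_algebra"
  shows "(1 - vacancy m) ^ card S * measure P B \<le>
    measure P ((configurations \<inter> (\<Inter>c\<in>S. {\<omega>\<in>configurations. cnt \<omega> (\<Gamma> c) \<noteq> 0})) \<inter> B)"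
  using S disj m clique B(1)
proof (induction S)
  case empty
  have "configurations \<inter> B = B" using sets.sets_into_space[OF B(2)] by auto
  then show ?case by simp
next
  case (insert c S)
  let ?F = "\<lambda>c. {\<omega>\<in>configurations. cnt \<omega> (\<Gamma> c) \<noteq> 0}" and ?E = "{\<omega>\<in>configurations. cnt \<omega> (\<Gamma> c) = 0}"
  let ?B = "(configurations \<inter> (\<Inter>c\<in>S. ?F c)) \<inter> B"
  have loc: "local_event (- \<Gamma> c) ?B"
  proof (rule local_event_Int[OF local_event_INT])
    fix d assume d: "d \<in> S"
    then have "\<Gamma> d \<inter> \<Gamma> c = {}" using insert.prems(3)[of d c] insert.hyps by auto
    then show "local_event (- \<Gamma> c) (?F d)"
      using insert.prems(1)[of c] insert.prems(1)[of d] insert.prems(2)[of d] d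
      by (intro local_event_cnt) auto
  next
    show "local_event (- \<Gamma> c) B" by (rule insert.prems(6)) simp
  next
    show "- \<Gamma> c \<in> sets borel" using insert.prems(1)[of c] by auto
  qed (rule insert.hyps)
  have IH: "(1 - vacancy m) ^ card S * measure P B \<le> measure P ?B"
    by (rule insert.IH; rule insert.prems; simp)
  have "measure P (?E \<inter> ?B) \<le> vacancy (mu (\<Gamma> c)) * measure P ?B"
  proof (rule prob_vacant_le[OF _ _ loc])
    show "touch p w" if "p \<in> \<Gamma> c" "w \<in> \<Gamma> c" "0 \<le> snd p" "0 \<le> snd w" for p w
      by (rule insert.prems(5)[OF insertI1 that])
  qed (rule insert.prems; simp)+
  then have vac: "measure P (?E \<inter> ?B) \<le> vacancy m * measure P ?B" using insert.prems(4)[of c] by simp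
  have sB: "?B \<in> sets P" unfolding sets_P by (rule local_event_sets[OF loc])
  have "\<Gamma> c \<in> sets borel" "bounded (\<Gamma> c)" using insert.prems(1,2)[of c] by simp_all
  then have sE: "?E \<in> sets P" unfolding sets_P by (intro cnt_event)
  have eq: "(configurations \<inter> (\<Inter>c\<in>insert c S. ?F c)) \<inter> B = ?B - ?E" by auto
  have "measure P (?B - ?E) = measure P ?B - measure P (?B \<inter> ?E)"
    using sB sE by (rule P.finite_measure_Diff')
  then have "(1 - vacancy m) * measure P ?B \<le> measure P (?B - ?E)"
    using vac by (simp add: Int_commute left_diff_distrib)
  moreover have "(1 - vacancy m) * ((1 - vacancy m) ^ card S * measure P B) \<le> (1 - vacancy m) * measure P ?B"
    using IH vacancy_less_1[OF m0] by (intro mult_left_mono) auto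
  ultimately show ?case unfolding eq using insert.hyps by (simp add: mult.assoc)
qed

lemma prob_cnt_ge:
  assumes \<Gamma>: "\<Gamma> \<in> sets borel" "bounded \<Gamma>"
    and le: "\<And>j. measure P {\<omega>\<in>configurations. cnt \<omega> \<Gamma> = j} \<le> C * (\<mu> ^ j / fact j)"
    and \<mu>: "0 \<le> \<mu>" "\<mu> \<le> 1" and "0 \<le> C" "0 < t"
  shows "measure P {\<omega>\<in>configurations. t \<le> real (cnt \<omega> \<Gamma>)} \<le> C * exp 1 / t"
proof -
  define m where "m = nat \<lceil>t\<rceil>"
  have m: "t \<le> real m" "0 < m" using \<open>0 < t\<close> by (simp_all add: m_def)
  let ?A = "\<lambda>j. {\<omega>\<in>configurations. cnt \<omega> \<Gamma> = j + m}"
  have eq: "{\<omega>\<in>configurations. t \<le> real (cnt \<omega> \<Gamma>)} = (\<Union>j. ?A j)"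
  proof (intro equalityI subsetI)
    fix \<omega> assume \<omega>: "\<omega> \<in> {\<omega>\<in>configurations. t \<le> real (cnt \<omega> \<Gamma>)}"
    then have "m \<le> cnt \<omega> \<Gamma>" unfolding m_def by (simp add: nat_le_iff ceiling_le_iff)
    then have "\<omega> \<in> ?A (cnt \<omega> \<Gamma> - m)" using \<omega> by simp
    then show "\<omega> \<in> (\<Union>j. ?A j)" by blast
  qed (use m in auto)
  have A: "?A j \<in> sets P" for j unfolding sets_P by (intro cnt_event \<Gamma>)
  have sums: "(\<lambda>j. measure P (?A j)) sums measure P (\<Union>j. ?A j)"
    using A by (intro P.finite_measure_UNION) (auto simp: disjoint_family_on_def)
  have bound: "measure P (?A j) \<le> C / t * (1 / fact j)" for j
  proof -
    have "measure P (?A j) \<le> C * (\<mu> ^ (j + m) / fact (j + m))" by (rule le)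
    \<comment> \<open>One factor of \<open>fact (j + m)\<close> is at least \<open>t\<close>; the
      others dominate \<open>fact j\<close>, which leaves a summable series.\<close>
    also have "\<dots> \<le> C * (1 / (t * fact j))"
    proof (intro mult_left_mono frac_le)
      show "\<mu> ^ (j + m) \<le> 1" using \<mu> by (simp add: power_le_one)
      obtain m' where m': "m = Suc m'" using m(2) by (cases m) auto
      have "t * fact j \<le> real m * fact j" using m(1) by (intro mult_right_mono) auto
      also have "\<dots> \<le> real (j + m) * fact (j + m')"
        by (intro mult_mono fact_mono) auto
      also have "\<dots> = fact (j + m)" by (simp add: m')
      finally show "t * fact j \<le> fact (j + m)" .
    qed (use assms in auto)
    also have "\<dots> = C / t * (1 / fact j)" by simp
    finally show ?thesis .
  qed
  have "(\<lambda>j. 1 / fact j :: real) sums exp 1" using exp_converges[of "1 :: real"] by (simp add: field_simps)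
  then have "(\<lambda>j. C / t * (1 / fact j)) sums (C / t * exp 1)" by (rule sums_mult)
  from sums_le[OF bound sums this] have "measure P (\<Union>j. ?A j) \<le> C / t * exp 1" .
  then show ?thesis unfolding eq by simp
qed

text \<open>
  Large balls centred in small cubes around a cell cover a neighbourhood of the cell and then
  merge everything that the points of the cell can touch. Two disjoint families of such small
  cubes are used, so that every point of the cell lies outside at least one of the two families.
\<close>

lemma prob_cell_tail:
  assumes r: "0 < r" and \<beta>: "0 < measure Q {r..R\<^sub>0}" and small: "z * (2 * R\<^sub>0) ^ CARD('n) \<le> 1"
  shows "\<exists>K. \<forall>c t. 0 < t \<longrightarrow> measure P {\<omega>\<in>configurations. t \<le> real (cnt \<omega> (cell c))} \<le> K / t"
proof -
  obtain a0 :: 'n where True by blast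
  \<comment> \<open>Half the usual side: a ball of radius at least \<open>r\<close> centred in a
    small cube then covers all adjacent small cubes.\<close>
  define s where "s = r / (2 * CARD('n))"
  have s: "0 < s" using r by (simp add: s_def)
  \<comment> \<open>A ball centred in the cell stays within \<open>3 * R\<^sub>0\<close> of the
    corner in each coordinate; the additional 2 leaves room for rounding and for the parity shift
    below.\<close>
  define N where "N = nat \<lceil>3 * R\<^sub>0 / s\<rceil> + 2"
  \<comment> \<open>The parity of one coordinate splits the small cubes into the two disjoint
    families.\<close>
  define I where "I b = {g \<in> nbhd N (\<lambda>_::'n. 0). even (g a0) = b}" for b
  have I: "finite (I b)" "card (I b) \<le> card (nbhd N (\<lambda>_::'n. 0))" for b
    using finite_nbhd[of N "\<lambda>_::'n. 0"] by (auto simp: I_def intro: card_mono)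
  define M where "M = card (nbhd N (\<lambda>_::'n. 0))"
  define m where "m = z * s ^ CARD('n) * measure Q {r..R\<^sub>0}"
  have m: "0 < m" using z_pos s \<beta> by (simp add: m_def)
  define \<mu> where "\<mu> = z * (2 * R\<^sub>0) ^ CARD('n)"
  have \<mu>: "0 \<le> \<mu>" "\<mu> \<le> 1" using small z_pos R0_pos by (auto simp: \<mu>_def)
  \<comment> \<open>Each of at most \<open>M\<close> cubes costs \<open>1 / (1 - vacancy m)\<close>
    for being filled and \<open>1 / q\<close> for the component it may merge.\<close>
  define C where "C = (1 / ((1 - vacancy m) * q)) ^ M"
  have v: "0 < (1 - vacancy m) * q" "(1 - vacancy m) * q \<le> 1"
    using vacancy_less_1[OF m] vacancy_nonneg[of m] m q_pos q_less by (auto intro: mult_le_one)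
  then have C0: "0 \<le> C" by (simp add: C_def)
  have "measure P {\<omega>\<in>configurations. t \<le> real (cnt \<omega> (cell c))} \<le> (4 * C * exp 1) / t" if t: "0 < t" for c t
  proof -
    define o' where "o' = (\<chi> i. 2 * R\<^sub>0 * of_int (c i))"
    define D where "D g = cube s o' g \<times> {r..R\<^sub>0}" for g
    have D: "D g \<in> sets borel" "bounded (D g)" for g unfolding D_def by (intro cylinder_cube; simp)+
    have D_disj: "D g \<inter> D g' = {}" if "g \<noteq> g'" for g g'
      using cube_disjoint[OF s that] by (simp add: D_def Times_Int_Times)
    have muD: "mu (D g) = m" for g using s by (simp add: D_def m_def mu_cube)
    have D_clique: "touch p w" if "p \<in> D g" "w \<in> D g" for p w g
    proof -
      have "dist (fst p) (fst w) \<le> s * (of_int 0 + 1) * CARD('n)"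
        using that s by (intro dist_cube_le[of s _ o' g _ g]) (auto simp: D_def)
      also have "\<dots> \<le> r" using r by (simp add: s_def)
      also have "\<dots> \<le> snd p + snd w" using that r by (auto simp: D_def)
      finally show ?thesis using that r by (subst touch_iff) (auto simp: D_def)
    qed
    \<comment> \<open>Every point \<open>y\<close> reached from the cell lies in all balls centred
      in a suitable cube of either family, so one ball per cube suffices.\<close>
    have D_cover: "\<exists>g\<in>I b. \<forall>p\<in>D g. y \<in> germ_ball p"
      if y: "x \<in> cube (2 * R\<^sub>0) 0 c" "dist x y \<le> R\<^sub>0" for x y b
    proof -
      define g0 where "g0 i = \<lfloor>(y $ i - o' $ i) / s\<rfloor>" for i
      have y0: "y \<in> cube s o' g0" using s by (simp add: cube_eq_floor g0_def[abs_def])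
      have g0: "\<bar>g0 i\<bar> \<le> int N - 1" for i
      proof -
        have "\<bar>x $ i - y $ i\<bar> \<le> R\<^sub>0"
          using y(2) component_le_norm_cart[of "x - y" i] by (simp add: dist_norm)
        moreover have "o' $ i \<le> x $ i" "x $ i < o' $ i + 2 * R\<^sub>0"
          using y(1) by (auto simp: cube_def o'_def algebra_simps)
        ultimately have "\<bar>y $ i - o' $ i\<bar> \<le> 3 * R\<^sub>0" by linarith
        then have "\<bar>(y $ i - o' $ i) / s\<bar> \<le> 3 * R\<^sub>0 / s" using s by (simp add: abs_divide divide_right_mono)
        then have "\<bar>(y $ i - o' $ i) / s\<bar> \<le> of_int \<lceil>3 * R\<^sub>0 / s\<rceil>" by linarith
        moreover have "int N - 1 = \<lceil>3 * R\<^sub>0 / s\<rceil> + 1" 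
        proof -
          have "0 < 3 * R\<^sub>0 / s" using R0_pos s by simp
          then have "0 \<le> \<lceil>3 * R\<^sub>0 / s\<rceil>" by linarith
          then show ?thesis unfolding N_def by linarith
        qed
        ultimately show ?thesis unfolding g0_def by linarith
      qed
      \<comment> \<open>If the cube of \<open>y\<close> has the wrong parity, an adjacent one is
        used.\<close>
      define g where "g = (if even (g0 a0) = b then g0 else g0(a0 := g0 a0 + 1))"
      have gd: "\<bar>g i - g0 i\<bar> \<le> 1" for i by (simp add: g_def)
      have "\<bar>g i\<bar> \<le> int N" for i using g0[of i] gd[of i] by linarith
      then have "g \<in> I b" by (auto simp: I_def nbhd_def g_def)
      moreover have "y \<in> germ_ball p" if p: "p \<in> D g" for p
      proof -
        have "dist (fst p) y \<le> s * (of_int 1 + 1) * CARD('n)"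
          using p s y0 gd by (intro dist_cube_le[of s _ o' g _ g0]) (auto simp: D_def)
        also have "\<dots> = r" by (simp add: s_def)
        also have "\<dots> \<le> snd p" using p by (auto simp: D_def)
        finally show ?thesis by (simp add: germ_ball_def)
      qed
      ultimately show ?thesis by blast
    qed
    \<comment> \<open>The cubes of the family are removed from the cell, so that filling them is an
      event outside \<open>G b\<close>.\<close>
    define G where "G b = cell c - (\<Union>g\<in>I b. D g)" for b
    have G: "G b \<in> sets borel" "bounded (G b)" "G b \<subseteq> cell c" for b
    proof -
      have "(\<Union>g\<in>I b. D g) \<in> sets borel" using I D by (intro sets.finite_UN) auto
      then show "G b \<in> sets borel" unfolding G_def using cell_meas(1)[of c] by auto
      show "G b \<subseteq> cell c" by (auto simp: G_def)
      then show "bounded (G b)" using cell_meas(2) by (rule bounded_subset[rotated])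
    qed
    have single: "measure P {\<omega>\<in>configurations. cnt \<omega> (G b) = j} \<le> C * (\<mu> ^ j / fact j)" for b j
    proof -
      let ?A = "{\<omega>\<in>configurations. cnt \<omega> (G b) = j}"
      let ?H = "configurations \<inter> (\<Inter>g\<in>I b. {\<omega>\<in>configurations. cnt \<omega> (D g) \<noteq> 0})"
      have DG: "D g \<inter> G b = {}" if "g \<in> I b" for g using that by (auto simp: G_def)
      have A: "local_event (G b) ?A" using G by (intro local_event_cnt) auto
      have H: "local_event (- G b) ?H"
        using I DG D G by (intro local_event_INT local_event_cnt) auto
      have fill: "(1 - vacancy m) ^ card (I b) * measure P ?A \<le> measure P (?H \<inter> ?A)"
      proof (rule prob_all_filled_ge[OF I(1) D D_disj muD D_clique m])
        show "local_event (- D g) ?A" if "g \<in> I b" for g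
          using DG[OF that] D G by (intro local_event_cnt) auto
        show "?A \<in> sets conf_algebra" by (rule local_event_sets[OF A])
      qed
      have "measure P (?A \<inter> ?H) \<le> (1 / q) ^ card (I b) * exp (mu (G b)) * measure \<pi> ?A * measure P ?H"
      proof (rule prob_le_merging[OF G(1,2) A H])
        fix a \<zeta> assume a: "tame R\<^sub>0 a" "points a \<subseteq> G b" and \<zeta>: "tame R\<^sub>0 \<zeta>" "\<zeta> \<in> ?H"
        note \<zeta>c = tame_configurations[OF \<zeta>(1)]
        have ne: "points \<zeta> \<inter> D g \<noteq> {}" if "g \<in> I b" for g
        proof -
          have "cnt \<zeta> (D g) \<noteq> 0" using \<zeta>(2) that by simp
          then show ?thesis using cnt_eq_0_iff[OF \<zeta>c D(2,1)] by simp
        qed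
        \<comment> \<open>One ball per filled cube: these form the set \<open>Y\<close> of the
          merging estimate.\<close>
        define f where "f g = (SOME p. p \<in> points \<zeta> \<inter> D g)" for g
        have f: "f g \<in> points \<zeta> \<inter> D g" if "g \<in> I b" for g
          unfolding f_def by (rule someI_ex) (use ne[OF that] in blast)
        show "\<exists>Y. finite Y \<and> Y \<subseteq> points \<zeta> \<and> card Y \<le> card (I b) \<and>
          (\<forall>p\<in>points \<zeta>. \<forall>w\<in>points a. touch p w \<longrightarrow> (\<exists>y\<in>Y. touch p y))"
        proof (intro exI[of _ "f ` I b"] conjI ballI impI)
          show "finite (f ` I b)" "card (f ` I b) \<le> card (I b)" using I by (auto intro: card_image_le)
          show "f ` I b \<subseteq> points \<zeta>" using f by auto
          fix p w assume p: "p \<in> points \<zeta>" and w: "w \<in> points a" and t: "touch p w"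
          obtain y where y: "y \<in> germ_ball p" "y \<in> germ_ball w" using t by (auto simp: touch_def)
          have "w \<in> cell c" using w a G(3) by blast
          then have "fst w \<in> cube (2 * R\<^sub>0) 0 c" "dist (fst w) y \<le> R\<^sub>0"
            using y(2) by (auto simp: cell_def germ_ball_def)
          from D_cover[OF this] obtain g where g: "g \<in> I b" "\<forall>p\<in>D g. y \<in> germ_ball p" by blast
          then have "touch p (f g)" using f[OF g(1)] y(1) unfolding touch_def by blast
          then show "\<exists>y\<in>f ` I b. touch p y" using g(1) by blast
        qed
      qed
      also have "\<dots> \<le> (1 / q) ^ card (I b) * exp (mu (G b)) * measure \<pi> ?A * 1"
        using q_pos by (intro mult_left_mono) auto
      also have "\<dots> = (1 / q) ^ card (I b) * (mu (G b) ^ j / fact j)"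
        by (subst prob_cnt[OF G(2,1)]) (simp add: exp_minus)
      also have "\<dots> \<le> (1 / q) ^ card (I b) * (\<mu> ^ j / fact j)"
      proof -
        have "mu (G b) \<le> \<mu>"
          using mu_mono[OF G(3) G(1) cell_meas] mu_cell[of c] by (simp add: \<mu>_def)
        then show ?thesis using q_pos mu_nonneg
          by (intro mult_left_mono divide_right_mono power_mono) auto
      qed
      finally have "(1 - vacancy m) ^ card (I b) * measure P ?A \<le> (1 / q) ^ card (I b) * (\<mu> ^ j / fact j)"
        using fill by (simp add: Int_commute)
      then have "measure P ?A \<le> (1 / q) ^ card (I b) * (\<mu> ^ j / fact j) / (1 - vacancy m) ^ card (I b)"
        using vacancy_less_1[OF m] by (subst pos_le_divide_eq) (simp_all add: mult.commute)
      also have "\<dots> = (1 / ((1 - vacancy m) * q)) ^ card (I b) * (\<mu> ^ j / fact j)"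
        by (simp add: power_mult_distrib power_divide)
      also have "\<dots> \<le> C * (\<mu> ^ j / fact j)"
        unfolding C_def M_def using v I(2) \<mu> by (intro mult_right_mono power_increasing) auto
      finally show ?thesis .
    qed
    have half: "measure P {\<omega>\<in>configurations. t / 2 \<le> real (cnt \<omega> (G b))} \<le> C * exp 1 / (t / 2)" for b
      using t by (intro prob_cnt_ge[OF G(1,2) single \<mu> C0]) simp
    have ev: "{\<omega>\<in>configurations. t / 2 \<le> real (cnt \<omega> (G b))} \<in> sets P" for b
      unfolding sets_P by (intro cnt_event G)
    have "{\<omega>\<in>configurations. t \<le> real (cnt \<omega> (cell c))} \<subseteq>
      {\<omega>\<in>configurations. t / 2 \<le> real (cnt \<omega> (G True))} \<union> {\<omega>\<in>configurations. t / 2 \<le> real (cnt \<omega> (G False))}"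
    proof
      fix \<omega> assume \<omega>: "\<omega> \<in> {\<omega>\<in>configurations. t \<le> real (cnt \<omega> (cell c))}"
      then have oc: "\<omega> \<in> configurations" by simp
      \<comment> \<open>A point of the cell missing from \<open>G True\<close> lies in a cube of
        that family, hence in no cube of the other. So one of the two parts contains at least half
        of the points of the cell.\<close>
      have "cell c - G True \<subseteq> G False"
      proof
        fix p assume p: "p \<in> cell c - G True"
        then obtain g where g: "g \<in> I True" "p \<in> D g" by (auto simp: G_def)
        have "p \<notin> D g'" if "g' \<in> I False" for g'
          using D_disj[of g g'] g that by (auto simp: I_def)
        then show "p \<in> G False" using p by (auto simp: G_def)
      qed
      then have "cnt \<omega> (cell c - G True) \<le> cnt \<omega> (G False)"
        using G cell_meas(1)[of c] by (intro cnt_mono[OF oc]) auto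
      moreover have "cnt \<omega> (cell c) = cnt \<omega> (G True) + cnt \<omega> (cell c - G True)"
        using G cell_meas by (intro cnt_Diff[OF oc]) auto
      ultimately have "cnt \<omega> (cell c) \<le> cnt \<omega> (G True) + cnt \<omega> (G False)" by linarith
      then have "real (cnt \<omega> (cell c)) \<le> real (cnt \<omega> (G True)) + real (cnt \<omega> (G False))" by linarith
      then have "t / 2 \<le> real (cnt \<omega> (G True)) \<or> t / 2 \<le> real (cnt \<omega> (G False))"
        using \<omega> by (simp; linarith)
      then show "\<omega> \<in> {\<omega>\<in>configurations. t / 2 \<le> real (cnt \<omega> (G True))} \<union> {\<omega>\<in>configurations. t / 2 \<le> real (cnt \<omega> (G False))}"
        using oc by simp
    qed
    then have "measure P {\<omega>\<in>configurations. t \<le> real (cnt \<omega> (cell c))} \<le>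
      measure P ({\<omega>\<in>configurations. t / 2 \<le> real (cnt \<omega> (G True))} \<union> {\<omega>\<in>configurations. t / 2 \<le> real (cnt \<omega> (G False))})"
      using ev by (intro P.finite_measure_mono) auto
    also have "\<dots> \<le> measure P {\<omega>\<in>configurations. t / 2 \<le> real (cnt \<omega> (G True))} + measure P {\<omega>\<in>configurations. t / 2 \<le> real (cnt \<omega> (G False))}"
      by (rule measure_Un_le[OF ev ev])
    also have "\<dots> \<le> C * exp 1 / (t / 2) + C * exp 1 / (t / 2)" by (intro add_mono half)
    also have "\<dots> = (4 * C * exp 1) / t" by simp
    finally show ?thesis .
  qed
  then show ?thesis by blast
qed

end

lemma successively_predecessor:
  "successively (\<lambda>a b. (a, b) \<in> E) (u # l) \<Longrightarrow> c \<in> set l \<Longrightarrow> \<exists>a. (a, c) \<in> E"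
  by (induction l arbitrary: u) auto

context crcm
begin

subsection \<open>Absence of percolation at low intensity\<close>

definition fatten :: "('n \<Rightarrow> int) set \<Rightarrow> nat \<Rightarrow> ('n \<Rightarrow> int) set" where
  "fatten S k = (\<Union>c\<in>S. nbhd k c)"

lemma fatten_0: "fatten S 0 = S"
proof -
  have "nbhd 0 c = {c}" for c :: "'n \<Rightarrow> int" by (auto simp: nbhd_def)
  then show ?thesis by (simp add: fatten_def)
qed

lemma fatten_mono: "k \<le> l \<Longrightarrow> fatten S k \<subseteq> fatten S l"
proof -
  assume kl: "k \<le> l"
  have "nbhd k c \<subseteq> nbhd l c" for c :: "'n \<Rightarrow> int"
  proof
    fix d assume d: "d \<in> nbhd k c"
    have "\<bar>d i - c i\<bar> \<le> int l" for i
    proof -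
      have "\<bar>d i - c i\<bar> \<le> int k" using d by (simp add: nbhd_def)
      then show ?thesis using kl by linarith
    qed
    then show "d \<in> nbhd l c" by (simp add: nbhd_def)
  qed
  then show ?thesis unfolding fatten_def by (intro UN_mono) auto
qed

lemma finite_fatten: "finite S \<Longrightarrow> finite (fatten S k)"
  by (simp add: fatten_def finite_nbhd)

lemma card_fatten_le:
  assumes "finite S" shows "card (fatten S k) \<le> (2 * k + 1) ^ CARD('n) * card S"
proof -
  have "card (fatten S k) \<le> (\<Sum>c\<in>S. card (nbhd k c))" unfolding fatten_def by (rule card_UN_le[OF assms])
  then show ?thesis by (simp add: card_nbhd mult.commute)
qed

lemma nbhd_fatten_Suc: "d \<in> fatten S k \<Longrightarrow> c \<in> nbhd 1 d \<Longrightarrow> c \<in> fatten S (Suc k)"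
proof -
  assume "d \<in> fatten S k" "c \<in> nbhd 1 d"
  then obtain e where e: "e \<in> S" "\<And>i. \<bar>d i - e i\<bar> \<le> int k" "\<And>i. \<bar>c i - d i\<bar> \<le> 1"
    by (auto simp: fatten_def nbhd_def)
  have "\<bar>c i - e i\<bar> \<le> int (Suc k)" for i using e(2)[of i] e(3)[of i] by linarith
  then show ?thesis using e(1) by (auto simp: fatten_def nbhd_def)
qed

lemma cells_mono: "S \<subseteq> T \<Longrightarrow> cells S \<subseteq> cells T"
  by (auto simp: cells_def)

text \<open>
  Every outside component that a point in the cells of \<open>T\<close> can touch contains a point of the
  shell \<open>T' - T\<close>, so at most \<open>M\<close> components are merged.
\<close>

lemma prob_crowded_le:
  fixes S :: "('n \<Rightarrow> int) set"
  assumes S: "finite S" and T_def: "T = fatten S k" and T'_def: "T' = fatten S (Suc k)"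
  shows "measure P ({\<omega>\<in>configurations. cnt \<omega> (cells T) = M} \<inter> {\<omega>\<in>configurations. cnt \<omega> (cells T' - cells T) \<le> M})
    \<le> (mu (cells T) / q) ^ M / fact M"
proof -
  have T: "finite T" "finite T'" "T \<subseteq> T'"
    unfolding T_def T'_def using S finite_fatten fatten_mono[of k "Suc k"] by auto
  note mT = cells_meas[OF T(1)] and mT' = cells_meas[OF T(2)]
  let ?A = "{\<omega>\<in>configurations. cnt \<omega> (cells T) = M}" and ?B = "{\<omega>\<in>configurations. cnt \<omega> (cells T' - cells T) \<le> M}"
  have shell: "cells T' - cells T \<in> sets borel" "bounded (cells T' - cells T)"
    using mT mT' by (auto intro: bounded_subset)
  have "measure P (?A \<inter> ?B) \<le> (1 / q) ^ M * exp (mu (cells T)) * measure \<pi> ?A * measure P ?B"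
  proof (rule prob_le_merging[OF mT])
    show "local_event (cells T) ?A" using mT by (intro local_event_cnt) auto
    show "local_event (- cells T) ?B" using mT shell by (intro local_event_cnt) auto
    fix a \<zeta> assume a: "tame R\<^sub>0 a" "points a \<subseteq> cells T" and \<zeta>: "tame R\<^sub>0 \<zeta>" "points \<zeta> \<inter> cells T = {}" "\<zeta> \<in> ?B"
    note \<zeta>c = tame_configurations[OF \<zeta>(1)]
    let ?Y = "points \<zeta> \<inter> (cells T' - cells T)"
    show "\<exists>Y. finite Y \<and> Y \<subseteq> points \<zeta> \<and> card Y \<le> M \<and>
        (\<forall>p\<in>points \<zeta>. \<forall>w\<in>points a. touch p w \<longrightarrow> (\<exists>y\<in>Y. touch p y))"
    proof (intro exI[of _ ?Y] conjI ballI impI)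
      show "finite ?Y" by (rule finite_points[OF \<zeta>c shell(2,1)])
      show "card ?Y \<le> M" using card_points_le_cnt[OF \<zeta>c shell(2,1)] \<zeta>(3) by simp
      fix p w assume p: "p \<in> points \<zeta>" and w: "w \<in> points a" and t: "touch p w"
      obtain d where d: "d \<in> T" "w \<in> cell d" using w a by (auto simp: cells_def)
      obtain c where "fst p \<in> cube (2 * R\<^sub>0) 0 c" using cube_ex[of "2 * R\<^sub>0" "fst p" 0] R0_pos by auto
      then have c: "p \<in> cell c" by (rule point_in_cell[OF \<zeta>(1) p])
      have "c \<in> nbhd 1 d" by (rule touch_cells_close[OF c d(2) t])
      then have "c \<in> T'" using d(1) unfolding T_def T'_def by (rule nbhd_fatten_Suc[rotated])
      then have "p \<in> ?Y" using c p \<zeta>(2) by (auto simp: cells_def)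
      \<comment> \<open>Whatever touches the interior lies in the shell itself, so \<open>p\<close>
        can serve as its own representative.\<close>
      moreover have "touch p p" using points_snd_nonneg[OF \<zeta>c p] by (simp add: touch_iff)
      ultimately show "\<exists>y\<in>?Y. touch p y" by blast
    qed auto
  qed
  also have "\<dots> \<le> (1 / q) ^ M * exp (mu (cells T)) * measure \<pi> ?A * 1"
    using q_pos by (intro mult_left_mono) auto
  also have "\<dots> = (mu (cells T) / q) ^ M / fact M"
    by (subst prob_cnt[OF mT(2,1)]) (simp add: exp_minus power_divide)
  finally show ?thesis .
qed

definition occupied :: "('n \<Rightarrow> int) set \<Rightarrow> 'n conf set" where
  "occupied S = configurations \<inter> (\<Inter>c\<in>S. {\<omega>\<in>configurations. cnt \<omega> (cell c) \<noteq> 0})"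

lemma occupied_sets: "finite S \<Longrightarrow> occupied S \<in> sets conf_algebra"
proof -
  assume "finite S"
  then have "local_event UNIV (occupied S)"
    unfolding occupied_def using cell_meas by (intro local_event_INT local_event_cnt) auto
  then show ?thesis by (rule local_event_sets)
qed

lemma card_le_cnt_occupied:
  assumes "finite S" "\<omega> \<in> occupied S" shows "card S \<le> cnt \<omega> (cells S)"
proof -
  have oc: "\<omega> \<in> configurations" using assms(2) by (auto simp: occupied_def)
  have "cnt \<omega> (cells S) = (\<Sum>c\<in>S. cnt \<omega> (cell c))"
    unfolding cells_def using assms cell_meas cell_disjoint
    by (intro cnt_UNION[OF oc]) (auto simp: disjoint_family_on_def)
  also have "\<dots> \<ge> (\<Sum>c\<in>S. 1)"
  proof (rule sum_mono)
    fix c assume "c \<in> S"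
    then have "cnt \<omega> (cell c) \<noteq> 0" using assms(2) by (auto simp: occupied_def)
    then show "1 \<le> cnt \<omega> (cell c)" by simp
  qed
  finally show ?thesis by simp
qed

text \<open>If the count is at least \<open>2 ^ k * card S\<close>, some cell of the
  \<open>k\<close>-neighbourhood has at least the average \<open>t\<close>. The tail bound and a
  union bound give the square of the volume factor over \<open>2 ^ k\<close>, which tends to
  0.\<close>

lemma prob_dense_null:
  assumes S: "finite S" "S \<noteq> {}" and r: "0 < r" "0 < measure Q {r..R\<^sub>0}" and small: "z * (2 * R\<^sub>0) ^ CARD('n) \<le> 1"
  shows "measure P {\<omega>\<in>configurations. \<forall>k. 2 ^ k * card S \<le> cnt \<omega> (cells (fatten S k))} = 0"
proof -
  let ?d = "CARD('n)" and ?n = "card S"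
  have n: "0 < ?n" using S by (simp add: card_gt_0_iff)
  let ?D = "{\<omega>\<in>configurations. \<forall>k. 2 ^ k * ?n \<le> cnt \<omega> (cells (fatten S k))}"
  obtain K where K: "\<And>c t. 0 < t \<Longrightarrow> measure P {\<omega>\<in>configurations. t \<le> real (cnt \<omega> (cell c))} \<le> K / t"
    using prob_cell_tail[OF r small] by blast
  have K0: "0 \<le> K" using order_trans[OF measure_nonneg K[of 1 "\<lambda>_. 0"]] by simp
  have le: "measure P ?D \<le> real ?n * K * ((2 * real k + 1) ^ (2 * ?d) / 2 ^ k)" for k
  proof -
    let ?T = "fatten S k"
    note fT = finite_fatten[OF S(1), of k]
    define t where "t = 2 ^ k / (2 * real k + 1) ^ ?d"
    have t: "0 < t" by (simp add: t_def)
    let ?E = "\<lambda>c. {\<omega>\<in>configurations. t \<le> real (cnt \<omega> (cell c))}"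
    have cT: "real (card ?T) \<le> (2 * real k + 1) ^ ?d * real ?n"
      using of_nat_mono[OF card_fatten_le[OF S(1), of k], where 'a = real] by (simp add: add.commute)
    have "?D \<subseteq> (\<Union>c\<in>?T. ?E c)"
    proof
      fix \<omega> assume \<omega>: "\<omega> \<in> ?D"
      then have oc: "\<omega> \<in> configurations" by simp
      show "\<omega> \<in> (\<Union>c\<in>?T. ?E c)"
      proof (rule ccontr)
        assume "\<omega> \<notin> (\<Union>c\<in>?T. ?E c)"
        then have lt: "real (cnt \<omega> (cell c)) < t" if "c \<in> ?T" for c using that oc by (auto simp: not_le)
        have "?T \<noteq> {}" using fatten_mono[of 0 k S] S(2) by (auto simp: fatten_0)
        have "cnt \<omega> (cells ?T) = (\<Sum>c\<in>?T. cnt \<omega> (cell c))"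
          unfolding cells_def using fT cell_meas cell_disjoint
          by (intro cnt_UNION[OF oc]) (auto simp: disjoint_family_on_def)
        then have "real (cnt \<omega> (cells ?T)) = (\<Sum>c\<in>?T. real (cnt \<omega> (cell c)))" by simp
        also have "\<dots> < (\<Sum>c\<in>?T. t)" using lt fT \<open>?T \<noteq> {}\<close> by (intro sum_strict_mono) auto
        also have "\<dots> = real (card ?T) * t" by simp
        also have "\<dots> \<le> (2 * real k + 1) ^ ?d * real ?n * t" using cT t by (intro mult_right_mono) auto
        also have "\<dots> = 2 ^ k * real ?n" by (simp add: t_def)
        finally have "real (cnt \<omega> (cells ?T)) < real (2 ^ k * ?n)" by simp
        then show False using \<omega> by (simp add: not_less[symmetric] del: of_nat_mult of_nat_power)
      qed
    qed
    then have "measure P ?D \<le> measure P (\<Union>c\<in>?T. ?E c)"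
      using fT cell_meas by (intro P.finite_measure_mono sets.finite_UN) (auto simp: sets_P intro!: cnt_event)
    also have "\<dots> \<le> (\<Sum>c\<in>?T. measure P (?E c))"
      using fT cell_meas by (intro measure_UNION_le) (auto simp: sets_P intro!: cnt_event)
    also have "\<dots> \<le> (\<Sum>c\<in>?T. K / t)" by (intro sum_mono K t)
    also have "\<dots> = real (card ?T) * (K / t)" by simp
    also have "\<dots> \<le> (2 * real k + 1) ^ ?d * real ?n * (K / t)"
      using cT K0 t by (intro mult_right_mono) auto
    also have "\<dots> = real ?n * K * ((2 * real k + 1) ^ (2 * ?d) / 2 ^ k)"
    proof -
      have "(2 * real k + 1) ^ (2 * ?d) = (2 * real k + 1) ^ ?d * (2 * real k + 1) ^ ?d"
        by (simp only: mult_2 power_add)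
      then show ?thesis by (simp add: t_def)
    qed
    finally show ?thesis .
  qed
  have "(\<lambda>k. real ?n * K * ((2 * real k + 1) ^ (2 * ?d) / 2 ^ k)) \<longlonglongrightarrow> real ?n * K * 0"
    by (intro tendsto_mult tendsto_const power_over_exp_tendsto)
  then have "measure P ?D \<le> real ?n * K * 0" by (rule LIMSEQ_le_const) (use le in blast)
  then show ?thesis using measure_nonneg[of P ?D] by (simp add: order_antisym)
qed

text \<open>The constant \<open>C\<close> bounds the volume factor
  \<open>(2 * k + 1) ^ CARD('n)\<close> by \<open>C * 2 ^ k\<close> at all scales, so a single
  \<rho> works for every \<open>k\<close>. The factor 4 comes from two geometric series, over the
  scale \<open>k\<close> and over the excess \<open>j\<close>.\<close>

lemma prob_occupied_le:
  assumes S: "finite S" "S \<noteq> {}" and r: "0 < r" "0 < measure Q {r..R\<^sub>0}"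
    and small: "z * (2 * R\<^sub>0) ^ CARD('n) \<le> 1"
    and C: "\<And>k::nat. (2 * real k + 1) ^ CARD('n) \<le> C * 2 ^ k"
    and \<rho>: "\<rho> = exp 1 * (z * (2 * R\<^sub>0) ^ CARD('n)) * C / q" "\<rho> \<le> 1 / 2"
  shows "measure P (occupied S) \<le> 4 * \<rho> ^ card S"
proof -
  let ?d = "CARD('n)" and ?n = "card S"
  define v where "v = z * (2 * R\<^sub>0) ^ ?d"
  have v: "0 < v" using z_pos R0_pos by (simp add: v_def)
  have n: "1 \<le> ?n" using S by (simp add: Suc_le_eq card_gt_0_iff)
  have C0: "0 < C" using C[of 0] by simp
  have \<rho>0: "0 < \<rho>" unfolding \<rho>(1) using v C0 q_pos by (simp add: v_def)
  let ?T = "fatten S"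
  let ?M = "\<lambda>k \<omega>. cnt \<omega> (cells (?T k))"
  let ?shell = "\<lambda>k. cells (?T (Suc k)) - cells (?T k)"
  have fT: "finite (?T k)" for k by (rule finite_fatten[OF S(1)])
  note mT = cells_meas[OF fT]
  have sub: "cells (?T k) \<subseteq> cells (?T (Suc k))" for k by (intro cells_mono fatten_mono) simp
  have mshell: "?shell k \<in> sets borel" "bounded (?shell k)" for k
    using mT[of k] mT[of "Suc k"] by (auto intro: bounded_subset)
  \<comment> \<open>The count at scale \<open>k\<close> exceeds the doubling threshold by exactly
    \<open>j\<close>, and the shell is no richer.\<close>
  define A where "A k j = {\<omega>\<in>configurations. ?M k \<omega> = 2 ^ k * ?n + j} \<inter> {\<omega>\<in>configurations. cnt \<omega> (?shell k) \<le> 2 ^ k * ?n + j}" for k j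
  have A: "A k j \<in> sets P" for k j
    unfolding A_def sets_P by (intro sets.Int cnt_event mT mshell)
  have A_le: "measure P (A k j) \<le> \<rho> ^ ((k + 1) * ?n) * (1 / 2) ^ j" for k j
  proof -
    let ?m = "2 ^ k * ?n + j"
    have m: "0 < ?m" using n by simp
    have mu0: "0 \<le> mu (cells (?T k)) / q" using mu_nonneg q_pos by simp
    have "measure P (A k j) \<le> (mu (cells (?T k)) / q) ^ ?m / fact ?m"
      unfolding A_def by (rule prob_crowded_le[OF S(1) refl refl])
    also have "\<dots> \<le> (exp 1 * (mu (cells (?T k)) / q) / real ?m) ^ ?m" by (rule power_le_exp_fact[OF mu0])
    also have "\<dots> \<le> \<rho> ^ ?m"
    proof (rule power_mono)
      \<comment> \<open>The expected number of points grows at most like \<open>C\<close> times the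
        prescribed count \<open>?m\<close>, so the base of the power stays below \<rho> at every
        scale.\<close>
      have "mu (cells (?T k)) \<le> real (card (?T k)) * v" unfolding v_def by (rule mu_cells_le[OF fT])
      also have "\<dots> \<le> ((2 * real k + 1) ^ ?d * real ?n) * v"
        using of_nat_mono[OF card_fatten_le[OF S(1), of k], where 'a = real] v
        by (intro mult_right_mono) (auto simp: add.commute)
      also have "\<dots> \<le> (C * 2 ^ k * real ?n) * v" using C[of k] v by (intro mult_right_mono) auto
      also have "\<dots> \<le> C * real ?m * v" using C0 v by (intro mult_right_mono) auto
      finally have "exp 1 * (mu (cells (?T k)) / q) \<le> exp 1 * ((C * real ?m * v) / q)"
        using q_pos by (intro mult_left_mono divide_right_mono) auto
      also have "\<dots> = \<rho> * real ?m" by (simp add: \<rho>(1) v_def)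
      finally have "exp 1 * (mu (cells (?T k)) / q) \<le> \<rho> * real ?m" .
      moreover have "0 < real ?m" using m by (simp only: of_nat_0_less_iff)
      ultimately show "exp 1 * (mu (cells (?T k)) / q) / real ?m \<le> \<rho>" by (simp only: pos_divide_le_eq)
      show "0 \<le> exp 1 * (mu (cells (?T k)) / q) / real ?m"
        by (intro divide_nonneg_nonneg mult_nonneg_nonneg mu0) auto
    qed
    also have "\<dots> = \<rho> ^ (2 ^ k * ?n) * \<rho> ^ j" by (rule power_add)
    \<comment> \<open>The doubly exponential decay is weakened by \<open>k + 1 \<le> 2 ^ k\<close>
      to a geometric one; one power \<open>\<rho> ^ card S\<close> remains after summation.\<close>
    also have "\<dots> \<le> \<rho> ^ ((k + 1) * ?n) * (1 / 2) ^ j"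
    proof (rule mult_mono)
      have "k + 1 \<le> 2 ^ k" by (induction k) auto
      then have "(k + 1) * ?n \<le> 2 ^ k * ?n" by (rule mult_right_mono) simp
      then show "\<rho> ^ (2 ^ k * ?n) \<le> \<rho> ^ ((k + 1) * ?n)"
        using \<rho>0 \<rho>(2) by (intro power_decreasing) auto
      show "\<rho> ^ j \<le> (1 / 2) ^ j" using \<rho>0 \<rho>(2) by (intro power_mono) auto
    qed (use \<rho>0 in auto)
    finally show ?thesis .
  qed
  have geo: "(\<lambda>j. (1 / 2) ^ j :: real) sums 2" using geometric_sums[of "1 / 2 :: real"] by simp
  define St where "St k = (\<Union>j. A k j)" for k
  have St: "St k \<in> sets P" for k unfolding St_def using A by auto
  have St_le: "measure P (St k) \<le> 2 * \<rho> ^ ?n * (1 / 2) ^ k" for k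
  proof -
    have bsum: "(\<lambda>j. \<rho> ^ ((k + 1) * ?n) * (1 / 2) ^ j) sums (\<rho> ^ ((k + 1) * ?n) * 2)" by (rule sums_mult[OF geo])
    have Asum: "summable (\<lambda>j. measure P (A k j))"
      by (rule summable_comparison_test'[OF sums_summable[OF bsum], of 0]) (use A_le[of k] in simp)
    have "measure P (St k) \<le> (\<Sum>j. measure P (A k j))"
      unfolding St_def using A Asum by (intro P.finite_measure_subadditive_countably) auto
    also have "\<dots> \<le> \<rho> ^ ((k + 1) * ?n) * 2"
      unfolding sums_unique[OF bsum] by (rule suminf_le[OF A_le Asum sums_summable[OF bsum]])
    also have "\<dots> = 2 * \<rho> ^ ?n * \<rho> ^ (k * ?n)" by (simp add: power_add algebra_simps)
    also have "\<dots> \<le> 2 * \<rho> ^ ?n * (1 / 2) ^ k"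
    proof (rule mult_left_mono)
      have "\<rho> ^ (k * ?n) \<le> (1 / 2) ^ (k * ?n)" using \<rho>0 \<rho>(2) by (intro power_mono) auto
      also have "\<dots> \<le> (1 / 2) ^ k" using n by (intro power_decreasing) auto
      finally show "\<rho> ^ (k * ?n) \<le> (1 / 2) ^ k" .
    qed (use \<rho>0 in simp)
    finally show ?thesis .
  qed
  have bsum: "(\<lambda>k. 2 * \<rho> ^ ?n * (1 / 2) ^ k) sums (2 * \<rho> ^ ?n * 2)" by (rule sums_mult[OF geo])
  have Ssum: "summable (\<lambda>k. measure P (St k))"
    by (rule summable_comparison_test'[OF sums_summable[OF bsum], of 0]) (use St_le in simp)
  have "measure P (\<Union>k. St k) \<le> (\<Sum>k. measure P (St k))"
    using St Ssum by (intro P.finite_measure_subadditive_countably) auto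
  also have "\<dots> \<le> 2 * \<rho> ^ ?n * 2"
    unfolding sums_unique[OF bsum] by (rule suminf_le[OF St_le Ssum sums_summable[OF bsum]])
  finally have St_all: "measure P (\<Union>k. St k) \<le> 4 * \<rho> ^ ?n" by simp
  let ?D = "{\<omega>\<in>configurations. \<forall>k. 2 ^ k * ?n \<le> ?M k \<omega>}"
  have "?D = (\<Inter>k. {\<omega>\<in>configurations. 2 ^ k * ?n \<le> ?M k \<omega>})" by auto
  also have "\<dots> \<in> sets P" unfolding sets_P by (intro sets.countable_INT) (auto intro!: cnt_event mT)
  finally have D: "?D \<in> sets P" .
  have "occupied S \<subseteq> (\<Union>k. St k) \<union> ?D"
  proof
    fix \<omega> assume \<omega>: "\<omega> \<in> occupied S"
    then have oc: "\<omega> \<in> configurations" by (auto simp: occupied_def)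
    show "\<omega> \<in> (\<Union>k. St k) \<union> ?D"
    proof (rule ccontr)
      assume no: "\<omega> \<notin> (\<Union>k. St k) \<union> ?D"
      have "2 ^ k * ?n \<le> ?M k \<omega>" for k
      proof (induction k)
        case 0
        then show ?case using card_le_cnt_occupied[OF S(1) \<omega>] by (simp add: fatten_0)
      next
        case (Suc k)
        have "\<omega> \<notin> A k (?M k \<omega> - 2 ^ k * ?n)" using no by (auto simp: St_def)
        then have "?M k \<omega> < cnt \<omega> (?shell k)" using Suc oc by (auto simp: A_def not_le)
        moreover have "?M (Suc k) \<omega> = ?M k \<omega> + cnt \<omega> (?shell k)"
          by (rule cnt_Diff[OF oc mT(2) mT(1) mT(1) sub])
        ultimately show ?case using Suc by simp
      qed
      then show False using no oc by blast
    qed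
  qed
  then have "measure P (occupied S) \<le> measure P ((\<Union>k. St k) \<union> ?D)"
    using St D by (intro P.finite_measure_mono sets.Un sets.countable_UN) auto
  also have "\<dots> \<le> measure P (\<Union>k. St k) + measure P ?D"
    using St D by (intro measure_Un_le) auto
  also have "measure P ?D = 0" by (rule prob_dense_null[OF S r small])
  finally show ?thesis using St_all by simp
qed

text \<open>A chain of touching balls projects to a walk through adjacent occupied cells; loop
  erasure keeps its endpoints, and distant endpoints force the erased path to be long.\<close>

lemma percolates_occupied_path:
  assumes \<omega>: "tame R\<^sub>0 \<omega>" and perc: "percolates \<omega>"
  shows "\<exists>c. \<forall>n. \<exists>l\<in>paths n c. distinct l \<and> \<omega> \<in> occupied (set l)"
proof -
  note oc = tame_configurations[OF \<omega>]
  let ?h = "2 * R\<^sub>0"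
  have h: "0 < ?h" using R0_pos by simp
  obtain Cc where Cc: "Cc \<in> conn_components \<omega>" "\<not> bounded Cc" using perc by (auto simp: percolates_def)
  obtain x where x: "Cc = {y. connected_in \<omega> x y}" using Cc(1) by (auto simp: conn_components_def quotient_def)
  define idx where "idx y = (\<lambda>i. \<lfloor>(y $ i - (0 :: real ^ 'n) $ i) / ?h\<rfloor>)" for y :: "real ^ 'n"
  have idx: "y \<in> cube ?h 0 (idx y)" for y by (simp add: idx_def cube_eq_floor[OF h])
  have idx_cell: "p \<in> cell (idx (fst p))" if "p \<in> points \<omega>" for p by (rule point_in_cell[OF \<omega> that idx])
  have ball_near: "\<bar>idx y i - idx (fst p) i\<bar> \<le> 1" if "p \<in> points \<omega>" "y \<in> germ_ball p" for p y i
  proof (rule cube_index_close[OF h idx idx])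
    have "dist y (fst p) \<le> R\<^sub>0"
      using that \<omega> unfolding germ_ball_def tame_def by (force simp: dist_commute)
    then show "dist y (fst p) \<le> ?h * of_int 1" using R0_pos by simp
  qed
  define E where "E = {(c, d). points \<omega> \<inter> cell c \<noteq> {} \<and> points \<omega> \<inter> cell d \<noteq> {} \<and> d \<in> nbhd 1 c}"
  have walk: "(idx (fst p), idx (fst p')) \<in> E\<^sup>*" if "(p, p') \<in> (adj touch (points \<omega>))\<^sup>*" for p p'
    using that
  proof induction
    case (step u w)
    then have uw: "u \<in> points \<omega>" "w \<in> points \<omega>" "touch w u" by (auto simp: adj_def intro: touch.T_sym)
    have "idx (fst w) \<in> nbhd 1 (idx (fst u))"
      by (rule touch_cells_close[OF idx_cell idx_cell]) (use uw in auto)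
    moreover have "u \<in> points \<omega> \<inter> cell (idx (fst u))" "w \<in> points \<omega> \<inter> cell (idx (fst w))"
      using uw idx_cell by blast+
    ultimately have "(idx (fst u), idx (fst w)) \<in> E" unfolding E_def by blast
    with step.IH show ?case by (rule rtrancl_into_rtrancl)
  qed simp
  have "\<exists>l\<in>paths n (idx x). distinct l \<and> \<omega> \<in> occupied (set l)" for n
  proof -
    \<comment> \<open>The margin 2 accounts for the passage from \<open>x\<close> and from
      \<open>y\<close> to the centres of the balls containing them, one cell each.\<close>
    have "\<exists>y\<in>Cc. \<exists>i. int n + 2 < \<bar>idx y i - idx x i\<bar>"
    proof (rule ccontr)
      assume "\<not> ?thesis"
      then have "dist y x \<le> ?h * (of_int (int n + 2) + 1) * CARD('n)" if "y \<in> Cc" for y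
        using that by (intro dist_cube_le[OF h idx idx]) (auto simp: not_less)
      then have "Cc \<subseteq> cball x (?h * (of_int (int n + 2) + 1) * CARD('n))" by (auto simp: dist_commute)
      then show False using Cc(2) bounded_subset[OF bounded_cball] by blast
    qed
    then obtain y i where y: "y \<in> Cc" "int n + 2 < \<bar>idx y i - idx x i\<bar>" by blast
    then obtain p p' where p: "p \<in> points \<omega>" "x \<in> germ_ball p" "y \<in> germ_ball p'"
      "(p, p') \<in> (adj touch (points \<omega>))\<^sup>*" unfolding x by (auto simp: connected_in_iff)
    have p': "p' \<in> points \<omega>" using p(4,1) by (induction rule: rtrancl_induct) (auto simp: adj_def)
    let ?u = "idx (fst p)" and ?v = "idx (fst p')"
    from rtrancl_distinct_path[OF walk[OF p(4)]] obtain l where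
      l: "distinct (?u # l)" "successively (\<lambda>a b. (a, b) \<in> E) (?u # l)" "last (?u # l) = ?v" by blast
    have succ: "successively (\<lambda>c d. d \<in> nbhd 1 c) (?u # l)"
      using l(2) by (rule successively_mono) (auto simp: E_def)
    have "\<bar>?v i - ?u i\<bar> \<le> int (length l)" using successively_displacement[OF succ, of i] l(3) by simp
    then have len: "n \<le> length (?u # l)"
      using y(2) ball_near[OF p(1,2), of i] ball_near[OF p' p(3), of i] by simp
    \<comment> \<open>Any initial segment of the erased path is again distinct and occupied, so
      exactly \<open>n\<close> cells are kept.\<close>
    define L where "L = take n (?u # l)"
    have Llen: "length L = n" using len by (simp add: L_def)
    have L_sub: "set L \<subseteq> set (?u # l)" unfolding L_def by (rule set_take_subset)
    have "idx (fst p) \<in> nbhd 1 (idx x)" using ball_near[OF p(1,2)] by (auto simp: nbhd_def abs_minus_commute)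
    then have "successively (\<lambda>c d. d \<in> nbhd 1 c) (idx x # ?u # l)" using succ by simp
    moreover have "idx x # ?u # l = (idx x # L) @ drop n (?u # l)" by (simp only: L_def append_Cons append_take_drop_id)
    ultimately have "successively (\<lambda>c d. d \<in> nbhd 1 c) (idx x # L)" by (simp only: successively_append_iff)
    then have "L \<in> paths n (idx x)" using successively_paths[of "idx x" L] Llen by simp
    moreover have "distinct L" unfolding L_def using l(1) by (rule distinct_take)
    moreover have "\<omega> \<in> occupied (set L)"
    proof -
      have occ: "points \<omega> \<inter> cell c \<noteq> {}" if "c \<in> set (?u # l)" for c
      proof -
        have "points \<omega> \<inter> cell ?u \<noteq> {}" using idx_cell p(1) by blast
        moreover have "points \<omega> \<inter> cell c \<noteq> {}" if "c \<in> set l"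
          using successively_predecessor[OF l(2) that] by (auto simp: E_def)
        ultimately show ?thesis using that by auto
      qed
      have "cnt \<omega> (cell c) \<noteq> 0" if "c \<in> set L" for c
      proof -
        have "points \<omega> \<inter> cell c \<noteq> {}" using occ L_sub that by blast
        then show ?thesis using cnt_eq_0_iff[OF oc cell_meas(2,1), of c] by simp
      qed
      then show ?thesis unfolding occupied_def using oc by simp
    qed
    ultimately show ?thesis by blast
  qed
  then show ?thesis by blast
qed

text \<open>The union bound over at most \<open>(3 ^ CARD('n)) ^ n\<close> paths of length
  \<open>n\<close> gives \<open>4 * (1 / 2) ^ n\<close> for each starting cell.\<close>

lemma not_percolates_AE:
  assumes r: "0 < r" "0 < measure Q {r..R\<^sub>0}"
    and small: "z * (2 * R\<^sub>0) ^ CARD('n) \<le> 1"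
    and C: "\<And>k::nat. (2 * real k + 1) ^ CARD('n) \<le> C * 2 ^ k"
    and \<rho>: "\<rho> = exp 1 * (z * (2 * R\<^sub>0) ^ CARD('n)) * C / q" "3 ^ CARD('n) * \<rho> \<le> 1 / 2"
  shows "AE \<omega> in P. \<not> percolates \<omega>"
proof -
  have C0: "0 < C" using C[of 0] by simp
  have \<rho>0: "0 \<le> \<rho>" unfolding \<rho>(1) using z_pos R0_pos C0 q_pos by simp
  have "1 * \<rho> \<le> 3 ^ CARD('n) * \<rho>" using \<rho>0 by (intro mult_right_mono) auto
  then have \<rho>12: "\<rho> \<le> 1 / 2" using \<rho>(2) by simp
  define B where "B n c = (\<Union>l\<in>{l\<in>paths n c. distinct l}. occupied (set l))" for n and c :: "'n \<Rightarrow> int"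
  have fin: "finite {l\<in>paths n c. distinct l}" for n and c :: "'n \<Rightarrow> int" by (rule finite_subset[OF _ finite_paths]) auto
  have B: "B n c \<in> sets P" for n c
    unfolding B_def sets_P by (intro sets.finite_UN fin occupied_sets) simp
  have B_le: "measure P (B (Suc n) c) \<le> 4 * (1 / 2) ^ Suc n" for n c
  proof -
    have "measure P (B (Suc n) c) \<le> (\<Sum>l\<in>{l\<in>paths (Suc n) c. distinct l}. measure P (occupied (set l)))"
      unfolding B_def by (intro measure_UNION_le fin) (simp add: sets_P occupied_sets)
    also have "\<dots> \<le> (\<Sum>l\<in>{l\<in>paths (Suc n) c. distinct l}. 4 * \<rho> ^ Suc n)"
    proof (rule sum_mono)
      fix l assume l: "l \<in> {l\<in>paths (Suc n) c. distinct l}"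
      then have "length l = Suc n" using paths_length by blast
      then have "card (set l) = Suc n" "set l \<noteq> {}" using l by (auto simp: distinct_card)
      then show "measure P (occupied (set l)) \<le> 4 * \<rho> ^ Suc n"
        using prob_occupied_le[OF _ _ r small C \<rho>(1) \<rho>12, of "set l"] by simp
    qed
    also have "\<dots> = real (card {l\<in>paths (Suc n) c. distinct l}) * (4 * \<rho> ^ Suc n)" by simp
    also have "\<dots> \<le> (3 ^ CARD('n)) ^ Suc n * (4 * \<rho> ^ Suc n)"
    proof (rule mult_right_mono)
      have "card {l\<in>paths (Suc n) c. distinct l} \<le> card (paths (Suc n) c)"
        by (intro card_mono finite_paths) auto
      also have "\<dots> \<le> (3 ^ CARD('n)) ^ Suc n" by (rule card_paths_le)
      finally have "real (card {l\<in>paths (Suc n) c. distinct l}) \<le> real ((3 ^ CARD('n)) ^ Suc n)" by (simp only: of_nat_le_iff)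
      then show "real (card {l\<in>paths (Suc n) c. distinct l}) \<le> (3 ^ CARD('n)) ^ Suc n" by simp
    qed (use \<rho>0 in simp)
    also have "\<dots> = 4 * (3 ^ CARD('n) * \<rho>) ^ Suc n" by (simp only: power_mult_distrib mult_ac)
    also have "\<dots> \<le> 4 * (1 / 2) ^ Suc n"
      using \<rho>(2) \<rho>0 by (intro mult_left_mono power_mono) auto
    finally show ?thesis .
  qed
  have "AE \<omega> in P. \<exists>n. \<omega> \<notin> B (Suc n) c" for c
  proof -
    let ?N = "\<Inter>n. B (Suc n) c"
    have N: "?N \<in> sets P" using B by auto
    have le: "measure P ?N \<le> 4 * (1 / 2) ^ Suc n" for n
      using P.finite_measure_mono[OF _ B, of ?N "Suc n" c] B_le[of n c] by (meson INT_lower UNIV_I order_trans)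
    have "(\<lambda>n. 4 * (1 / 2 :: real) ^ Suc n) \<longlonglongrightarrow> 0" by real_asymp
    then have "measure P ?N \<le> 0" by (rule LIMSEQ_le_const) (use le in blast)
    then have "measure P ?N = 0" using measure_nonneg[of P ?N] by linarith
    then have "AE \<omega> in P. \<omega> \<notin> ?N" using N by (intro AE_not_in) (auto simp: null_sets_def P.emeasure_eq_measure)
    then show ?thesis by eventually_elim auto
  qed
  \<comment> \<open>The starting cell depends on the configuration, but there are only countably
    many cells.\<close>
  then have "AE \<omega> in P. \<forall>c. \<exists>n. \<omega> \<notin> B (Suc n) c" by (simp add: AE_all_countable)
  then show ?thesis using AE_P_tame
  proof eventually_elim
    case (elim \<omega>)
    show ?case
    proof
      assume "percolates \<omega>"
      from percolates_occupied_path[OF elim(2) this] obtain c where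
        c: "\<And>n. \<exists>l\<in>paths n c. distinct l \<and> \<omega> \<in> occupied (set l)" by blast
      obtain n where "\<omega> \<notin> B (Suc n) c" using elim(1) by blast
      then show False using c[of "Suc n"] unfolding B_def by blast
    qed
  qed
qed

end

theorem theorem3:
  fixes Q :: "real measure" and q R\<^sub>0 :: real
  assumes "CARD('n::finite) \<ge> 2"
    and "0 < q" and "q < 1"
    and "prob_space Q" and "sets Q = sets borel"
    and "Q \<noteq> return borel 0"
    and "R\<^sub>0 > 0" and "emeasure Q {0..R\<^sub>0} = 1"
  shows "(\<exists>z\<^sub>1\<ge>0. \<forall>z>z\<^sub>1. \<forall>P::'n conf measure. CRCM z Q q P \<longrightarrow> law_percolates P) \<and>
    (\<exists>z\<^sub>0>0. \<forall>z. 0 < z \<and> z < z\<^sub>0 \<longrightarrow>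
       (\<forall>P::'n conf measure. CRCM z Q q P \<longrightarrow> law_not_percolates P))"
proof -
  have crcm: "\<exists>\<pi>. crcm z q R\<^sub>0 Q P \<pi>" if "0 < z" "CRCM z Q q P" for z and P :: "'n conf measure"
  proof -
    note CRCM = that(2)
    obtain \<pi> where P: "prob_space P" "sets P = sets conf_algebra" and \<pi>: "poisson_law z Q \<pi>" and
      D: "\<forall>\<Lambda>\<in>sets borel. bounded \<Lambda> \<longrightarrow>
          (AE \<omega> in P. 0 < partition_fun q \<pi> \<Lambda> (restr (- \<Lambda>) \<omega>) \<and>
                      partition_fun q \<pi> \<Lambda> (restr (- \<Lambda>) \<omega>) < \<infinity>) \<and>
          (\<forall>f::'n conf \<Rightarrow> real.
             f \<in> borel_measurable conf_algebra \<and> (\<exists>B. \<forall>\<omega>\<in>configurations. \<bar>f \<omega>\<bar> \<le> B) \<longrightarrow>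
             (\<integral>\<omega>. f \<omega> \<partial>P) =
             (\<integral>\<omega>. (\<integral>\<omega>'. f (superpose \<omega>' (restr (- \<Lambda>) \<omega>)) *
                       (q powi N_cc_loc \<Lambda> (superpose \<omega>' (restr (- \<Lambda>) \<omega>)) /
                        enn2real (partition_fun q \<pi> \<Lambda> (restr (- \<Lambda>) \<omega>))) \<partial>project \<Lambda> \<pi>) \<partial>P))"
      using CRCM unfolding CRCM_def by (elim conjE exE) blast
    have "crcm z q R\<^sub>0 Q P \<pi>"
    proof (rule crcm.intro)
      fix \<Lambda> :: "(real ^ 'n) set" assume \<Lambda>: "\<Lambda> \<in> sets borel" "bounded \<Lambda>"
      show "AE \<omega> in P. 0 < partition_fun q \<pi> \<Lambda> (restr (- \<Lambda>) \<omega>) \<and>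
          partition_fun q \<pi> \<Lambda> (restr (- \<Lambda>) \<omega>) < \<infinity>"
        by (rule D[THEN bspec, OF \<Lambda>(1), THEN mp, OF \<Lambda>(2), THEN conjunct1])
      fix f :: "'n conf \<Rightarrow> real"
      assume f: "f \<in> borel_measurable conf_algebra" "\<exists>B. \<forall>\<omega>\<in>configurations. \<bar>f \<omega>\<bar> \<le> B"
      show "(\<integral>\<omega>. f \<omega> \<partial>P) = (\<integral>\<omega>. (\<integral>\<omega>'. f (superpose \<omega>' (restr (- \<Lambda>) \<omega>)) *
         (q powi N_cc_loc \<Lambda> (superpose \<omega>' (restr (- \<Lambda>) \<omega>)) /
          enn2real (partition_fun q \<pi> \<Lambda> (restr (- \<Lambda>) \<omega>))) \<partial>project \<Lambda> \<pi>) \<partial>P)"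
        by (rule D[THEN bspec, OF \<Lambda>(1), THEN mp, OF \<Lambda>(2), THEN conjunct2, THEN spec, THEN mp, OF conjI[OF f]])
    qed (fact that(1) assms P \<pi>)+
    then show ?thesis by blast
  qed
  obtain r where r: "0 < r" "0 < measure Q {r..R\<^sub>0}"
    using ex_radius_charged[OF assms(4,5,6,8)] by blast
  \<comment> \<open>The mean number of balls per small cube with radius in
    \<open>{r..R\<^sub>0}\<close>, per unit of intensity.\<close>
  define \<beta> where "\<beta> = (r / CARD('n)) ^ CARD('n) * measure Q {r..R\<^sub>0}"
  have \<beta>: "0 < \<beta>" using r by (simp add: \<beta>_def)
  \<comment> \<open>At \<open>z = ln (162 / q) / \<beta>\<close> the bound
    \<open>81 * exp (- (z * \<beta>)) / q\<close> equals exactly one half.\<close>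
  define z1 where "z1 = max 0 (ln (162 / q) / \<beta>)"
  have high: "law_percolates P" if "z1 < z" "CRCM z Q q P" for z and P :: "'n conf measure"
  proof -
    have z: "0 < z" "ln (162 / q) / \<beta> < z" using that(1) by (auto simp: z1_def)
    from crcm[OF z(1) that(2)] obtain \<pi> where "crcm z q R\<^sub>0 Q P \<pi>" by blast
    then interpret crcm z q R\<^sub>0 Q P \<pi> .
    have "ln (162 / q) < z * \<beta>" using z(2) \<beta> by (simp add: pos_divide_less_eq)
    then have "exp (- (z * \<beta>)) < exp (- ln (162 / q))" by simp
    also have "\<dots> = q / 162" using assms(2) by (simp add: exp_minus)
    finally have "81 * (exp (- (z * \<beta>)) / q) \<le> 1 / 2" using assms(2) by (simp add: pos_divide_le_eq)
    then have "81 * (exp (- (z * (r / CARD('n)) ^ CARD('n) * measure Q {r..R\<^sub>0})) / q) \<le> 1 / 2"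
      unfolding \<beta>_def by (simp only: mult.assoc)
    then show ?thesis unfolding law_percolates_def by (rule percolates_AE[OF assms(1) r])
  qed
  have "Bseq (\<lambda>k. (2 * real k + 1) ^ CARD('n) / 2 ^ k)"
    by (rule convergent_imp_Bseq) (use power_over_exp_tendsto in \<open>auto simp: convergent_def\<close>)
  then obtain C where C: "0 < C" "\<And>k. norm ((2 * real k + 1) ^ CARD('n) / 2 ^ k) \<le> C" by (auto elim: BseqE)
  have C': "(2 * real k + 1) ^ CARD('n) \<le> C * 2 ^ k" for k :: nat
    using C(2)[of k] by (simp add: pos_divide_le_eq)
  define h where "h = (2 * R\<^sub>0) ^ CARD('n)"
  have h: "0 < h" using assms(7) by (simp add: h_def)
  \<comment> \<open>The quantity \<open>3 ^ CARD('n) * \<rho>\<close> per unit of intensity.\<close>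
  define A where "A = 3 ^ CARD('n) * (exp 1 * h * C / q)"
  have A: "0 < A" using h C(1) assms(2) by (simp add: A_def)
  \<comment> \<open>The two bounds keep the Poisson mean of a cell at most 1 and the growth rate of
    the path sum at most one half.\<close>
  define z0 where "z0 = min (1 / h) (1 / (2 * A))"
  have low: "law_not_percolates P" if "0 < z" "z < z0" "CRCM z Q q P" for z and P :: "'n conf measure"
  proof -
    from crcm[OF that(1,3)] obtain \<pi> where "crcm z q R\<^sub>0 Q P \<pi>" by blast
    then interpret crcm z q R\<^sub>0 Q P \<pi> .
    have "z * h \<le> 1" using that(2) h by (simp add: z0_def pos_less_divide_eq)
    moreover have "z * A \<le> 1 / 2" using that(2) A by (simp add: z0_def pos_less_divide_eq)
    then have "3 ^ CARD('n) * (exp 1 * (z * h) * C / q) \<le> 1 / 2" by (simp add: A_def mult_ac)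
    ultimately show ?thesis
      unfolding law_not_percolates_def h_def by (intro not_percolates_AE[OF r _ C' refl])
  qed
  have "0 \<le> z1" "0 < z0" using h A by (simp_all add: z1_def z0_def)
  then show ?thesis using high low by blast
qed

end
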